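(* Consider the modified fully discrete scheme (MFD) given in the context, where $F^n$ and $G^n$ are linear functionals on $V_h$ and $\mathbf W_h$, respectively, with $G^0=0$. There exist positive constants $C$ and $k_0$ such that for $0<k\le k_0$, $m\ge1$, $t_{m+1}\le T$, the solution $\Phi^n=(U^n,\mathbf Q^n,\mathbf Z^n)$ of (MFD) satisfies $$|||\Phi^{m+1/2}|||\le C\Big\{|||\Phi^{1/2}|||+k\sum_{n=0}^{m+1}\|f^n\|+k\sum_{n=1}^m\|F^n\|+k\sum_{n=0}^m\|\partial_tG^{n+1/2}\|\Big\}.$$
   Context: **Data.** $\Omega\subset\mathbb R^2$ is a bounded convex domain, $T>0$. $A(x)$ is a $2\times2$ symmetric positive definite matrix with $(A(x)\xi,\xi)\ge\alpha_0|\xi|^2$ for all $0\ne\xi\in\mathbb R^2$, for some constant $\alpha_0>0$; $A^{1/2}$ is its positive definite square root. $B(x,t,s)$ is a $2\times2$ matrix (written $B(t,s)$). All coefficients of $A$ and $B$ are smooth and bounded, with bounded derivatives, by a constant $M>0$. $f=f(x,t)$ is a given function. Constants denoted $C$ do not depend on $h$ and $p$. **Meshes and spaces.** $\mathcal T_h=\{K_i:1\le i\le N_h\}$, $0<h<1$, is a family of shape regular subdivisions of $\Omega$ into triangles or rectangles (hanging nodes allowed), $h_i=\operatorname{diam}K_i$, $h=\max_ih_i$. To each $K_i$ a degree $p_i\ge1$ is assigned, and $p=\min_ip_i$. Mesh sizes and polynomial degrees are of bounded local variation (ratios $h_i/h_j$ and $p_i/p_j$ of neighbouring elements are bounded above and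 below by positive constants independent of $h$ and the degrees). $\Gamma_I$ is the set of interior edges $e_{ij}=\partial K_i\cap\partial K_j$ of positive length, $\Gamma_\partial$ the set of boundary edges $\partial K_i\cap\partial\Omega$ of positive length, $\Gamma=\Gamma_I\cup\Gamma_\partial$. $V_h=\{v_h\in L^2(\Omega):v_h|_{K_i}\in Z_{p_i}(K_i)\}$, $\mathbf W_h=\{\mathbf w_h\in L^2(\Omega)^2:\mathbf w_h|_{K_i}\in Z_{p_i}(K_i)^2\}$, where $Z_{p_i}(K_i)$ is $P_{p_i}(K_i)$ (total degree $\le p_i$) on triangles and $Q_{p_i}(K_i)$ (degree $\le p_i$ in each variable) on rectangles. $\|\cdot\|$, $(\cdot,\cdot)$ are the $L^2(\Omega)$ norm and inner product. **Jumps and averages.** On $e=\partial K_i\cap\partial K_j\in\Gamma_I$ with outward normals $\boldsymbol\nu_i,\boldsymbol\nu_j$: $[\![v]\!]=v|_{K_i}\boldsymbol\nu_i+v|_{K_j}\boldsymbol\nu_j$, $[\![\mathbf w]\!]=\mathbf w|_{K_i}\cdot\boldsymbol\nu_i+\mathbf w|_{K_j}\cdot\boldsymbol\nu_j$, and $\{\!\{\cdot\}\!\}$ is the arithmetic mean of the two traces. On $e\in\Gamma_\partial$: $[\![v]\!]=v\boldsymbol\nu$, $[\![\mathbf w]\!]=\mathbf w\cdot\boldsymbol\nu$, $\{\!\{v\}\!\}=v$, $\{\!\{\mathbf w\}\!\}=\mathbf w$. **Stabilization parameters.** $\zeta>0$, $\kappa\ge0$, $-1\le\alpha\le0\le\beta\le1$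 are independent of the mesh size. $C_{11}=\zeta\min\{h_i^\alpha/p_i^{2\alpha},h_j^\alpha/p_j^{2\alpha}\}$ on an interior edge between $K_i$ and $K_j$ and $C_{11}=\zeta h_i^\alpha/p_i^{2\alpha}$ on $\partial K_i\cap\partial\Omega$; $C_{22}=\kappa\min\{h_i^\beta/p_i^{2\beta},h_j^\beta/p_j^{2\beta}\}$ on an interior edge between $K_i$ and $K_j$. $C_{12}$ is a single-valued $\mathbb R^2$-valued function on interior edges with $|C_{12}|$ of order one. **Forms.** $\mathcal A(\mathbf p,\mathbf w)=\int_\Omega\mathbf p\cdot\mathbf w\,dx$; $\mathcal A_1(v,\mathbf p)=\sum_i\int_{K_i}\mathbf p\cdot\nabla v\,dx-\int_\Gamma\{\!\{\mathbf p\}\!\}\cdot[\![v]\!]\,ds+\int_{\Gamma_I}(C_{12}\cdot[\![v]\!])[\![\mathbf p]\!]\,ds$; $\mathcal A_2(\mathbf p,\mathbf w)=\int_\Omega A\mathbf p\cdot\mathbf w\,dx$; $\mathcal B(t,s;\mathbf p,\mathbf w)=\int_\Omega B(t,s)\mathbf p\cdot\mathbf w\,dx$; $J_1(\mathbf p,\mathbf w)=\int_{\Gamma_I}C_{22}[\![\mathbf p]\!][\![\mathbf w]\!]\,ds$; $J(\phi,v)=\int_\Gamma C_{11}[\![\phi]\!]\cdot[\![v]\!]\,ds$. **Time discretization.** $0<k<1$, $k=T/N$ with $N$ a positive integer, $t_n=nk$, $t_{j+1/2}=(j+\frac12)k$, $\phi^n=\phi(t_n)$ for functions of time. For a sequence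 $U^n$ (of functions or functionals): $U^{n+1/2}=\frac{U^{n+1}+U^n}2$, $U^{n;1/4}=\frac{U^{n+1}+2U^n+U^{n-1}}4$, $\partial_tU^{n+1/2}=\frac{U^{n+1}-U^n}k$, $\partial_t^2U^n=\frac{U^{n+1}-2U^n+U^{n-1}}{k^2}$. Quadrature: $\boldsymbol\epsilon^n(\mathcal B^n(\mathbf Q,\boldsymbol\chi))=k\sum_{j=0}^{n-1}\mathcal B(t_n,t_{j+1/2};\mathbf Q^{j+1/2},\boldsymbol\chi)$ and $\boldsymbol\epsilon^{n+1/2}(\mathcal B^{n+1/2}(\mathbf Q,\boldsymbol\chi))=\frac12\big[\boldsymbol\epsilon^{n+1}(\mathcal B^{n+1}(\mathbf Q,\boldsymbol\chi))+\boldsymbol\epsilon^n(\mathcal B^n(\mathbf Q,\boldsymbol\chi))\big]$. **Modified scheme (MFD).** $(U^n,\mathbf Q^n,\mathbf Z^n)\in V_h\times\mathbf W_h\times\mathbf W_h$ satisfies, for all $(v_h,\boldsymbol\tau_h,\mathbf w_h)\in V_h\times\mathbf W_h\times\mathbf W_h$, $$\mathcal A(\mathbf Q^{n+1/2},\mathbf w_h)-\mathcal A_1(U^{n+1/2},\mathbf w_h)+J_1(\mathbf Z^{n+1/2},\mathbf w_h)=0,\quad n\ge0,$$ $$\mathcal A_2(\mathbf Q^{n+1/2},\boldsymbol\tau_h)-\mathcal A(\mathbf Z^{n+1/2},\boldsymbol\tau_h)+\boldsymbol\epsilon^{n+1/2}(\mathcal B^{n+1/2}(\mathbf Q,\boldsymbol\tau_h))=G^{n+1/2}(\boldsymbol\tau_h),\quad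 n\ge0,$$ $$(\partial_t^2U^n,v_h)+\mathcal A_1(v_h,\mathbf Z^{n;1/4})+J(U^{n;1/4},v_h)=(f^{n;1/4},v_h)+F^n(v_h),\quad n\ge1.$$ **Norms.** $|||\Phi^{n+1/2}|||^2=\|\partial_tU^{n+1/2}\|^2+\|A^{1/2}\mathbf Q^{n+1/2}\|^2+J_1(\mathbf Z^{n+1/2},\mathbf Z^{n+1/2})+J(U^{n+1/2},U^{n+1/2})$; $\|F^n\|=\sup_{0\ne\chi\in V_h}|F^n(\chi)|/\|\chi\|$, and similarly for functionals on $\mathbf W_h$ (sup over $0\ne\boldsymbol\chi\in\mathbf W_h$). *)

theory Defs
  imports "HOL-Analysis.Analysis"
begin

type_synonym pt = "real^2"
type_synonym mat2 = "real^2^2"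

section \<open>Coefficients\<close>

text \<open>Infinitely differentiable on \<open>S\<close>. Derivatives are taken within \<open>S\<close>, which is one-sided at
  those boundary points (in time) that belong to \<open>S\<close>; the sets used below are convex with
  nonempty interior, so these derivatives are unique.\<close>

coinductive smooth_on :: "'a::euclidean_space set \<Rightarrow> ('a \<Rightarrow> real) \<Rightarrow> bool" for S where
  "\<lbrakk>\<forall>x\<in>S. g differentiable (at x within S);
    \<forall>i\<in>Basis. smooth_on S (\<lambda>x. frechet_derivative g (at x within S) i)\<rbrakk>
   \<Longrightarrow> smooth_on S g"

text \<open>The bound is imposed on the function and its first-order partial derivatives only; this is
  the weakest reading of \<open>smooth and bounded, with bounded derivatives, by M\<close>.\<close>

definition smooth_bounded_on :: "'a::euclidean_space set \<Rightarrow> real \<Rightarrow> ('a \<Rightarrow> real) \<Rightarrow> bool" where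
  "smooth_bounded_on S M g \<longleftrightarrow> smooth_on S g \<and>
     (\<forall>x\<in>S. \<bar>g x\<bar> \<le> M \<and> (\<forall>i\<in>Basis. \<bar>frechet_derivative g (at x within S) i\<bar> \<le> M))"

definition pos_def_matrix :: "mat2 \<Rightarrow> bool" where
  "pos_def_matrix S \<longleftrightarrow> transpose S = S \<and> (\<forall>\<xi>. \<xi> \<noteq> 0 \<longrightarrow> (S *v \<xi>) \<bullet> \<xi> > 0)"

definition matrix_sqrt :: "mat2 \<Rightarrow> mat2" where
  "matrix_sqrt A = (THE S. pos_def_matrix S \<and> S ** S = A)"

definition elliptic_coeff :: "pt set \<Rightarrow> real \<Rightarrow> real \<Rightarrow> (pt \<Rightarrow> mat2) \<Rightarrow> bool" where
  "elliptic_coeff \<Omega> \<alpha>\<^sub>0 M A \<longleftrightarrow>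
     (\<forall>x\<in>\<Omega>. pos_def_matrix (A x) \<and> (\<forall>\<xi>. \<xi> \<noteq> 0 \<longrightarrow> (A x *v \<xi>) \<bullet> \<xi> \<ge> \<alpha>\<^sub>0 * (norm \<xi>)\<^sup>2)) \<and>
     (\<forall>i j. smooth_bounded_on \<Omega> M (\<lambda>x. A x $ i $ j))"

text \<open>The memory kernel \<open>B(x,t,s)\<close> is only ever evaluated for \<open>0 \<le> s \<le> t \<le> T\<close>.\<close>

definition memory_coeff :: "pt set \<Rightarrow> real \<Rightarrow> real \<Rightarrow> (pt \<Rightarrow> real \<Rightarrow> real \<Rightarrow> mat2) \<Rightarrow> bool" where
  "memory_coeff \<Omega> T M B \<longleftrightarrow>
     (\<forall>i j. smooth_bounded_on {(x,t,s). x \<in> \<Omega> \<and> 0 \<le> s \<and> s \<le> t \<and> t \<le> T} M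
              (\<lambda>(x,t,s). B x t s $ i $ j))"


section \<open>The space \<open>L\<^sup>2(\<Omega>)\<close>\<close>

definition L2 :: "pt set \<Rightarrow> (pt \<Rightarrow> 'b::euclidean_space) \<Rightarrow> bool" where
  "L2 \<Omega> u \<longleftrightarrow> u \<in> borel_measurable (lebesgue_on \<Omega>) \<and>
     integrable (lebesgue_on \<Omega>) (\<lambda>x. (norm (u x))\<^sup>2)"

definition L2_inner :: "pt set \<Rightarrow> (pt \<Rightarrow> 'b::euclidean_space) \<Rightarrow> (pt \<Rightarrow> 'b) \<Rightarrow> real" where
  "L2_inner \<Omega> u v = (\<integral>x. u x \<bullet> v x \<partial>lebesgue_on \<Omega>)"

definition L2_norm :: "pt set \<Rightarrow> (pt \<Rightarrow> 'b::euclidean_space) \<Rightarrow> real" where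
  "L2_norm \<Omega> u = sqrt (L2_inner \<Omega> u u)"


section \<open>Meshes\<close>

text \<open>\<open>Triangle a b c\<close> is given by its vertices, \<open>Rectangle a u v\<close> by one vertex \<open>a\<close> and its two
  orthogonal side vectors \<open>u\<close>, \<open>v\<close>; it need not be parallel to the axes.\<close>

datatype element = Triangle pt pt pt | Rectangle pt pt pt

fun region :: "element \<Rightarrow> pt set" where
  "region (Triangle a b c) = convex hull {a, b, c}"
| "region (Rectangle a u v) = convex hull {a, a + u, a + u + v, a + v}"

fun nondegenerate :: "element \<Rightarrow> bool" where
  "nondegenerate (Triangle a b c) \<longleftrightarrow> \<not> collinear {a, b, c}"
| "nondegenerate (Rectangle a u v) \<longleftrightarrow> u \<noteq> 0 \<and> v \<noteq> 0 \<and> u \<bullet> v = 0"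

fun sides :: "element \<Rightarrow> pt set set" where
  "sides (Triangle a b c) = {closed_segment a b, closed_segment b c, closed_segment c a}"
| "sides (Rectangle a u v) =
     {closed_segment a (a + u), closed_segment (a + u) (a + u + v),
      closed_segment (a + u + v) (a + v), closed_segment (a + v) a}"

text \<open>\<open>P\<^sub>r\<close> on triangles and \<open>Q\<^sub>r\<close> on rectangles. The variables of \<open>Q\<^sub>r\<close> are the coordinates along
  the two side directions, i.e. \<open>x\<^sub>1\<close> and \<open>x\<^sub>2\<close> up to scaling on an axis-parallel rectangle.\<close>

fun local_space :: "nat \<Rightarrow> element \<Rightarrow> (pt \<Rightarrow> real) set" where
  "local_space r (Triangle a b c) =
     {q. \<exists>c. q = (\<lambda>x. \<Sum>i\<le>r. \<Sum>j\<le>r - i. c i j * (x $ 1) ^ i * (x $ 2) ^ j)}"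
| "local_space r (Rectangle a u v) =
     {q. \<exists>c. q = (\<lambda>x. \<Sum>i\<le>r. \<Sum>j\<le>r. c i j * (x \<bullet> u) ^ i * (x \<bullet> v) ^ j)}"

definition diam :: "element \<Rightarrow> real" where
  "diam K = diameter (region K)"

definition mesh_size :: "element set \<Rightarrow> real" where
  "mesh_size \<T> = Max (diam ` \<T>)"

definition subdivision :: "pt set \<Rightarrow> element set \<Rightarrow> bool" where
  "subdivision \<Omega> \<T> \<longleftrightarrow> finite \<T> \<and> \<T> \<noteq> {} \<and> (\<forall>K\<in>\<T>. nondegenerate K) \<and>
     (\<Union>K\<in>\<T>. region K) = closure \<Omega> \<and>
     (\<forall>K\<in>\<T>. \<forall>L\<in>\<T>. K \<noteq> L \<longrightarrow> interior (region K) \<inter> interior (region L) = {})"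

definition positive_length :: "pt set \<Rightarrow> bool" where
  "positive_length e \<longleftrightarrow> (\<exists>a b. a \<noteq> b \<and> closed_segment a b \<subseteq> e)"

definition interior_edges :: "element set \<Rightarrow> pt set set" where
  "interior_edges \<T> = {e. \<exists>K\<in>\<T>. \<exists>L\<in>\<T>. K \<noteq> L \<and>
     e = frontier (region K) \<inter> frontier (region L) \<and> positive_length e}"

text \<open>The set \<open>\<partial>K \<inter> \<partial>\<Omega>\<close> may consist of several sides of \<open>K\<close> (at a corner of \<open>\<Omega>\<close>). It is split
  into its straight pieces, each of which has a constant normal.\<close>

definition boundary_edges :: "pt set \<Rightarrow> element set \<Rightarrow> pt set set" where
  "boundary_edges \<Omega> \<T> = {e. \<exists>K\<in>\<T>. \<exists>\<sigma>\<in>sides K. e = \<sigma> \<inter> frontier \<Omega> \<and> positive_length e}"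

definition edges :: "pt set \<Rightarrow> element set \<Rightarrow> pt set set" where
  "edges \<Omega> \<T> = interior_edges \<T> \<union> boundary_edges \<Omega> \<T>"

text \<open>The elements bordering on \<open>e\<close>: two for an interior edge, one for a boundary edge.\<close>

definition adjacent :: "element set \<Rightarrow> pt set \<Rightarrow> element set" where
  "adjacent \<T> e = {K\<in>\<T>. e \<subseteq> frontier (region K)}"

definition shape_regular :: "real \<Rightarrow> element set \<Rightarrow> bool" where
  "shape_regular \<sigma> \<T> \<longleftrightarrow> (\<forall>K\<in>\<T>. \<exists>x. cball x (diam K / \<sigma>) \<subseteq> region K)"

text \<open>The condition is symmetric in the two neighbours, so it bounds the ratios from both sides.\<close>

definition bounded_local_variation :: "real \<Rightarrow> element set \<Rightarrow> (element \<Rightarrow> nat) \<Rightarrow> bool" where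
  "bounded_local_variation \<delta> \<T> deg \<longleftrightarrow>
     (\<forall>K\<in>\<T>. \<forall>L\<in>\<T>. K \<noteq> L \<and> positive_length (frontier (region K) \<inter> frontier (region L)) \<longrightarrow>
        diam K / diam L \<le> \<delta> \<and> real (deg K) / real (deg L) \<le> \<delta>)"

definition admissible_mesh ::
  "pt set \<Rightarrow> real \<Rightarrow> real \<Rightarrow> element set \<Rightarrow> (element \<Rightarrow> nat) \<Rightarrow> bool" where
  "admissible_mesh \<Omega> \<sigma> \<delta> \<T> deg \<longleftrightarrow>
     subdivision \<Omega> \<T> \<and> mesh_size \<T> < 1 \<and> shape_regular \<sigma> \<T> \<and>
     (\<forall>K\<in>\<T>. deg K \<ge> 1) \<and> bounded_local_variation \<delta> \<T> deg"


section \<open>Discrete spaces\<close>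

text \<open>Elements of \<open>V\<^sub>h\<close> are \<open>L\<^sup>2\<close> classes. A class is represented by its unique member that is
  polynomial in the interior of each element and vanishes on the skeleton of the mesh (a null set)
  and outside of it. Boundary values are therefore never read off from the representative; they
  are taken as traces from inside the elements.\<close>

definition V_space :: "element set \<Rightarrow> (element \<Rightarrow> nat) \<Rightarrow> (pt \<Rightarrow> real) set" where
  "V_space \<T> deg = {v.
     (\<forall>K\<in>\<T>. \<exists>q\<in>local_space (deg K) K. \<forall>x\<in>interior (region K). v x = q x) \<and>
     (\<forall>x. x \<notin> (\<Union>K\<in>\<T>. interior (region K)) \<longrightarrow> v x = 0)}"

definition W_space :: "element set \<Rightarrow> (element \<Rightarrow> nat) \<Rightarrow> (pt \<Rightarrow> pt) set" where
  "W_space \<T> deg = {w. \<forall>i. (\<lambda>x. w x $ i) \<in> V_space \<T> deg}"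

definition linear_functional_on ::
  "('x \<Rightarrow> 'b::real_vector) set \<Rightarrow> (('x \<Rightarrow> 'b) \<Rightarrow> real) \<Rightarrow> bool" where
  "linear_functional_on V F \<longleftrightarrow>
     (\<forall>u\<in>V. \<forall>v\<in>V. F (\<lambda>x. u x + v x) = F u + F v) \<and>
     (\<forall>c. \<forall>u\<in>V. F (\<lambda>x. c *\<^sub>R u x) = c * F u)"

text \<open>On the finite-dimensional spaces above this supremum is over a nonempty bounded set.\<close>

definition dual_norm ::
  "pt set \<Rightarrow> (pt \<Rightarrow> 'b::euclidean_space) set \<Rightarrow> ((pt \<Rightarrow> 'b) \<Rightarrow> real) \<Rightarrow> real" where
  "dual_norm \<Omega> V F = (SUP \<eta> \<in> V - {\<lambda>x. 0}. \<bar>F \<eta>\<bar> / L2_norm \<Omega> \<eta>)"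


section \<open>Traces, jumps, averages\<close>

definition trace_from :: "element \<Rightarrow> (pt \<Rightarrow> 'b::t2_space) \<Rightarrow> pt \<Rightarrow> 'b" where
  "trace_from K v x = Lim (at x within interior (region K)) v"

text \<open>The unit normal on the straight piece \<open>e\<close> of \<open>\<partial>K\<close> pointing out of the convex set \<open>K\<close>;
  taking both endpoints of \<open>e\<close> for \<open>x\<close>, \<open>y\<close> shows that it is orthogonal to \<open>e\<close>.\<close>

definition outward_normal :: "element \<Rightarrow> pt set \<Rightarrow> pt" where
  "outward_normal K e = (THE \<nu>. norm \<nu> = 1 \<and> (\<forall>x\<in>e. \<forall>y\<in>region K. \<nu> \<bullet> (y - x) \<le> 0))"

text \<open>Summing over the one or two adjacent elements covers interior and boundary edges at once.\<close>

definition jump :: "element set \<Rightarrow> pt set \<Rightarrow> (pt \<Rightarrow> real) \<Rightarrow> pt \<Rightarrow> pt" where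
  "jump \<T> e v x = (\<Sum>K\<in>adjacent \<T> e. trace_from K v x *\<^sub>R outward_normal K e)"

definition normal_jump :: "element set \<Rightarrow> pt set \<Rightarrow> (pt \<Rightarrow> pt) \<Rightarrow> pt \<Rightarrow> real" where
  "normal_jump \<T> e w x = (\<Sum>K\<in>adjacent \<T> e. trace_from K w x \<bullet> outward_normal K e)"

definition average :: "element set \<Rightarrow> pt set \<Rightarrow> (pt \<Rightarrow> pt) \<Rightarrow> pt \<Rightarrow> pt" where
  "average \<T> e w x =
     (1 / real (card (adjacent \<T> e))) *\<^sub>R (\<Sum>K\<in>adjacent \<T> e. trace_from K w x)"

text \<open>Integral with respect to arc length over a straight edge; its value does not depend on
  the order in which the endpoints are chosen.\<close>

definition edge_integral :: "pt set \<Rightarrow> (pt \<Rightarrow> real) \<Rightarrow> real" where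
  "edge_integral e g =
     (let (a, b) = (SOME (a, b). e = closed_segment a b)
      in dist a b * (\<integral>t. g (a + t *\<^sub>R (b - a)) \<partial>lebesgue_on {0..1}))"


section \<open>Stabilization parameters and forms\<close>

definition C11 :: "real \<Rightarrow> real \<Rightarrow> element set \<Rightarrow> (element \<Rightarrow> nat) \<Rightarrow> pt set \<Rightarrow> real" where
  "C11 \<zeta> \<alpha> \<T> deg e =
     \<zeta> * (MIN K\<in>adjacent \<T> e. diam K powr \<alpha> / real (deg K) powr (2 * \<alpha>))"

definition C22 :: "real \<Rightarrow> real \<Rightarrow> element set \<Rightarrow> (element \<Rightarrow> nat) \<Rightarrow> pt set \<Rightarrow> real" where
  "C22 \<kappa> \<beta> \<T> deg e =
     \<kappa> * (MIN K\<in>adjacent \<T> e. diam K powr \<beta> / real (deg K) powr (2 * \<beta>))"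

text \<open>\<open>C\<^sub>1\<^sub>2\<close> is single-valued because it depends on the point only, not on an element.\<close>

definition admissible_C12 :: "real \<Rightarrow> real \<Rightarrow> element set \<Rightarrow> (pt \<Rightarrow> pt) \<Rightarrow> bool" where
  "admissible_C12 c\<^sub>0 c\<^sub>1 \<T> C12 \<longleftrightarrow>
     C12 \<in> borel_measurable (restrict_space borel (\<Union>(interior_edges \<T>))) \<and>
     (\<forall>x\<in>\<Union>(interior_edges \<T>). c\<^sub>0 \<le> norm (C12 x) \<and> norm (C12 x) \<le> c\<^sub>1)"

definition grad :: "(pt \<Rightarrow> real) \<Rightarrow> pt \<Rightarrow> pt" where
  "grad v x = (\<chi> i. frechet_derivative v (at x) (axis i 1))"

definition form_A :: "pt set \<Rightarrow> (pt \<Rightarrow> pt) \<Rightarrow> (pt \<Rightarrow> pt) \<Rightarrow> real" where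
  "form_A \<Omega> p w = (\<integral>x. p x \<bullet> w x \<partial>lebesgue_on \<Omega>)"

definition form_A1 ::
  "pt set \<Rightarrow> element set \<Rightarrow> (pt \<Rightarrow> pt) \<Rightarrow> (pt \<Rightarrow> real) \<Rightarrow> (pt \<Rightarrow> pt) \<Rightarrow> real" where
  "form_A1 \<Omega> \<T> C12 v p =
     (\<Sum>K\<in>\<T>. \<integral>x. p x \<bullet> grad v x \<partial>lebesgue_on (region K))
     - (\<Sum>e\<in>edges \<Omega> \<T>. edge_integral e (\<lambda>x. average \<T> e p x \<bullet> jump \<T> e v x))
     + (\<Sum>e\<in>interior_edges \<T>.
          edge_integral e (\<lambda>x. (C12 x \<bullet> jump \<T> e v x) * normal_jump \<T> e p x))"

definition form_A2 :: "pt set \<Rightarrow> (pt \<Rightarrow> mat2) \<Rightarrow> (pt \<Rightarrow> pt) \<Rightarrow> (pt \<Rightarrow> pt) \<Rightarrow> real" where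
  "form_A2 \<Omega> A p w = (\<integral>x. (A x *v p x) \<bullet> w x \<partial>lebesgue_on \<Omega>)"

definition form_B :: "pt set \<Rightarrow> (pt \<Rightarrow> real \<Rightarrow> real \<Rightarrow> mat2) \<Rightarrow> real \<Rightarrow> real
    \<Rightarrow> (pt \<Rightarrow> pt) \<Rightarrow> (pt \<Rightarrow> pt) \<Rightarrow> real" where
  "form_B \<Omega> B t s p w = (\<integral>x. (B x t s *v p x) \<bullet> w x \<partial>lebesgue_on \<Omega>)"

definition form_J1 :: "real \<Rightarrow> real \<Rightarrow> element set \<Rightarrow> (element \<Rightarrow> nat)
    \<Rightarrow> (pt \<Rightarrow> pt) \<Rightarrow> (pt \<Rightarrow> pt) \<Rightarrow> real" where
  "form_J1 \<kappa> \<beta> \<T> deg p w =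
     (\<Sum>e\<in>interior_edges \<T>.
        edge_integral e (\<lambda>x. C22 \<kappa> \<beta> \<T> deg e * normal_jump \<T> e p x * normal_jump \<T> e w x))"

definition form_J :: "real \<Rightarrow> real \<Rightarrow> pt set \<Rightarrow> element set \<Rightarrow> (element \<Rightarrow> nat)
    \<Rightarrow> (pt \<Rightarrow> real) \<Rightarrow> (pt \<Rightarrow> real) \<Rightarrow> real" where
  "form_J \<zeta> \<alpha> \<Omega> \<T> deg \<phi> v =
     (\<Sum>e\<in>edges \<Omega> \<T>.
        edge_integral e (\<lambda>x. C11 \<zeta> \<alpha> \<T> deg e * (jump \<T> e \<phi> x \<bullet> jump \<T> e v x)))"


section \<open>Time discretization\<close>

text \<open>The operators act pointwise, on sequences of functions on \<open>\<Omega>\<close> as well as on sequences of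
  functionals. \<open>half U n\<close> is \<open>U\<^bsup>n+1/2\<^esup>\<close>, \<open>quarter U n\<close> is \<open>U\<^bsup>n;1/4\<^esup>\<close>, \<open>dt k U n\<close> is the difference
  quotient at \<open>t\<^bsub>n+1/2\<^esub>\<close>, \<open>dtt k U n\<close> the second one at \<open>t\<^sub>n\<close>; \<open>quarter\<close> and \<open>dtt\<close> are meant for
  \<open>n \<ge> 1\<close>.\<close>

definition half :: "(nat \<Rightarrow> 'x \<Rightarrow> 'b::real_vector) \<Rightarrow> nat \<Rightarrow> 'x \<Rightarrow> 'b" where
  "half U n = (\<lambda>x. (1/2) *\<^sub>R (U (n + 1) x + U n x))"

definition quarter :: "(nat \<Rightarrow> 'x \<Rightarrow> 'b::real_vector) \<Rightarrow> nat \<Rightarrow> 'x \<Rightarrow> 'b" where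
  "quarter U n = (\<lambda>x. (1/4) *\<^sub>R (U (n + 1) x + 2 *\<^sub>R U n x + U (n - 1) x))"

definition dt :: "real \<Rightarrow> (nat \<Rightarrow> 'x \<Rightarrow> 'b::real_vector) \<Rightarrow> nat \<Rightarrow> 'x \<Rightarrow> 'b" where
  "dt k U n = (\<lambda>x. (1/k) *\<^sub>R (U (n + 1) x - U n x))"

definition dtt :: "real \<Rightarrow> (nat \<Rightarrow> 'x \<Rightarrow> 'b::real_vector) \<Rightarrow> nat \<Rightarrow> 'x \<Rightarrow> 'b" where
  "dtt k U n = (\<lambda>x. (1/k\<^sup>2) *\<^sub>R (U (n + 1) x - 2 *\<^sub>R U n x + U (n - 1) x))"

definition at_steps :: "real \<Rightarrow> (pt \<Rightarrow> real \<Rightarrow> 'b) \<Rightarrow> nat \<Rightarrow> pt \<Rightarrow> 'b" where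
  "at_steps k f n = (\<lambda>x. f x (real n * k))"

definition quadrature :: "pt set \<Rightarrow> (pt \<Rightarrow> real \<Rightarrow> real \<Rightarrow> mat2) \<Rightarrow> real
    \<Rightarrow> (nat \<Rightarrow> pt \<Rightarrow> pt) \<Rightarrow> nat \<Rightarrow> (pt \<Rightarrow> pt) \<Rightarrow> real" where
  "quadrature \<Omega> B k Q n \<eta> =
     k * (\<Sum>j<n. form_B \<Omega> B (real n * k) ((real j + 1/2) * k) (half Q j) \<eta>)"

text \<open>The scheme on the time levels \<open>t\<^sub>0, \<dots>, t\<^sub>N = T\<close>, with time step \<open>k = T / N\<close>.\<close>

definition MFD_solution ::
  "pt set \<Rightarrow> (pt \<Rightarrow> mat2) \<Rightarrow> (pt \<Rightarrow> real \<Rightarrow> real \<Rightarrow> mat2)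
   \<Rightarrow> element set \<Rightarrow> (element \<Rightarrow> nat) \<Rightarrow> real \<Rightarrow> real \<Rightarrow> real \<Rightarrow> real \<Rightarrow> (pt \<Rightarrow> pt)
   \<Rightarrow> real \<Rightarrow> nat \<Rightarrow> (pt \<Rightarrow> real \<Rightarrow> real)
   \<Rightarrow> (nat \<Rightarrow> (pt \<Rightarrow> real) \<Rightarrow> real) \<Rightarrow> (nat \<Rightarrow> (pt \<Rightarrow> pt) \<Rightarrow> real)
   \<Rightarrow> (nat \<Rightarrow> pt \<Rightarrow> real) \<Rightarrow> (nat \<Rightarrow> pt \<Rightarrow> pt) \<Rightarrow> (nat \<Rightarrow> pt \<Rightarrow> pt) \<Rightarrow> bool" where
  "MFD_solution \<Omega> A B \<T> deg \<zeta> \<alpha> \<kappa> \<beta> C12 k N f F G U Q Z \<longleftrightarrow>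
     (\<forall>n\<le>N. U n \<in> V_space \<T> deg \<and> Q n \<in> W_space \<T> deg \<and> Z n \<in> W_space \<T> deg) \<and>
     (\<forall>n<N. \<forall>w\<in>W_space \<T> deg.
        form_A \<Omega> (half Q n) w - form_A1 \<Omega> \<T> C12 (half U n) w
          + form_J1 \<kappa> \<beta> \<T> deg (half Z n) w = 0) \<and>
     (\<forall>n<N. \<forall>\<tau>\<in>W_space \<T> deg.
        form_A2 \<Omega> A (half Q n) \<tau> - form_A \<Omega> (half Z n) \<tau>
          + half (quadrature \<Omega> B k Q) n \<tau> = half G n \<tau>) \<and>
     (\<forall>n. 1 \<le> n \<and> n < N \<longrightarrow> (\<forall>v\<in>V_space \<T> deg.
        L2_inner \<Omega> (dtt k U n) v + form_A1 \<Omega> \<T> C12 v (quarter Z n)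
          + form_J \<zeta> \<alpha> \<Omega> \<T> deg (quarter U n) v
        = L2_inner \<Omega> (quarter (at_steps k f) n) v + F n v))"

text \<open>\<open>energy_norm \<dots> n\<close> is the triple norm at level \<open>n + 1/2\<close>.\<close>

definition energy_norm ::
  "pt set \<Rightarrow> (pt \<Rightarrow> mat2) \<Rightarrow> element set \<Rightarrow> (element \<Rightarrow> nat)
   \<Rightarrow> real \<Rightarrow> real \<Rightarrow> real \<Rightarrow> real \<Rightarrow> real
   \<Rightarrow> (nat \<Rightarrow> pt \<Rightarrow> real) \<Rightarrow> (nat \<Rightarrow> pt \<Rightarrow> pt) \<Rightarrow> (nat \<Rightarrow> pt \<Rightarrow> pt) \<Rightarrow> nat \<Rightarrow> real" where
  "energy_norm \<Omega> A \<T> deg \<zeta> \<alpha> \<kappa> \<beta> k U Q Z n = sqrt (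
     (L2_norm \<Omega> (dt k U n))\<^sup>2
     + (L2_norm \<Omega> (\<lambda>x. matrix_sqrt (A x) *v half Q n x))\<^sup>2
     + form_J1 \<kappa> \<beta> \<T> deg (half Z n) (half Z n)
     + form_J \<zeta> \<alpha> \<Omega> \<T> deg (half U n) (half U n))"

end

theory Submission
  imports Defs
begin

text \<open>The scheme conserves a discrete energy up to the forcing and the memory term. For a solution write
\<open>q\<^sub>n\<close>, \<open>z\<^sub>n\<close>, \<open>u\<^sub>n\<close> for the averages at level \<open>n + 1/2\<close> and \<open>d\<^sub>n\<close> for the difference quotient of \<open>U\<close>, and
collect the right-hand side and the memory term of the second equation in one functional
\<open>H\<^sub>n = G\<^sub>n - \<epsilon>\<^sub>n\<close>, the load. Test the third equation with \<open>(d\<^sub>n + d\<^sub>n\<^sub>-\<^sub>1)/2 = (u\<^sub>n - u\<^sub>n\<^sub>-\<^sub>1)/k\<close>. The first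
equation, at two consecutive levels, turns \<open>A\<^sub>1(u\<^sub>n - u\<^sub>n\<^sub>-\<^sub>1, \<cdot>)\<close> into a mass term in \<open>q\<^sub>n - q\<^sub>n\<^sub>-\<^sub>1\<close> plus a jump
term in \<open>z\<close>, and the second equation, tested with \<open>q\<^sub>n - q\<^sub>n\<^sub>-\<^sub>1\<close>, turns that mass term into one in
\<open>A\<^sub>2\<close> plus the load. All four terms become differences of squares, because the forms are bilinear
and, except for \<open>A\<^sub>1\<close>, symmetric; so the squared triple norm grows in one step by
\<open>2k(f, v) + 2k F(v) + 2 h\<^sub>n(q\<^sub>n - q\<^sub>n\<^sub>-\<^sub>1)\<close>, where \<open>h\<^sub>n\<close> is a weighted mean of \<open>H\<^sub>n\<^sub>+\<^sub>1\<close>, \<open>H\<^sub>n\<close>, \<open>H\<^sub>n\<^sub>-\<^sub>1\<close>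
(\<open>energy_step\<close>).

The difference \<open>q\<^sub>n - q\<^sub>n\<^sub>-\<^sub>1\<close> is not controlled by \<open>k\<close> times the energy, so it is moved onto the load by
summation by parts (\<open>averaged_sum_by_parts_bound\<close>). The load vanishes at \<open>n = 0\<close>, and \<open>H\<^sub>n\<^sub>+\<^sub>1 - H\<^sub>n\<close>
is of size \<open>k\<close>: the part from \<open>G\<close> is \<open>k \<partial>\<^sub>t G\<close>, and the memory sum gains one new term of weight \<open>k\<close> while
its old terms change only through the Lipschitz dependence of \<open>B\<close> on \<open>t\<close> (\<open>quadrature_step\<close>). The outcome
is a bound of the squared norm by the largest norm so far times the data and \<open>k\<close> times the sum of all
norms so far (\<open>energy_inequality\<close>). Evaluating it where the norm is largest removes the square, and the
discrete Gronwall lemma removes the sum (\<open>quadratic_Gronwall\<close>). The constants depend only on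
\<open>M\<close>, \<open>T\<close> and \<open>\<alpha>\<^sub>0\<close>.

Two facts make this calculation legitimate on the given spaces. The edge integrals are linear in
traces only if every edge is a segment along which the traces from inside exist; this is convex
geometry (\<open>interior_edge_segment\<close>, \<open>boundary_edge_segment\<close>, \<open>trace_from_eq\<close>). And a dual norm bounds
its functional only if the supremum is over a bounded set; on a finite-dimensional space with a
definite inner product this follows from the Riesz representation (\<open>finite_span_Riesz\<close>,
\<open>dual_norm_bound\<close>).\<close>

section \<open>Linear and bilinear functionals\<close>

definition fun_subspace :: "('x \<Rightarrow> 'b::real_vector) set \<Rightarrow> bool" where
  "fun_subspace V \<longleftrightarrow> (\<lambda>x. 0) \<in> V \<and> (\<forall>u\<in>V. \<forall>v\<in>V. (\<lambda>x. u x + v x) \<in> V) \<and>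
     (\<forall>c. \<forall>u\<in>V. (\<lambda>x. c *\<^sub>R u x) \<in> V)"

lemma fun_subspaceD:
  assumes "fun_subspace V"
  shows "(\<lambda>x. 0) \<in> V" "u \<in> V \<Longrightarrow> v \<in> V \<Longrightarrow> (\<lambda>x. u x + v x) \<in> V"
    "u \<in> V \<Longrightarrow> (\<lambda>x. c *\<^sub>R u x) \<in> V"
  using assms by (auto simp: fun_subspace_def)

lemma fun_subspace_diff:
  assumes "fun_subspace V" "u \<in> V" "v \<in> V"
  shows "(\<lambda>x. u x - v x) \<in> V"
  using fun_subspaceD(2)[OF assms(1) assms(2) fun_subspaceD(3)[OF assms(1,3), of "-1"]] by simp

lemma half_mem:
  assumes "fun_subspace V" "U (n + 1) \<in> V" "U n \<in> V" shows "half U n \<in> V"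
  unfolding half_def using fun_subspaceD(3)[OF assms(1) fun_subspaceD(2)[OF assms]] .

lemma fun_subspace_sum:
  assumes "fun_subspace V" "\<And>i. i \<in> I \<Longrightarrow> b i \<in> V"
  shows "(\<lambda>x. \<Sum>i\<in>I. c i *\<^sub>R b i x) \<in> V"
  using assms(2)
proof (induction I rule: infinite_finite_induct)
  case (insert i I)
  then show ?case
    using fun_subspaceD(2)[OF assms(1) fun_subspaceD(3)[OF assms(1), of "b i" "c i"], of "\<lambda>x. \<Sum>i\<in>I. c i *\<^sub>R b i x"]
    by simp
qed (use fun_subspaceD(1)[OF assms(1)] in simp_all)

lemma linear_functional_onI:
  assumes "\<And>u v. u \<in> V \<Longrightarrow> v \<in> V \<Longrightarrow> F (\<lambda>x. u x + v x) = F u + F v"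
    and "\<And>c u. u \<in> V \<Longrightarrow> F (\<lambda>x. c *\<^sub>R u x) = c * F u"
  shows "linear_functional_on V F"
  using assms by (auto simp: linear_functional_on_def)

lemma linear_functional_onD:
  assumes "linear_functional_on V F"
  shows "u \<in> V \<Longrightarrow> v \<in> V \<Longrightarrow> F (\<lambda>x. u x + v x) = F u + F v"
    "u \<in> V \<Longrightarrow> F (\<lambda>x. c *\<^sub>R u x) = c * F u"
  using assms by (auto simp: linear_functional_on_def)

lemma linear_functional_on_diff_arg:
  assumes "fun_subspace V" "linear_functional_on V F" "u \<in> V" "v \<in> V"
  shows "F (\<lambda>x. u x - v x) = F u - F v"
  using linear_functional_onD(1)[OF assms(2,3) fun_subspaceD(3)[OF assms(1,4), of "-1"]]
    linear_functional_onD(2)[OF assms(2,4), of "-1"] by simp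

lemma linear_functional_on_zero_arg:
  assumes "fun_subspace V" "linear_functional_on V F"
  shows "F (\<lambda>x. 0) = 0"
  using linear_functional_onD(2)[OF assms(2) fun_subspaceD(1)[OF assms(1)], of 0] by simp

lemma linear_functional_on_zero: "linear_functional_on V (\<lambda>v. 0)"
  by (auto simp: linear_functional_on_def)

lemma linear_functional_on_add:
  "linear_functional_on V F \<Longrightarrow> linear_functional_on V G \<Longrightarrow> linear_functional_on V (\<lambda>v. F v + G v)"
  by (auto simp: linear_functional_on_def algebra_simps)

lemma linear_functional_on_diff:
  "linear_functional_on V F \<Longrightarrow> linear_functional_on V G \<Longrightarrow> linear_functional_on V (\<lambda>v. F v - G v)"
  by (auto simp: linear_functional_on_def algebra_simps)

lemma linear_functional_on_cmult:
  "linear_functional_on V F \<Longrightarrow> linear_functional_on V (\<lambda>v. c * F v)"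
  by (auto simp: linear_functional_on_def algebra_simps)

lemma linear_functional_on_multc:
  "linear_functional_on V F \<Longrightarrow> linear_functional_on V (\<lambda>v. F v * c)"
  by (auto simp: linear_functional_on_def algebra_simps)

lemma linear_functional_on_sum:
  "(\<And>i. i \<in> I \<Longrightarrow> linear_functional_on V (F i)) \<Longrightarrow> linear_functional_on V (\<lambda>v. \<Sum>i\<in>I. F i v)"
  by (induction I rule: infinite_finite_induct)
    (auto intro: linear_functional_on_zero linear_functional_on_add)

text \<open>Linearity is required only almost everywhere, because the gradient of a piecewise polynomial is
meaningless on the boundary of an element.\<close>

lemma linear_functional_on_integral:
  assumes V: "fun_subspace V" and lin: "AE x in M. linear_functional_on V (\<lambda>v. g v x)"
    and int: "\<And>v. v \<in> V \<Longrightarrow> integrable M (g v)"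
  shows "linear_functional_on V (\<lambda>v. \<integral>x. g v x \<partial>M)"
proof (rule linear_functional_onI)
  fix u v assume uv: "u \<in> V" "v \<in> V"
  have "(\<integral>x. g (\<lambda>x. u x + v x) x \<partial>M) = (\<integral>x. g u x + g v x \<partial>M)"
  proof (rule integral_cong_AE)
    show "AE x in M. g (\<lambda>x. u x + v x) x = g u x + g v x"
      using lin by eventually_elim (rule linear_functional_onD(1)[OF _ uv])
  qed (use int uv fun_subspaceD(2)[OF V uv] in auto)
  then show "(\<integral>x. g (\<lambda>x. u x + v x) x \<partial>M) = (\<integral>x. g u x \<partial>M) + (\<integral>x. g v x \<partial>M)"
    using int uv by simp
next
  fix c u assume u: "u \<in> V"
  have "(\<integral>x. g (\<lambda>x. c *\<^sub>R u x) x \<partial>M) = (\<integral>x. c * g u x \<partial>M)"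
  proof (rule integral_cong_AE)
    show "AE x in M. g (\<lambda>x. c *\<^sub>R u x) x = c * g u x"
      using lin by eventually_elim (rule linear_functional_onD(2)[OF _ u])
  qed (use int u fun_subspaceD(3)[OF V u] in auto)
  then show "(\<integral>x. g (\<lambda>x. c *\<^sub>R u x) x \<partial>M) = c * (\<integral>x. g u x \<partial>M)"
    by simp
qed

lemma linear_functional_on_subset:
  "linear_functional_on V F \<Longrightarrow> W \<subseteq> V \<Longrightarrow> linear_functional_on W F"
  unfolding linear_functional_on_def by (meson subsetD)

definition bilinear_on ::
  "('x \<Rightarrow> 'a::real_vector) set \<Rightarrow> ('y \<Rightarrow> 'b::real_vector) set \<Rightarrow> (('x \<Rightarrow> 'a) \<Rightarrow> ('y \<Rightarrow> 'b) \<Rightarrow> real) \<Rightarrow> bool" where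
  "bilinear_on V W a \<longleftrightarrow> (\<forall>w\<in>W. linear_functional_on V (\<lambda>v. a v w)) \<and>
     (\<forall>v\<in>V. linear_functional_on W (a v))"

lemma bilinear_onI:
  assumes "\<And>w. w \<in> W \<Longrightarrow> linear_functional_on V (\<lambda>v. a v w)"
    "\<And>v. v \<in> V \<Longrightarrow> linear_functional_on W (\<lambda>w. a v w)"
  shows "bilinear_on V W a"
  using assms by (auto simp: bilinear_on_def)

lemma bilinear_onD:
  assumes "bilinear_on V W a"
  shows "w \<in> W \<Longrightarrow> linear_functional_on V (\<lambda>v. a v w)" "v \<in> V \<Longrightarrow> linear_functional_on W (a v)"
  using assms by (auto simp: bilinear_on_def)

lemma bilinear_on_subset:
  "bilinear_on V W a \<Longrightarrow> V' \<subseteq> V \<Longrightarrow> W' \<subseteq> W \<Longrightarrow> bilinear_on V' W' a"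
  unfolding bilinear_on_def by (meson linear_functional_on_subset subsetD)

text \<open>The source of every difference of squares in the energy identity: the cross terms cancel by symmetry.\<close>

lemma bilinear_on_diff_sum:
  assumes V: "fun_subspace V" and a: "bilinear_on V V a"
    and sym: "\<And>u v. u \<in> V \<Longrightarrow> v \<in> V \<Longrightarrow> a u v = a v u"
    and uv: "u \<in> V" "v \<in> V"
  shows "a (\<lambda>x. r *\<^sub>R (u x - v x)) (\<lambda>x. s *\<^sub>R (u x + v x)) = r * s * (a u u - a v v)"
proof -
  have p: "(\<lambda>x. u x + v x) \<in> V" and m: "(\<lambda>x. u x - v x) \<in> V"
    using fun_subspaceD(2)[OF V uv] fun_subspace_diff[OF V uv] by auto
  have sp: "(\<lambda>x. s *\<^sub>R (u x + v x)) \<in> V" using fun_subspaceD(3)[OF V p] .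
  have "a (\<lambda>x. r *\<^sub>R (u x - v x)) (\<lambda>x. s *\<^sub>R (u x + v x))
      = r * a (\<lambda>x. u x - v x) (\<lambda>x. s *\<^sub>R (u x + v x))"
    using linear_functional_onD(2)[OF bilinear_onD(1)[OF a sp] m] by simp
  also have "\<dots> = r * (s * a (\<lambda>x. u x - v x) (\<lambda>x. u x + v x))"
    using linear_functional_onD(2)[OF bilinear_onD(2)[OF a m] p] by simp
  also have "a (\<lambda>x. u x - v x) (\<lambda>x. u x + v x) = a u (\<lambda>x. u x + v x) - a v (\<lambda>x. u x + v x)"
    using linear_functional_on_diff_arg[OF V bilinear_onD(1)[OF a p] uv] .
  also have "\<dots> = a u u - a v v"
    using linear_functional_onD(1)[OF bilinear_onD(2)[OF a uv(1)] uv]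
      linear_functional_onD(1)[OF bilinear_onD(2)[OF a uv(2)] uv] sym[OF uv] by simp
  finally show ?thesis by simp
qed

lemma bilinear_on_Cauchy_Schwarz:
  assumes V: "fun_subspace V" and a: "bilinear_on V V a"
    and sym: "\<And>u v. u \<in> V \<Longrightarrow> v \<in> V \<Longrightarrow> a u v = a v u"
    and pos: "\<And>v. v \<in> V \<Longrightarrow> a v v \<ge> 0"
    and uv: "u \<in> V" "v \<in> V"
  shows "\<bar>a u v\<bar> \<le> sqrt (a u u) * sqrt (a v v)"
proof -
  \<comment> \<open>expand \<open>a\<close> at \<open>s u - t v\<close>\<close>
  have q: "s\<^sup>2 * a u u - 2 * s * t * a u v + t\<^sup>2 * a v v \<ge> 0" for s t
  proof -
    let ?u = "\<lambda>x. s *\<^sub>R u x" and ?v = "\<lambda>x. t *\<^sub>R v x"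
    have in': "?u \<in> V" "?v \<in> V" using fun_subspaceD(3)[OF V] uv by auto
    let ?w = "\<lambda>x. ?u x - ?v x"
    have w: "?w \<in> V" using fun_subspace_diff[OF V in'] .
    have "a ?w ?w = a ?u ?w - a ?v ?w"
      using linear_functional_on_diff_arg[OF V bilinear_onD(1)[OF a w] in'] .
    also have "\<dots> = (a ?u ?u - a ?u ?v) - (a ?v ?u - a ?v ?v)"
      using linear_functional_on_diff_arg[OF V bilinear_onD(2)[OF a in'(1)] in']
        linear_functional_on_diff_arg[OF V bilinear_onD(2)[OF a in'(2)] in'] by simp
    also have "\<dots> = s\<^sup>2 * a u u - 2 * s * t * a u v + t\<^sup>2 * a v v"
      using linear_functional_onD(2)[OF bilinear_onD(1)[OF a in'(1)] uv(1), of s]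
        linear_functional_onD(2)[OF bilinear_onD(1)[OF a in'(2)] uv(1), of s]
        linear_functional_onD(2)[OF bilinear_onD(1)[OF a in'(1)] uv(2), of t]
        linear_functional_onD(2)[OF bilinear_onD(1)[OF a in'(2)] uv(2), of t]
        linear_functional_onD(2)[OF bilinear_onD(2)[OF a uv(1)] uv(1), of s]
        linear_functional_onD(2)[OF bilinear_onD(2)[OF a uv(1)] uv(2), of t]
        linear_functional_onD(2)[OF bilinear_onD(2)[OF a uv(2)] uv(1), of s]
        linear_functional_onD(2)[OF bilinear_onD(2)[OF a uv(2)] uv(2), of t] sym[OF uv]
      by (simp add: power2_eq_square algebra_simps)
    finally show ?thesis using pos[OF w] by simp
  qed
  have "(a u v)\<^sup>2 \<le> a u u * a v v"
  proof (cases "a v v = 0")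
    case True
    have "a u v = 0"
    proof (rule ccontr)
      assume "a u v \<noteq> 0"
      \<comment> \<open>at this \<open>t\<close> the quadratic form, now affine in
        \<open>t\<close>, takes the value \<open>-1\<close>\<close>
      then show False using q[of 1 "(a u u + 1) / (2 * a u v)"] True by simp
    qed
    then show ?thesis by (simp add: True)
  next
    case False
    then have "a v v > 0" using pos[OF uv(2)] by simp
    moreover have "a v v * (a u u * a v v - (a u v)\<^sup>2) \<ge> 0"
      using q[of "a v v" "a u v"] by (simp add: power2_eq_square algebra_simps)
    ultimately show ?thesis by (simp add: zero_le_mult_iff)
  qed
  then have "sqrt ((a u v)\<^sup>2) \<le> sqrt (a u u * a v v)" by (rule real_sqrt_le_mono)
  then show ?thesis by (simp add: real_sqrt_mult)
qed

text \<open>Gram-Schmidt in inductive form. When \<open>b\<^sub>j\<close> is added to the spanning family, split off its component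
\<open>e\<close> orthogonal to the old span; the old representer still serves on the old span, and the multiple \<open>l e\<close>
corrects it on \<open>e\<close>. The projection of \<open>b\<^sub>j\<close> itself comes from the induction hypothesis, applied to the
functional \<open>a(\<cdot>, b\<^sub>j)\<close>. The representer is given by coefficients, since it has to lie in the span.\<close>

lemma finite_span_Riesz:
  fixes b :: "'i \<Rightarrow> 'x \<Rightarrow> 'b::real_vector"
  assumes "finite I" and V: "fun_subspace V" and b: "\<And>i. i \<in> I \<Longrightarrow> b i \<in> V"
    and a: "bilinear_on V V a" and sym: "\<And>u v. u \<in> V \<Longrightarrow> v \<in> V \<Longrightarrow> a u v = a v u"
    and definite: "\<And>v. v \<in> V \<Longrightarrow> a v v = 0 \<Longrightarrow> v = (\<lambda>x. 0)"
    and "linear_functional_on V F"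
  shows "\<exists>d. \<forall>c. F (\<lambda>x. \<Sum>i\<in>I. c i *\<^sub>R b i x) = a (\<lambda>x. \<Sum>i\<in>I. c i *\<^sub>R b i x) (\<lambda>x. \<Sum>i\<in>I. d i *\<^sub>R b i x)"
  using assms(1,3,7)
proof (induction I arbitrary: F)
  case empty
  have "F (\<lambda>x. 0) = 0" using linear_functional_on_zero_arg[OF V empty(2)] .
  moreover have "a (\<lambda>x. 0) (\<lambda>x. 0) = 0"
    using linear_functional_on_zero_arg[OF V bilinear_onD(2)[OF a fun_subspaceD(1)[OF V]]] .
  ultimately show ?case by simp
next
  case (insert j I)
  define S where "S c = (\<lambda>x. \<Sum>i\<in>I. c i *\<^sub>R b i x)" for c
  have bj: "b j \<in> V" using insert.prems by simp
  have S: "S c \<in> V" for c unfolding S_def by (rule fun_subspace_sum[OF V]) (use insert.prems in simp)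
  note F = insert.prems(2)
  obtain d where d: "F (S c) = a (S c) (S d)" for c
    using insert.IH[OF _ F] insert.prems(1) unfolding S_def by auto
  obtain d' where d': "a (S c) (b j) = a (S c) (S d')" for c
    using insert.IH[OF _ bilinear_onD(1)[OF a bj]] insert.prems(1) unfolding S_def by auto
  define e where "e = (\<lambda>x. b j x - S d' x)"
  have e: "e \<in> V" unfolding e_def by (rule fun_subspace_diff[OF V bj S])
  have orth: "a (S c) e = 0" for c
    unfolding e_def using linear_functional_on_diff_arg[OF V bilinear_onD(2)[OF a S] bj S] d' by simp
  have orth': "a e (S c) = 0" for c using orth sym[OF e S] by simp
  \<comment> \<open>if \<open>a e e = 0\<close> then \<open>e = 0\<close> by definiteness, and
    \<open>l\<close> is \<open>0\<close> because division by zero is; the identity \<open>F e =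
    l * a e e\<close> then holds as well\<close>
  define l where "l = F e / a e e"
  have l: "F e = l * a e e"
  proof (cases "a e e = 0")
    case True
    then have "F e = 0" using definite[OF e] linear_functional_on_zero_arg[OF V F] by simp
    then show ?thesis using True by simp
  qed (simp add: l_def)
  define r where "r = (\<lambda>i. if i = j then l else d i - l * d' i)"
  have comb: "(\<lambda>x. \<Sum>i\<in>insert j I. c i *\<^sub>R b i x) = (\<lambda>x. S (\<lambda>i. c i + c j * d' i) x + c j *\<^sub>R e x)" for c
    using insert.hyps by (auto simp: S_def e_def algebra_simps sum.distrib scaleR_sum_right)
  have "(\<lambda>x. \<Sum>i\<in>insert j I. r i *\<^sub>R b i x) = (\<lambda>x. S (\<lambda>i. r i + r j * d' i) x + r j *\<^sub>R e x)"
    by (rule comb)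
  also have "S (\<lambda>i. r i + r j * d' i) = S d"
    unfolding S_def using insert.hyps by (intro ext sum.cong) (auto simp: r_def)
  also have "r j = l" by (simp add: r_def)
  finally have comb_r: "(\<lambda>x. \<Sum>i\<in>insert j I. r i *\<^sub>R b i x) = (\<lambda>x. S d x + l *\<^sub>R e x)" .
  have le: "(\<lambda>x. t *\<^sub>R e x) \<in> V" for t using fun_subspaceD(3)[OF V e] .
  have "F (\<lambda>x. S c x + t *\<^sub>R e x) = a (\<lambda>x. S c x + t *\<^sub>R e x) (\<lambda>x. S d x + l *\<^sub>R e x)" for c t
  proof -
    have w: "(\<lambda>x. S d x + l *\<^sub>R e x) \<in> V" using fun_subspaceD(2)[OF V S le] .
    have "a (\<lambda>x. S c x + t *\<^sub>R e x) (\<lambda>x. S d x + l *\<^sub>R e x)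
        = a (S c) (\<lambda>x. S d x + l *\<^sub>R e x) + t * a e (\<lambda>x. S d x + l *\<^sub>R e x)"
      using linear_functional_onD(1)[OF bilinear_onD(1)[OF a w] S le, of c t]
        linear_functional_onD(2)[OF bilinear_onD(1)[OF a w] e, of t] by simp
    also have "\<dots> = a (S c) (S d) + t * (l * a e e)"
      using linear_functional_onD(1)[OF bilinear_onD(2)[OF a S[of c]] S le, of d l]
        linear_functional_onD(1)[OF bilinear_onD(2)[OF a e] S le, of d l]
        linear_functional_onD(2)[OF bilinear_onD(2)[OF a S[of c]] e, of l]
        linear_functional_onD(2)[OF bilinear_onD(2)[OF a e] e, of l] orth orth' by simp
    also have "\<dots> = F (\<lambda>x. S c x + t *\<^sub>R e x)"
      using linear_functional_onD(1)[OF F S le, of c t] linear_functional_onD(2)[OF F e, of t] d l by simp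
    finally show ?thesis by simp
  qed
  then show ?case
    by (intro exI[of _ r] allI) (simp only: comb_r, simp only: comb)
qed

section \<open>Square integrable functions\<close>

lemma fun_subspace_L2: "fun_subspace {u. L2 \<Omega> (u :: pt \<Rightarrow> 'b::euclidean_space)}"
proof -
  have "L2 \<Omega> (\<lambda>x. u x + v x)" if "L2 \<Omega> u" "L2 \<Omega> v" for u v :: "pt \<Rightarrow> 'b"
  proof -
    have "integrable (lebesgue_on \<Omega>) (\<lambda>x. (norm (u x + v x))\<^sup>2)"
    proof (rule Bochner_Integration.integrable_bound)
      show "integrable (lebesgue_on \<Omega>) (\<lambda>x. 2 * (norm (u x))\<^sup>2 + 2 * (norm (v x))\<^sup>2)"
        using that by (simp add: L2_def)
      have [measurable]: "u \<in> borel_measurable (lebesgue_on \<Omega>)" "v \<in> borel_measurable (lebesgue_on \<Omega>)"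
        using that by (auto simp: L2_def)
      show "(\<lambda>x. (norm (u x + v x))\<^sup>2) \<in> borel_measurable (lebesgue_on \<Omega>)" by measurable
      have "(norm (a + b))\<^sup>2 \<le> 2 * (norm a)\<^sup>2 + 2 * (norm b)\<^sup>2" for a b :: 'b
      proof -
        have "(norm (a + b))\<^sup>2 \<le> (norm a + norm b)\<^sup>2" by (simp add: norm_triangle_ineq power_mono)
        also have "\<dots> \<le> 2 * (norm a)\<^sup>2 + 2 * (norm b)\<^sup>2"
          using sum_squares_bound[of "norm a" "norm b"] by (simp add: power2_sum)
        finally show ?thesis .
      qed
      then show "AE x in lebesgue_on \<Omega>. norm ((norm (u x + v x))\<^sup>2)
          \<le> norm (2 * (norm (u x))\<^sup>2 + 2 * (norm (v x))\<^sup>2)" by simp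
    qed
    moreover have "(\<lambda>x. u x + v x) \<in> borel_measurable (lebesgue_on \<Omega>)"
      using that by (intro borel_measurable_add) (auto simp: L2_def)
    ultimately show ?thesis by (simp add: L2_def)
  qed
  then show ?thesis by (auto simp: fun_subspace_def L2_def power_mult_distrib)
qed

lemma L2_inner_integrable:
  fixes u v :: "pt \<Rightarrow> 'b::euclidean_space"
  assumes "L2 \<Omega> u" "L2 \<Omega> v"
  shows "integrable (lebesgue_on \<Omega>) (\<lambda>x. u x \<bullet> v x)"
proof (rule Bochner_Integration.integrable_bound)
  show "integrable (lebesgue_on \<Omega>) (\<lambda>x. (norm (u x))\<^sup>2 + (norm (v x))\<^sup>2)"
    using assms by (simp add: L2_def)
  show "(\<lambda>x. u x \<bullet> v x) \<in> borel_measurable (lebesgue_on \<Omega>)"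
    using assms by (auto simp: L2_def)
  have "\<bar>a \<bullet> b\<bar> \<le> (norm a)\<^sup>2 + (norm b)\<^sup>2" for a b :: 'b
    using Cauchy_Schwarz_ineq2[of a b] sum_squares_bound[of "norm a" "norm b"]
      zero_le_power2[of "norm a"] zero_le_power2[of "norm b"]
      mult_nonneg_nonneg[OF norm_ge_zero[of a] norm_ge_zero[of b]] by linarith
  then show "AE x in lebesgue_on \<Omega>. norm (u x \<bullet> v x) \<le> norm ((norm (u x))\<^sup>2 + (norm (v x))\<^sup>2)"
    by simp
qed

lemma L2_inner_commute: "L2_inner \<Omega> u v = L2_inner \<Omega> v u"
  by (simp add: L2_inner_def inner_commute)

lemma L2_inner_self_nonneg: "L2_inner \<Omega> u u \<ge> 0"
  by (simp add: L2_inner_def)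

lemma L2_norm_nonneg [simp]: "L2_norm \<Omega> u \<ge> 0"
  by (simp add: L2_norm_def L2_inner_self_nonneg)

lemma L2_norm_power2: "(L2_norm \<Omega> u)\<^sup>2 = L2_inner \<Omega> u u"
  by (simp add: L2_norm_def L2_inner_self_nonneg)

lemma bilinear_on_L2_inner: "bilinear_on {u. L2 \<Omega> u} {u. L2 \<Omega> u} (L2_inner \<Omega>)"
proof -
  have "linear_functional_on {u. L2 \<Omega> u} (\<lambda>v. L2_inner \<Omega> v w)"
    if "L2 \<Omega> w" for w :: "pt \<Rightarrow> 'a::euclidean_space"
    unfolding L2_inner_def
    by (rule linear_functional_on_integral[OF fun_subspace_L2])
      (use that in \<open>auto intro: L2_inner_integrable simp: linear_functional_on_def inner_add_left\<close>)
  then show ?thesis by (auto simp: bilinear_on_def L2_inner_commute)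
qed

lemma L2_Cauchy_Schwarz:
  assumes "L2 \<Omega> u" "L2 \<Omega> v"
  shows "\<bar>L2_inner \<Omega> u v\<bar> \<le> L2_norm \<Omega> u * L2_norm \<Omega> v"
  unfolding L2_norm_def
  by (rule bilinear_on_Cauchy_Schwarz[OF fun_subspace_L2 bilinear_on_L2_inner])
    (use assms in \<open>auto simp: L2_inner_commute L2_inner_self_nonneg\<close>)

section \<open>The dual norm on finite-dimensional spaces\<close>

text \<open>The representer of \<open>F\<close> bounds the quotients in the supremum by Cauchy-Schwarz. Nontriviality of \<open>V\<close>
keeps the supremum from ranging over the empty set, where its value is unspecified and might be negative.\<close>

lemma dual_norm_bound:
  fixes b :: "'i \<Rightarrow> pt \<Rightarrow> 'b::euclidean_space"
  assumes V: "fun_subspace V" "V \<subseteq> {u. L2 \<Omega> u}"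
    and definite: "\<And>v. v \<in> V \<Longrightarrow> L2_inner \<Omega> v v = 0 \<Longrightarrow> v = (\<lambda>x. 0)"
    and nontrivial: "V \<noteq> {\<lambda>x. 0}"
    and fin: "finite I" "\<And>i. i \<in> I \<Longrightarrow> b i \<in> V"
    and span: "\<And>v. v \<in> V \<Longrightarrow> \<exists>c. v = (\<lambda>x. \<Sum>i\<in>I. c i *\<^sub>R b i x)"
    and F: "linear_functional_on V F"
  shows "dual_norm \<Omega> V F \<ge> 0" "\<And>v. v \<in> V \<Longrightarrow> \<bar>F v\<bar> \<le> dual_norm \<Omega> V F * L2_norm \<Omega> v"
proof -
  have bil: "bilinear_on V V (L2_inner \<Omega>)"
    by (rule bilinear_on_subset[OF bilinear_on_L2_inner V(2) V(2)])
  obtain d where d: "F (\<lambda>x. \<Sum>i\<in>I. c i *\<^sub>R b i x)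
      = L2_inner \<Omega> (\<lambda>x. \<Sum>i\<in>I. c i *\<^sub>R b i x) (\<lambda>x. \<Sum>i\<in>I. d i *\<^sub>R b i x)" for c
    using finite_span_Riesz[where b = b and I = I, OF fin(1) V(1) fin(2) bil L2_inner_commute definite F]
    by blast
  define r where "r = (\<lambda>x. \<Sum>i\<in>I. d i *\<^sub>R b i x)"
  have r: "r \<in> V" unfolding r_def by (rule fun_subspace_sum[OF V(1) fin(2)])
  have bound: "\<bar>F v\<bar> \<le> L2_norm \<Omega> r * L2_norm \<Omega> v" if v: "v \<in> V" for v
  proof -
    obtain c where "v = (\<lambda>x. \<Sum>i\<in>I. c i *\<^sub>R b i x)" using span[OF v] by auto
    then have "F v = L2_inner \<Omega> v r" using d by (simp add: r_def)
    then show ?thesis using L2_Cauchy_Schwarz[of \<Omega> v r] V(2) v r by (auto simp: mult.commute)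
  qed
  have pos: "L2_norm \<Omega> v > 0" if "v \<in> V - {\<lambda>x. 0}" for v
    using definite[of v] that L2_inner_self_nonneg[of \<Omega> v] by (force simp: L2_norm_def)
  have bdd: "bdd_above ((\<lambda>v. \<bar>F v\<bar> / L2_norm \<Omega> v) ` (V - {\<lambda>x. 0}))"
    using bound pos by (intro bdd_aboveI2[of _ _ "L2_norm \<Omega> r"]) (auto simp: divide_le_eq)
  have upper: "\<bar>F v\<bar> / L2_norm \<Omega> v \<le> dual_norm \<Omega> V F" if "v \<in> V - {\<lambda>x. 0}" for v
    unfolding dual_norm_def by (rule cSUP_upper[OF that bdd])
  obtain v where v: "v \<in> V - {\<lambda>x. 0}" using nontrivial fun_subspaceD(1)[OF V(1)] by auto
  have "0 \<le> \<bar>F v\<bar> / L2_norm \<Omega> v" by simp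
  then show "dual_norm \<Omega> V F \<ge> 0" using upper[OF v] by linarith
  show "\<bar>F v\<bar> \<le> dual_norm \<Omega> V F * L2_norm \<Omega> v" if "v \<in> V" for v
  proof (cases "v = (\<lambda>x. 0)")
    case True
    then show ?thesis using linear_functional_on_zero_arg[OF V(1) F]
      by (simp add: L2_norm_def L2_inner_def)
  next
    case False
    then show ?thesis using upper[of v] pos[of v] that by (simp add: divide_le_eq)
  qed
qed

section \<open>Piecewise polynomials\<close>

text \<open>The derivative is given by a gradient field, so that its continuity can be stated in the plane.\<close>

definition C1 :: "(pt \<Rightarrow> real) \<Rightarrow> bool" where
  "C1 q \<longleftrightarrow> (\<exists>g. continuous_on UNIV g \<and> (\<forall>x. (q has_derivative (\<lambda>h. g x \<bullet> h)) (at x)))"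

lemma C1_continuous: "C1 q \<Longrightarrow> continuous_on S q"
  unfolding C1_def by (metis continuous_at_imp_continuous_on has_derivative_continuous)

lemma C1_const: "C1 (\<lambda>x. c)"
proof -
  have "(\<bullet>) (0 :: pt) = (\<lambda>h. 0)" by (rule ext) simp
  then show ?thesis unfolding C1_def by (intro exI[of _ "\<lambda>x. 0"]) simp
qed

lemma C1_inner: "C1 (\<lambda>x. x \<bullet> u)"
  unfolding C1_def by (rule exI[of _ "\<lambda>x. u"]) (auto intro!: derivative_eq_intros simp: inner_commute)

lemma C1_add:
  assumes "C1 p" "C1 q" shows "C1 (\<lambda>x. p x + q x)"
proof -
  obtain g h where "continuous_on UNIV g" "continuous_on UNIV h"
    "\<And>x. (p has_derivative (\<lambda>k. g x \<bullet> k)) (at x)" "\<And>x. (q has_derivative (\<lambda>k. h x \<bullet> k)) (at x)"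
    using assms unfolding C1_def by blast
  then show ?thesis unfolding C1_def
    by (intro exI[of _ "\<lambda>x. g x + h x"])
      (auto intro!: continuous_intros derivative_eq_intros simp: inner_add_left)
qed

lemma C1_mult:
  assumes "C1 p" "C1 q" shows "C1 (\<lambda>x. p x * q x)"
proof -
  obtain g h where "continuous_on UNIV g" "continuous_on UNIV h"
    "\<And>x. (p has_derivative (\<lambda>k. g x \<bullet> k)) (at x)" "\<And>x. (q has_derivative (\<lambda>k. h x \<bullet> k)) (at x)"
    using assms unfolding C1_def by blast
  then show ?thesis unfolding C1_def
    by (intro exI[of _ "\<lambda>x. q x *\<^sub>R g x + p x *\<^sub>R h x"])
      (auto intro!: continuous_intros derivative_eq_intros C1_continuous assms
        simp: inner_add_left algebra_simps)
qed

lemma C1_power: "C1 p \<Longrightarrow> C1 (\<lambda>x. p x ^ n)"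
  by (induction n) (auto intro: C1_const C1_mult)

lemma C1_sum: "(\<And>i. i \<in> I \<Longrightarrow> C1 (p i)) \<Longrightarrow> C1 (\<lambda>x. \<Sum>i\<in>I. p i x)"
  by (induction I rule: infinite_finite_induct) (auto intro: C1_const C1_add)

text \<open>Indices of the monomials spanning the local space; this makes triangles and rectangles two instances
of one linear span.\<close>

fun monomial_indices :: "nat \<Rightarrow> element \<Rightarrow> (nat \<times> nat) set" where
  "monomial_indices r (Triangle a b c) = (SIGMA i:{..r}. {..r - i})"
| "monomial_indices r (Rectangle a u v) = {..r} \<times> {..r}"

fun monomial :: "element \<Rightarrow> nat \<times> nat \<Rightarrow> pt \<Rightarrow> real" where
  "monomial (Triangle a b c) (i, j) x = (x $ 1) ^ i * (x $ 2) ^ j"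
| "monomial (Rectangle a u v) (i, j) x = (x \<bullet> u) ^ i * (x \<bullet> v) ^ j"

lemma finite_monomial_indices: "finite (monomial_indices r K)"
  by (cases K) auto

lemma local_space_eq_range:
  "local_space r K = range (\<lambda>c x. \<Sum>ij\<in>monomial_indices r K. c ij * monomial K ij x)"
proof (cases K)
  case (Triangle a b d)
  have "(\<exists>c. q = (\<lambda>x. \<Sum>i\<le>r. \<Sum>j\<le>r - i. c i j * (x $ 1) ^ i * (x $ 2) ^ j)) \<longleftrightarrow>
    (\<exists>c. q = (\<lambda>x. \<Sum>ij\<in>(SIGMA i:{..r}. {..r - i}). c ij * monomial K ij x))"
    (is "?l \<longleftrightarrow> ?r") for q :: "pt \<Rightarrow> real"
  proof
    assume ?l
    then obtain c where "q = (\<lambda>x. \<Sum>i\<le>r. \<Sum>j\<le>r - i. c i j * (x $ 1) ^ i * (x $ 2) ^ j)" by blast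
    then show ?r
      by (intro exI[of _ "\<lambda>(i, j). c i j"])
        (simp add: sum.Sigma Triangle split_def mult.assoc cong: sum.cong, auto simp: mult.assoc intro!: ext sum.cong)
  next
    assume ?r
    then obtain c where "q = (\<lambda>x. \<Sum>ij\<in>(SIGMA i:{..r}. {..r - i}). c ij * monomial K ij x)" by blast
    then show ?l
      by (intro exI[of _ "\<lambda>i j. c (i, j)"])
        (simp add: sum.Sigma Triangle, auto simp: mult.assoc intro!: ext sum.cong)
  qed
  then show ?thesis by (auto simp: Triangle image_def)
next
  case (Rectangle a u v)
  have "(\<exists>c. q = (\<lambda>x. \<Sum>i\<le>r. \<Sum>j\<le>r. c i j * (x \<bullet> u) ^ i * (x \<bullet> v) ^ j)) \<longleftrightarrow>
    (\<exists>c. q = (\<lambda>x. \<Sum>ij\<in>{..r} \<times> {..r}. c ij * monomial K ij x))"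
    (is "?l \<longleftrightarrow> ?r") for q :: "pt \<Rightarrow> real"
  proof
    assume ?l
    then obtain c where "q = (\<lambda>x. \<Sum>i\<le>r. \<Sum>j\<le>r. c i j * (x \<bullet> u) ^ i * (x \<bullet> v) ^ j)" by blast
    then show ?r
      by (intro exI[of _ "\<lambda>(i, j). c i j"])
        (simp add: sum.cartesian_product Rectangle, auto simp: mult.assoc intro!: ext sum.cong)
  next
    assume ?r
    then obtain c where "q = (\<lambda>x. \<Sum>ij\<in>{..r} \<times> {..r}. c ij * monomial K ij x)" by blast
    then show ?l
      by (intro exI[of _ "\<lambda>i j. c (i, j)"])
        (simp add: sum.cartesian_product Rectangle, auto simp: mult.assoc intro!: ext sum.cong)
  qed
  then show ?thesis by (auto simp: Rectangle image_def)
qed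

lemma C1_monomial: "C1 (monomial K ij)"
proof (cases K; cases ij)
  fix a b c i j assume eq: "K = Triangle a b c" "ij = (i, j)"
  have "monomial K ij = (\<lambda>x. (x \<bullet> axis 1 1) ^ i * (x \<bullet> axis 2 1) ^ j)"
    by (auto simp: eq inner_axis)
  then show ?thesis by (simp add: C1_mult C1_power C1_inner)
next
  fix a u v i j assume eq: "K = Rectangle a u v" "ij = (i, j)"
  have "monomial K ij = (\<lambda>x. (x \<bullet> u) ^ i * (x \<bullet> v) ^ j)" by (auto simp: eq)
  then show ?thesis by (simp add: C1_mult C1_power C1_inner)
qed

lemma C1_local_space: "q \<in> local_space r K \<Longrightarrow> C1 q"
  by (auto simp: local_space_eq_range intro!: C1_sum C1_mult C1_const C1_monomial)

lemma local_space_add: "p \<in> local_space r K \<Longrightarrow> q \<in> local_space r K \<Longrightarrow> (\<lambda>x. p x + q x) \<in> local_space r K"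
proof -
  assume "p \<in> local_space r K" "q \<in> local_space r K"
  then obtain c d where "p = (\<lambda>x. \<Sum>ij\<in>monomial_indices r K. c ij * monomial K ij x)"
    "q = (\<lambda>x. \<Sum>ij\<in>monomial_indices r K. d ij * monomial K ij x)"
    by (auto simp: local_space_eq_range)
  then show ?thesis unfolding local_space_eq_range
    by (intro image_eqI[of _ _ "\<lambda>ij. c ij + d ij"]) (auto simp: algebra_simps sum.distrib)
qed

lemma local_space_scale: "p \<in> local_space r K \<Longrightarrow> (\<lambda>x. s * p x) \<in> local_space r K"
proof -
  assume "p \<in> local_space r K"
  then obtain c where "p = (\<lambda>x. \<Sum>ij\<in>monomial_indices r K. c ij * monomial K ij x)"
    by (auto simp: local_space_eq_range)
  then show ?thesis unfolding local_space_eq_range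
    by (intro image_eqI[of _ _ "\<lambda>ij. s * c ij"]) (auto simp: algebra_simps sum_distrib_left)
qed

lemma local_space_monomial: "ij \<in> monomial_indices r K \<Longrightarrow> monomial K ij \<in> local_space r K"
  unfolding local_space_eq_range
  by (intro image_eqI[of _ _ "\<lambda>kl. if kl = ij then 1 else 0"])
    (auto simp: if_distrib[of "\<lambda>t. t * _"] finite_monomial_indices cong: if_cong)

lemma local_space_zero: "(\<lambda>x. 0) \<in> local_space r K"
  unfolding local_space_eq_range by (intro image_eqI[of _ _ "\<lambda>ij. 0"]) auto

lemma fun_subspace_V_space: "fun_subspace (V_space \<T> deg)"
  unfolding fun_subspace_def V_space_def
proof (intro conjI ballI allI; safe)
  fix K show "\<exists>q\<in>local_space (deg K) K. \<forall>x\<in>interior (region K). 0 = q x"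
    by (rule bexI[OF _ local_space_zero]) simp
next
  fix u v :: "pt \<Rightarrow> real" and K
  assume *: "\<forall>K\<in>\<T>. \<exists>q\<in>local_space (deg K) K. \<forall>x\<in>interior (region K). u x = q x"
    "\<forall>K\<in>\<T>. \<exists>q\<in>local_space (deg K) K. \<forall>x\<in>interior (region K). v x = q x" "K \<in> \<T>"
  then obtain p q where "p \<in> local_space (deg K) K" "\<forall>x\<in>interior (region K). u x = p x"
    "q \<in> local_space (deg K) K" "\<forall>x\<in>interior (region K). v x = q x" by blast
  then show "\<exists>q\<in>local_space (deg K) K. \<forall>x\<in>interior (region K). u x + v x = q x"
    by (intro bexI[OF _ local_space_add[of p _ _ q]]) auto
next
  fix u :: "pt \<Rightarrow> real" and s :: real and K
  assume *: "\<forall>K\<in>\<T>. \<exists>q\<in>local_space (deg K) K. \<forall>x\<in>interior (region K). u x = q x" "K \<in> \<T>"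
  then obtain p where "p \<in> local_space (deg K) K" "\<forall>x\<in>interior (region K). u x = p x" by blast
  then show "\<exists>q\<in>local_space (deg K) K. \<forall>x\<in>interior (region K). s *\<^sub>R u x = q x"
    by (intro bexI[OF _ local_space_scale[of p _ _ s]]) auto
qed auto

lemma fun_subspace_W_space: "fun_subspace (W_space \<T> deg)"
  using fun_subspaceD[OF fun_subspace_V_space[of \<T> deg]]
  by (auto simp: fun_subspace_def W_space_def)

lemma V_space_local:
  assumes "v \<in> V_space \<T> deg" "K \<in> \<T>"
  obtains q where "q \<in> local_space (deg K) K" "\<And>x. x \<in> interior (region K) \<Longrightarrow> v x = q x"
  using assms unfolding V_space_def by blast

lemma W_space_local:
  assumes "w \<in> W_space \<T> deg" "K \<in> \<T>"
  obtains q where "continuous_on UNIV q" "\<And>x. x \<in> interior (region K) \<Longrightarrow> w x = q x"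
proof -
  have "\<exists>q. continuous_on UNIV q \<and> (\<forall>x\<in>interior (region K). w x $ i = q x)" for i
  proof -
    have "(\<lambda>x. w x $ i) \<in> V_space \<T> deg" using assms(1) by (simp add: W_space_def)
    then obtain q where "q \<in> local_space (deg K) K" "\<And>x. x \<in> interior (region K) \<Longrightarrow> w x $ i = q x"
      using V_space_local assms(2) by blast
    then show ?thesis using C1_continuous[OF C1_local_space] by blast
  qed
  then obtain q where q: "\<And>i. continuous_on UNIV (q i)"
    "\<And>i x. x \<in> interior (region K) \<Longrightarrow> w x $ i = q i x" by metis
  show thesis
  proof (rule that[of "\<lambda>x. \<chi> i. q i x"])
    show "continuous_on UNIV (\<lambda>x. \<chi> i. q i x)" by (rule continuous_on_vec_lambda) (rule q)
  qed (simp add: vec_eq_iff q)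
qed

section \<open>Geometry of elements\<close>

lemma compact_region: "compact (region K)" and convex_region: "convex (region K)"
  by (cases K; simp add: finite_imp_compact_convex_hull)+

lemma aff_dim_noncollinear:
  fixes S :: "pt set"
  assumes "\<not> collinear S" shows "aff_dim S = 2"
  using assms aff_dim_le_DIM[of S] by (simp add: collinear_aff_dim)

text \<open>A noncollinear set has affine dimension 2 in the plane, so its hull has interior points; a rectangle
contains the triangle on three of its vertices.\<close>

lemma interior_region_nonempty:
  assumes "nondegenerate K" shows "interior (region K) \<noteq> {}"
proof -
  have hull: "interior (convex hull S) \<noteq> {}" if "\<not> collinear S" for S :: "pt set"
    using aff_dim_noncollinear[OF that] that
    by (auto simp: interior_rel_interior_gen aff_dim_convex_hull rel_interior_eq_empty)
  show ?thesis
  proof (cases K)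
    case (Triangle a b c)
    then show ?thesis using assms hull[of "{a, b, c}"] by simp
  next
    case (Rectangle a u v)
    have "\<not> collinear {a + u, a, a + v}"
      using assms Rectangle
      by (auto simp: collinear_3[of "a + u" a "a + v"] collinear_lemma)
    then have "interior (convex hull {a + u, a, a + v}) \<noteq> {}" by (rule hull)
    moreover have "convex hull {a + u, a, a + v} \<subseteq> region K"
      using Rectangle by (auto intro!: hull_mono)
    ultimately show ?thesis using interior_mono by blast
  qed
qed

lemma interior_region_subset:
  assumes "subdivision \<Omega> \<T>" "open \<Omega>" "convex \<Omega>" "K \<in> \<T>"
  shows "interior (region K) \<subseteq> \<Omega>"
proof -
  have "region K \<subseteq> closure \<Omega>" using assms by (auto simp: subdivision_def)
  then have "interior (region K) \<subseteq> interior (closure \<Omega>)" by (rule interior_mono)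
  then show ?thesis using assms by (simp add: convex_interior_closure interior_open)
qed

section \<open>Bases of the discrete spaces\<close>

text \<open>Like the members of \<open>V_space\<close>, the basis functions vanish on the skeleton of the mesh.\<close>

definition V_basis :: "element \<times> nat \<times> nat \<Rightarrow> pt \<Rightarrow> real" where
  "V_basis = (\<lambda>(K, ij) x. if x \<in> interior (region K) then monomial K ij x else 0)"

definition V_indices :: "element set \<Rightarrow> (element \<Rightarrow> nat) \<Rightarrow> (element \<times> nat \<times> nat) set" where
  "V_indices \<T> deg = (SIGMA K:\<T>. monomial_indices (deg K) K)"

definition W_basis :: "2 \<times> element \<times> nat \<times> nat \<Rightarrow> pt \<Rightarrow> pt" where
  "W_basis = (\<lambda>(l, i) x. V_basis i x *\<^sub>R axis l 1)"

lemma finite_V_indices: "subdivision \<Omega> \<T> \<Longrightarrow> finite (V_indices \<T> deg)"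
  by (auto simp: V_indices_def subdivision_def finite_monomial_indices)

lemma subdivision_unique:
  assumes "subdivision \<Omega> \<T>" "K \<in> \<T>" "L \<in> \<T>" "x \<in> interior (region K)" "x \<in> interior (region L)"
  shows "K = L"
  using assms unfolding subdivision_def by blast

lemma V_basis_in:
  assumes "subdivision \<Omega> \<T>" "i \<in> V_indices \<T> deg"
  shows "V_basis i \<in> V_space \<T> deg"
proof -
  obtain K ij where i: "i = (K, ij)" "K \<in> \<T>" "ij \<in> monomial_indices (deg K) K"
    using assms by (auto simp: V_indices_def)
  have "\<exists>q\<in>local_space (deg L) L. \<forall>x\<in>interior (region L). V_basis i x = q x" if "L \<in> \<T>" for L
  proof (cases "L = K")
    case True
    then show ?thesis using local_space_monomial[OF i(3)] by (auto simp: V_basis_def i(1))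
  next
    case False
    then show ?thesis using subdivision_unique[OF assms(1) that i(2)]
      by (intro bexI[OF _ local_space_zero]) (auto simp: V_basis_def i(1))
  qed
  then show ?thesis using i(1,2) by (auto simp: V_space_def V_basis_def)
qed

lemma V_basis_span:
  assumes "subdivision \<Omega> \<T>" "v \<in> V_space \<T> deg"
  shows "\<exists>c. v = (\<lambda>x. \<Sum>i\<in>V_indices \<T> deg. c i *\<^sub>R V_basis i x)"
proof -
  have "\<exists>c. \<forall>x\<in>interior (region K). v x = (\<Sum>ij\<in>monomial_indices (deg K) K. c ij * monomial K ij x)"
    if K: "K \<in> \<T>" for K
  proof -
    obtain q where "q \<in> local_space (deg K) K" "\<And>x. x \<in> interior (region K) \<Longrightarrow> v x = q x"
      using V_space_local[OF assms(2) K] by blast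
    then show ?thesis unfolding local_space_eq_range by auto
  qed
  then obtain c where c: "\<And>K x. K \<in> \<T> \<Longrightarrow> x \<in> interior (region K) \<Longrightarrow>
      v x = (\<Sum>ij\<in>monomial_indices (deg K) K. c K ij * monomial K ij x)" by metis
  have fin: "finite \<T>" using assms(1) by (simp add: subdivision_def)
  have "v x = (\<Sum>i\<in>V_indices \<T> deg. c (fst i) (snd i) *\<^sub>R V_basis i x)" for x
  proof -
    have "(\<Sum>i\<in>V_indices \<T> deg. c (fst i) (snd i) *\<^sub>R V_basis i x)
        = (\<Sum>K\<in>\<T>. \<Sum>ij\<in>monomial_indices (deg K) K. c K ij * V_basis (K, ij) x)"
      unfolding V_indices_def by (subst sum.Sigma) (auto simp: fin finite_monomial_indices split_def)
    also have "\<dots> = (\<Sum>K\<in>\<T>. if x \<in> interior (region K) then v x else 0)"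
      by (intro sum.cong) (auto simp: V_basis_def c)
    also have "\<dots> = v x"
    proof (cases "\<exists>K\<in>\<T>. x \<in> interior (region K)")
      case True
      then obtain K where K: "K \<in> \<T>" "x \<in> interior (region K)" by blast
      have "x \<in> interior (region L) \<longleftrightarrow> L = K" if "L \<in> \<T>" for L
        using subdivision_unique[OF assms(1) that K(1) _ K(2)] K(2) by blast
      then have "(\<Sum>L\<in>\<T>. if x \<in> interior (region L) then v x else 0) = (\<Sum>L\<in>\<T>. if L = K then v x else 0)"
        by (intro sum.cong) simp_all
      then show ?thesis using K(1) fin by simp
    next
      case False
      then have "v x = 0" using assms(2) by (auto simp: V_space_def)
      then show ?thesis by (auto intro!: sum.neutral)
    qed
    finally show ?thesis by simp
  qed
  then show ?thesis by (intro exI[of _ "\<lambda>i. c (fst i) (snd i)"]) auto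
qed

lemma W_basis_in:
  assumes "subdivision \<Omega> \<T>" "i \<in> UNIV \<times> V_indices \<T> deg"
  shows "W_basis i \<in> W_space \<T> deg"
proof -
  obtain l j where i: "i = (l, j)" "j \<in> V_indices \<T> deg" using assms by auto
  have "(\<lambda>x. W_basis i x $ m) = (if m = l then V_basis j else (\<lambda>x. 0))" for m
    by (auto simp: W_basis_def i(1) axis_def)
  then show ?thesis
    using V_basis_in[OF assms(1) i(2)] fun_subspaceD(1)[OF fun_subspace_V_space]
    by (simp add: W_space_def)
qed

lemma W_basis_span:
  assumes "subdivision \<Omega> \<T>" "w \<in> W_space \<T> deg"
  shows "\<exists>c. w = (\<lambda>x. \<Sum>i\<in>UNIV \<times> V_indices \<T> deg. c i *\<^sub>R W_basis i x)"
proof -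
  have "\<exists>c. (\<lambda>x. w x $ l) = (\<lambda>x. \<Sum>i\<in>V_indices \<T> deg. c i *\<^sub>R V_basis i x)" for l
    using assms(2) V_basis_span[OF assms(1)] by (simp add: W_space_def)
  then obtain c where c: "\<And>l. (\<lambda>x. w x $ l) = (\<lambda>x. \<Sum>i\<in>V_indices \<T> deg. c l i *\<^sub>R V_basis i x)"
    by metis
  have "w x $ m = (\<Sum>i\<in>UNIV \<times> V_indices \<T> deg. c (fst i) (snd i) *\<^sub>R W_basis i x) $ m" for x m
  proof -
    have "(\<Sum>i\<in>UNIV \<times> V_indices \<T> deg. c (fst i) (snd i) *\<^sub>R W_basis i x) $ m
        = (\<Sum>l\<in>UNIV. \<Sum>i\<in>V_indices \<T> deg. c l i * V_basis i x * (if m = l then 1 else 0))"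
      by (simp add: sum.cartesian_product W_basis_def axis_def split_def eq_commute)
    also have "\<dots> = (\<Sum>l\<in>UNIV. if m = l then w x $ m else 0)"
      using fun_cong[OF c] by (intro sum.cong) auto
    finally show ?thesis by simp
  qed
  then have "w = (\<lambda>x. \<Sum>i\<in>UNIV \<times> V_indices \<T> deg. c (fst i) (snd i) *\<^sub>R W_basis i x)"
    by (intro ext) (simp only: vec_eq_iff, blast)
  then show ?thesis by (intro exI[of _ "\<lambda>i. c (fst i) (snd i)"])
qed

section \<open>Norms on the discrete spaces\<close>

lemma L2_bounded:
  assumes "\<Omega> \<in> lmeasurable" "u \<in> borel_measurable borel" "\<And>x. norm (u x) \<le> C"
  shows "L2 \<Omega> u"
proof -
  have u: "u \<in> borel_measurable (lebesgue_on \<Omega>)"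
    using assms(2) by (intro measurable_restrict_space1 measurable_completion) simp
  moreover have "integrable (lebesgue_on \<Omega>) (\<lambda>x. (norm (u x))\<^sup>2)"
  proof (rule Bochner_Integration.integrable_bound)
    show "integrable (lebesgue_on \<Omega>) (\<lambda>x. C\<^sup>2)"
      by (rule finite_measure.integrable_const[OF finite_measure_lebesgue_on[OF assms(1)]])
    show "(\<lambda>x. (norm (u x))\<^sup>2) \<in> borel_measurable (lebesgue_on \<Omega>)" using u by simp
    show "AE x in lebesgue_on \<Omega>. norm ((norm (u x))\<^sup>2) \<le> norm (C\<^sup>2)"
      using assms(3) by (simp add: power_mono)
  qed
  ultimately show ?thesis by (simp add: L2_def)
qed

lemma L2_V_basis:
  assumes "\<Omega> \<in> lmeasurable" shows "L2 \<Omega> (V_basis i)" "L2 \<Omega> (W_basis (l, i))"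
proof -
  obtain K ij where i: "i = (K, ij)" by (cases i)
  have cont: "continuous_on S (monomial K ij)" for S by (rule C1_continuous[OF C1_monomial])
  have meas: "V_basis i \<in> borel_measurable borel"
  proof -
    have "(\<lambda>x. if x \<in> interior (region K) then monomial K ij x else 0) \<in> borel_measurable borel"
      by (intro measurable_If_set borel_measurable_continuous_onI cont) auto
    then show ?thesis by (simp add: V_basis_def i)
  qed
  have "bounded (monomial K ij ` region K)"
    by (intro compact_imp_bounded compact_continuous_image cont compact_region)
  then obtain C where C: "\<And>x. x \<in> region K \<Longrightarrow> \<bar>monomial K ij x\<bar> \<le> C" "C > 0"
    by (auto simp: bounded_pos)
  have bd: "\<bar>V_basis i x\<bar> \<le> C" for x
    using C interior_subset[of "region K"] by (auto simp: V_basis_def i)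
  show "L2 \<Omega> (V_basis i)" using L2_bounded[OF assms meas] bd by auto
  show "L2 \<Omega> (W_basis (l, i))"
    using bd meas by (intro L2_bounded[OF assms, of _ C]) (auto simp: W_basis_def)
qed

lemma L2_V_space:
  assumes "subdivision \<Omega> \<T>" "\<Omega> \<in> lmeasurable"
  shows "V_space \<T> deg \<subseteq> {v. L2 \<Omega> v}" "W_space \<T> deg \<subseteq> {w. L2 \<Omega> w}"
proof safe
  fix v assume "v \<in> V_space \<T> deg"
  then obtain c where c: "v = (\<lambda>x. \<Sum>i\<in>V_indices \<T> deg. c i *\<^sub>R V_basis i x)"
    using V_basis_span[OF assms(1)] by blast
  show "L2 \<Omega> v"
    using fun_subspace_sum[OF fun_subspace_L2, of "V_indices \<T> deg" V_basis \<Omega> c] L2_V_basis(1)[OF assms(2)]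
    by (simp add: c)
next
  fix w assume "w \<in> W_space \<T> deg"
  then obtain c where c: "w = (\<lambda>x. \<Sum>i\<in>UNIV \<times> V_indices \<T> deg. c i *\<^sub>R W_basis i x)"
    using W_basis_span[OF assms(1)] by blast
  show "L2 \<Omega> w"
    using fun_subspace_sum[OF fun_subspace_L2, of "UNIV \<times> V_indices \<T> deg" W_basis \<Omega> c]
      L2_V_basis(2)[OF assms(2)]
    by (auto simp: c)
qed

text \<open>If \<open>v\<close> is nonzero at a point, then by continuity it is nonzero on a nonempty open subset of an element,
and such a set is not negligible. That the integral runs over \<open>\<Omega>\<close> is harmless because the interiors of
the elements lie in \<open>\<Omega>\<close>.\<close>

lemma L2_definite:
  fixes v :: "pt \<Rightarrow> 'b::euclidean_space"
  assumes sub: "subdivision \<Omega> \<T>" "open \<Omega>" "convex \<Omega>"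
    and v: "L2 \<Omega> v" "L2_inner \<Omega> v v = 0"
    and cont: "\<And>K. K \<in> \<T> \<Longrightarrow> continuous_on (interior (region K)) v"
    and zero: "\<And>x. x \<notin> (\<Union>K\<in>\<T>. interior (region K)) \<Longrightarrow> v x = 0"
  shows "v = (\<lambda>x. 0)"
proof (rule ccontr)
  assume "v \<noteq> (\<lambda>x. 0)"
  then obtain x where x: "v x \<noteq> 0" by auto
  then obtain K where K: "K \<in> \<T>" "x \<in> interior (region K)" using zero by blast
  have "AE x in lebesgue_on \<Omega>. v x \<bullet> v x = 0"
    using v L2_inner_integrable[OF v(1) v(1)]
    by (subst integral_nonneg_eq_0_iff_AE[symmetric]) (auto simp: L2_inner_def)
  then have "AE x in lebesgue. x \<in> \<Omega> \<longrightarrow> v x = 0"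
    using sub(2) by (simp add: AE_restrict_space_iff)
  then obtain N where "N \<in> null_sets lebesgue" and N: "{x. \<not> (x \<in> \<Omega> \<longrightarrow> v x = 0)} \<subseteq> N"
    by (auto simp: eventually_ae_filter)
  then have neg: "negligible N" by (simp add: negligible_iff_null_sets)
  define O' where "O' = {y \<in> interior (region K). v y \<in> - {0}}"
  have "open O'"
    using continuous_open_preimage[OF cont[OF K(1)], of "- {0}"]
    by (simp add: O'_def vimage_def Int_def conj_commute open_Compl)
  moreover have "O' \<noteq> {}" using x K by (auto simp: O'_def)
  moreover have "negligible O'"
    by (rule negligible_subset[OF neg]) (use N interior_region_subset[OF sub K(1)] in \<open>auto simp: O'_def\<close>)
  ultimately show False using open_not_negligible by blast
qed

lemma V_space_definite:
  assumes "subdivision \<Omega> \<T>" "open \<Omega>" "convex \<Omega>" "\<Omega> \<in> lmeasurable"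
    and "v \<in> V_space \<T> deg" "L2_inner \<Omega> v v = 0"
  shows "v = (\<lambda>x. 0)"
proof (rule L2_definite[OF assms(1-3)])
  show "L2 \<Omega> v" using L2_V_space(1)[OF assms(1,4)] assms(5) by blast
  fix K assume "K \<in> \<T>"
  then obtain q where "q \<in> local_space (deg K) K" "\<And>x. x \<in> interior (region K) \<Longrightarrow> v x = q x"
    using V_space_local[OF assms(5)] by blast
  then show "continuous_on (interior (region K)) v"
    using C1_continuous[OF C1_local_space] continuous_on_cong by metis
qed (use assms in \<open>auto simp: V_space_def\<close>)

lemma W_space_definite:
  assumes "subdivision \<Omega> \<T>" "open \<Omega>" "convex \<Omega>" "\<Omega> \<in> lmeasurable"
    and "w \<in> W_space \<T> deg" "L2_inner \<Omega> w w = 0"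
  shows "w = (\<lambda>x. 0)"
proof (rule L2_definite[OF assms(1-3)])
  show "L2 \<Omega> w" using L2_V_space(2)[OF assms(1,4)] assms(5) by blast
  fix K assume "K \<in> \<T>"
  then obtain q where "continuous_on UNIV q" "\<And>x. x \<in> interior (region K) \<Longrightarrow> w x = q x"
    using W_space_local[OF assms(5)] by blast
  then show "continuous_on (interior (region K)) w"
    by (metis continuous_on_cong continuous_on_subset subset_UNIV)
qed (use assms in \<open>auto simp: W_space_def V_space_def vec_eq_iff\<close>)

lemma V_space_nontrivial:
  assumes "subdivision \<Omega> \<T>"
  shows "V_space \<T> deg \<noteq> {\<lambda>x. 0}" "W_space \<T> deg \<noteq> {\<lambda>x. 0}"
proof -
  obtain K where K: "K \<in> \<T>" "nondegenerate K" using assms by (auto simp: subdivision_def)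
  obtain x where x: "x \<in> interior (region K)" using interior_region_nonempty[OF K(2)] by blast
  have i: "(K, 0, 0) \<in> V_indices \<T> deg" using K(1) by (cases K) (auto simp: V_indices_def)
  have one: "V_basis (K, 0, 0) x = 1" using x by (cases K) (auto simp: V_basis_def)
  have V: "V_basis (K, 0, 0) \<in> V_space \<T> deg" using V_basis_in[OF assms i] .
  have W: "W_basis (1, K, 0, 0) \<in> W_space \<T> deg" using W_basis_in[OF assms, of "(1, K, 0, 0)"] i by simp
  show "V_space \<T> deg \<noteq> {\<lambda>x. 0}" using V one by (metis singletonD zero_neq_one)
  have "W_basis (1, K, 0, 0) x \<noteq> 0" using one by (simp add: W_basis_def axis_eq_0_iff)
  then show "W_space \<T> deg \<noteq> {\<lambda>x. 0}" using W by (metis singletonD)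
qed

text \<open>The dual norms of the theorem really bound their functionals, on both discrete spaces.\<close>

lemma dual_norm_V_space:
  assumes "subdivision \<Omega> \<T>" "open \<Omega>" "convex \<Omega>" "\<Omega> \<in> lmeasurable"
    and "linear_functional_on (V_space \<T> deg) F"
  shows "dual_norm \<Omega> (V_space \<T> deg) F \<ge> 0"
    "v \<in> V_space \<T> deg \<Longrightarrow> \<bar>F v\<bar> \<le> dual_norm \<Omega> (V_space \<T> deg) F * L2_norm \<Omega> v"
proof -
  note * = dual_norm_bound[where I = "V_indices \<T> deg" and b = V_basis,
    OF fun_subspace_V_space L2_V_space(1)[OF assms(1,4)] V_space_definite[OF assms(1-4)]
      V_space_nontrivial(1)[OF assms(1)] finite_V_indices[OF assms(1)] V_basis_in[OF assms(1)]
      V_basis_span[OF assms(1)] assms(5)]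
  show "dual_norm \<Omega> (V_space \<T> deg) F \<ge> 0" by (rule *(1))
  show "v \<in> V_space \<T> deg \<Longrightarrow> \<bar>F v\<bar> \<le> dual_norm \<Omega> (V_space \<T> deg) F * L2_norm \<Omega> v" by (rule *(2))
qed

lemma dual_norm_W_space:
  assumes "subdivision \<Omega> \<T>" "open \<Omega>" "convex \<Omega>" "\<Omega> \<in> lmeasurable"
    and "linear_functional_on (W_space \<T> deg) F"
  shows "dual_norm \<Omega> (W_space \<T> deg) F \<ge> 0"
    "w \<in> W_space \<T> deg \<Longrightarrow> \<bar>F w\<bar> \<le> dual_norm \<Omega> (W_space \<T> deg) F * L2_norm \<Omega> w"
proof -
  have fin: "finite ((UNIV :: 2 set) \<times> V_indices \<T> deg)" using finite_V_indices[OF assms(1)] by simp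
  note * = dual_norm_bound[where I = "UNIV \<times> V_indices \<T> deg" and b = W_basis,
    OF fun_subspace_W_space L2_V_space(2)[OF assms(1,4)] W_space_definite[OF assms(1-4)]
      V_space_nontrivial(2)[OF assms(1)] fin W_basis_in[OF assms(1)]
      W_basis_span[OF assms(1)] assms(5)]
  show "dual_norm \<Omega> (W_space \<T> deg) F \<ge> 0" by (rule *(1))
  show "w \<in> W_space \<T> deg \<Longrightarrow> \<bar>F w\<bar> \<le> dual_norm \<Omega> (W_space \<T> deg) F * L2_norm \<Omega> w" by (rule *(2))
qed

section \<open>Edges are segments\<close>

lemma closure_interior_region:
  assumes "nondegenerate K" shows "closure (interior (region K)) = region K"
  using convex_closure_interior[OF convex_region interior_region_nonempty[OF assms]]
    compact_region by (simp add: compact_imp_closed)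

lemma frontier_region_subset: "frontier (region K) \<subseteq> region K"
  by (simp add: frontier_subset_closed compact_imp_closed compact_region)

text \<open>Since the interiors of two elements are disjoint, their common frontier is the intersection of the
elements, a compact convex set without interior points; in the plane such a set lies on a line.\<close>

lemma interior_edge_segment:
  assumes sub: "subdivision \<Omega> \<T>" and e: "e \<in> interior_edges \<T>"
  shows "\<exists>a b. e = closed_segment a b"
proof -
  obtain K L where KL: "K \<in> \<T>" "L \<in> \<T>" "K \<noteq> L" "e = frontier (region K) \<inter> frontier (region L)"
    "positive_length e"
    using e by (auto simp: interior_edges_def)
  have disj: "interior (region K) \<inter> interior (region L) = {}"
    and nd: "nondegenerate K" "nondegenerate L"
    using sub KL by (auto simp: subdivision_def)
  \<comment> \<open>each region is the closure of its interior, so an open set that misses the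
    interior of a region misses the region\<close>
  have no: "interior (region K) \<inter> region L = {}" "interior (region L) \<inter> region K = {}"
    using disj open_Int_closure_eq_empty[of "interior (region K)" "interior (region L)"]
      open_Int_closure_eq_empty[of "interior (region L)" "interior (region K)"]
      closure_interior_region[OF nd(1)] closure_interior_region[OF nd(2)] by auto
  have front: "frontier (region M) = region M - interior (region M)" for M
    by (simp add: frontier_def compact_imp_closed compact_region)
  have e_eq: "e = region K \<inter> region L" unfolding KL(4) front using no by blast
  have "interior e = {}" unfolding e_eq using disj by simp
  moreover have conv: "convex e" unfolding e_eq by (intro convex_Int convex_region)
  moreover have ne: "e \<noteq> {}" using KL(5) by (auto simp: positive_length_def)
  ultimately have "collinear e"
    using aff_dim_noncollinear[of e] by (auto simp: interior_rel_interior_gen rel_interior_eq_empty split: if_splits)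
  moreover have "compact e" unfolding e_eq by (intro compact_Int compact_region)
  ultimately show ?thesis using compact_convex_collinear_segment[of e] conv ne by metis
qed

text \<open>The domain is open and convex and the side lies in its closure. Therefore, if the side met the domain
at one point, all of it except possibly its endpoints would be in the domain. Hence the side lies in
the boundary entirely, and the edge is the whole side.\<close>

lemma boundary_edge_segment:
  assumes sub: "subdivision \<Omega> \<T>" and \<Omega>: "open \<Omega>" "convex \<Omega>" and e: "e \<in> boundary_edges \<Omega> \<T>"
  shows "\<exists>a b. e = closed_segment a b"
proof -
  obtain K s where K: "K \<in> \<T>" "s \<in> sides K" "e = s \<inter> frontier \<Omega>" "positive_length e"
    using e by (auto simp: boundary_edges_def)
  obtain p q where s: "s = closed_segment p q" "p \<in> region K" "q \<in> region K"
  proof (cases K)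
    case (Triangle a b c)
    then show ?thesis using that K(2) hull_subset[of "{a, b, c}" convex] by auto
  next
    case (Rectangle a u v)
    then show ?thesis using that K(2) hull_subset[of "{a, a + u, a + u + v, a + v}" convex] by auto
  qed
  have reg: "region K \<subseteq> closure \<Omega>" using sub K(1) by (auto simp: subdivision_def)
  have s_clos: "s \<subseteq> closure \<Omega>"
    using closed_segment_subset[OF s(2,3) convex_region] reg by (simp add: s(1))
  \<comment> \<open>a side that meets \<open>\<Omega>\<close> lies in \<open>\<Omega>\<close>
    up to its endpoints, and two points contain no segment\<close>
  have "s \<inter> \<Omega> = {}"
  proof (rule ccontr)
    assume "s \<inter> \<Omega> \<noteq> {}"
    then obtain z where z: "z \<in> s" "z \<in> \<Omega>" by blast
    have open_sub: "open_segment z y \<subseteq> \<Omega>" if "y \<in> s" for y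
      using in_interior_closure_convex_segment[OF \<Omega>(2), of z y] z that s_clos interior_open[OF \<Omega>(1)]
      by auto
    have "s \<subseteq> {p, q, z} \<union> open_segment z p \<union> open_segment z q"
    proof (cases "z \<in> open_segment p q")
      case True
      show ?thesis unfolding s(1) closed_segment_eq_open Un_open_segment[OF True, symmetric]
        by (auto simp: open_segment_commute)
    next
      case False
      then have "z = p \<or> z = q" using z(1) by (auto simp: s(1) closed_segment_eq_open)
      then show ?thesis unfolding s(1) closed_segment_eq_open by (auto simp: open_segment_commute)
    qed
    moreover have "p \<in> s" "q \<in> s" by (auto simp: s(1))
    ultimately have "s \<subseteq> {p, q} \<union> \<Omega>" using open_sub z(2) by blast
    moreover have "frontier \<Omega> \<inter> \<Omega> = {}" using \<Omega>(1) by (simp add: frontier_disjoint_eq)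
    ultimately have "e \<subseteq> {p, q}" using K(3) by blast
    then have "finite e" using finite_subset by blast
    then show False using K(4) finite_subset finite_closed_segment by (metis positive_length_def)
  qed
  then have "s \<subseteq> frontier \<Omega>" using s_clos \<Omega>(1) by (auto simp: frontier_def interior_open)
  then show ?thesis using K(3) s(1) by blast
qed

lemma edge_segment:
  assumes "subdivision \<Omega> \<T>" "open \<Omega>" "convex \<Omega>" "e \<in> edges \<Omega> \<T>"
  shows "\<exists>a b. e = closed_segment a b"
  using assms interior_edge_segment boundary_edge_segment unfolding edges_def by blast

section \<open>Edge integrals\<close>

text \<open>The integral along an edge is taken along a parametrization that is known only up to orientation; this
asks for integrability along every one.\<close>

definition edge_integrable :: "pt set \<Rightarrow> (pt \<Rightarrow> real) \<Rightarrow> bool" where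
  "edge_integrable e g \<longleftrightarrow>
     (\<forall>a b. e = closed_segment a b \<longrightarrow> integrable (lebesgue_on {0..1}) (\<lambda>t. g (a + t *\<^sub>R (b - a))))"

text \<open>The chosen endpoints do parametrize the edge once the edge is known to be a segment.\<close>

lemma edge_integral_eq:
  assumes "\<exists>a b. e = closed_segment a b"
  obtains a b where "e = closed_segment a b"
    "\<And>g. edge_integral e g = dist a b * (\<integral>t. g (a + t *\<^sub>R (b - a)) \<partial>lebesgue_on {0..1})"
proof -
  obtain a b where ab: "(SOME (a, b). e = closed_segment a b) = (a, b)" by fastforce
  have "case (a, b) of (a, b) \<Rightarrow> e = closed_segment a b"
    unfolding ab[symmetric] by (rule someI_ex) (use assms in auto)
  then have "e = closed_segment a b" by simp
  then show thesis by (rule that) (simp only: edge_integral_def Let_def ab prod.case)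
qed

lemma segment_point: "t \<in> {0..1} \<Longrightarrow> a + t *\<^sub>R (b - a) \<in> closed_segment a b"
  by (auto simp: in_segment algebra_simps intro!: exI[of _ t])

lemma linear_functional_on_edge_integral:
  assumes V: "fun_subspace V" and e: "\<exists>a b. e = closed_segment a b"
    and lin: "\<And>x. x \<in> e \<Longrightarrow> linear_functional_on V (\<lambda>v. g v x)"
    and int: "\<And>v. v \<in> V \<Longrightarrow> edge_integrable e (g v)"
  shows "linear_functional_on V (\<lambda>v. edge_integral e (g v))"
proof -
  obtain a b where ab: "e = closed_segment a b"
    "\<And>g. edge_integral e g = dist a b * (\<integral>t. g (a + t *\<^sub>R (b - a)) \<partial>lebesgue_on {0..1})"
    using edge_integral_eq[OF e] by blast
  show ?thesis unfolding ab(2)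
  proof (intro linear_functional_on_cmult linear_functional_on_integral[OF V] AE_I2)
    fix t :: real assume "t \<in> space (lebesgue_on {0..1})"
    then show "linear_functional_on V (\<lambda>v. g v (a + t *\<^sub>R (b - a)))"
      using lin[of "a + t *\<^sub>R (b - a)"] segment_point[of t a b] by (simp add: ab(1))
  qed (use int ab(1) in \<open>auto simp: edge_integrable_def\<close>)
qed

lemma edge_integrable_continuous:
  assumes "continuous_on e g" shows "edge_integrable e g"
  unfolding edge_integrable_def
proof (intro allI impI continuous_imp_integrable_real)
  fix a b assume e: "e = closed_segment a b"
  show "continuous_on {0..1} (\<lambda>t. g (a + t *\<^sub>R (b - a)))"
    by (rule continuous_on_compose2[OF assms]) (auto intro!: continuous_intros segment_point simp: e)
qed

text \<open>For the term with \<open>C\<^sub>1\<^sub>2\<close>, which is bounded and measurable but perhaps not continuous along the edge.\<close>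

lemma edge_integrable_bounded_mult:
  fixes C :: "pt \<Rightarrow> pt"
  assumes C: "C \<in> borel_measurable (restrict_space borel S)" and e: "e \<subseteq> S"
    and bound: "\<And>x. x \<in> S \<Longrightarrow> norm (C x) \<le> c"
    and J: "continuous_on e J" and N: "continuous_on e N"
  shows "edge_integrable e (\<lambda>x. (C x \<bullet> J x) * N x)"
  unfolding edge_integrable_def
proof (intro allI impI)
  fix a b assume ab: "e = closed_segment a b"
  define \<gamma> where "\<gamma> t = a + t *\<^sub>R (b - a)" for t :: real
  have \<gamma>: "\<gamma> t \<in> e" if "t \<in> {0..1}" for t using segment_point[OF that] by (simp add: ab \<gamma>_def)
  have cont_\<gamma>: "continuous_on {0..1} \<gamma>" unfolding \<gamma>_def by (intro continuous_intros)
  have cJ: "continuous_on {0..1} (\<lambda>t. J (\<gamma> t))" and cN: "continuous_on {0..1} (\<lambda>t. N (\<gamma> t))"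
    using \<gamma> by (auto intro!: continuous_on_compose2[OF J cont_\<gamma>] continuous_on_compose2[OF N cont_\<gamma>])
  have m\<gamma>: "\<gamma> \<in> measurable (lebesgue_on {0..1}) (restrict_space borel S)"
    using \<gamma> e by (intro measurable_restrict_space2 continuous_imp_measurable_on_sets_lebesgue[OF cont_\<gamma>])
      auto
  have mC: "(\<lambda>t. C (\<gamma> t)) \<in> borel_measurable (lebesgue_on {0..1})"
    by (rule measurable_compose[OF m\<gamma> C])
  have mJ: "(\<lambda>t. J (\<gamma> t)) \<in> borel_measurable (lebesgue_on {0..1})"
    and mN: "(\<lambda>t. N (\<gamma> t)) \<in> borel_measurable (lebesgue_on {0..1})"
    by (auto intro!: continuous_imp_measurable_on_sets_lebesgue cJ cN)
  have ce: "compact e" by (simp add: ab)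
  obtain j where j: "\<And>x. x \<in> e \<Longrightarrow> norm (J x) \<le> j"
    using compact_imp_bounded[OF compact_continuous_image[OF J ce]] by (auto simp: bounded_iff)
  obtain n where n: "\<And>x. x \<in> e \<Longrightarrow> norm (N x) \<le> n"
    using compact_imp_bounded[OF compact_continuous_image[OF N ce]] by (auto simp: bounded_iff)
  interpret finite_measure "lebesgue_on {0..1::real}"
    by (rule finite_measure_lebesgue_on) simp
  show "integrable (lebesgue_on {0..1}) (\<lambda>t. (C (a + t *\<^sub>R (b - a)) \<bullet> J (a + t *\<^sub>R (b - a))) * N (a + t *\<^sub>R (b - a)))"
    unfolding \<gamma>_def[symmetric]
  proof (rule integrable_const_bound)
    show "AE t in lebesgue_on {0..1}. norm ((C (\<gamma> t) \<bullet> J (\<gamma> t)) * N (\<gamma> t)) \<le> (c * j) * n"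
    proof (rule AE_I2)
      fix t :: real assume "t \<in> space (lebesgue_on {0..1})"
      then have t: "\<gamma> t \<in> e" using \<gamma> by simp
      have "\<bar>C (\<gamma> t) \<bullet> J (\<gamma> t)\<bar> \<le> norm (C (\<gamma> t)) * norm (J (\<gamma> t))" by (rule Cauchy_Schwarz_ineq2)
      also have "\<dots> \<le> c * j"
        using bound[of "\<gamma> t"] j[OF t] t e order_trans[OF norm_ge_zero bound[of "\<gamma> t"]] by (intro mult_mono) auto
      finally have "\<bar>C (\<gamma> t) \<bullet> J (\<gamma> t)\<bar> \<le> c * j" .
      then have "\<bar>C (\<gamma> t) \<bullet> J (\<gamma> t)\<bar> * \<bar>N (\<gamma> t)\<bar> \<le> (c * j) * n"
        using n[OF t] by (intro mult_mono) auto
      then show "norm ((C (\<gamma> t) \<bullet> J (\<gamma> t)) * N (\<gamma> t)) \<le> (c * j) * n" by (simp add: abs_mult)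
    qed
    show "(\<lambda>t. (C (\<gamma> t) \<bullet> J (\<gamma> t)) * N (\<gamma> t)) \<in> borel_measurable (lebesgue_on {0..1})"
      using mC mJ mN by (intro borel_measurable_times borel_measurable_inner)
  qed
qed

lemma edge_integral_nonneg: "(\<And>x. g x \<ge> 0) \<Longrightarrow> edge_integral e g \<ge> 0"
  by (simp add: edge_integral_def split_def Let_def)

section \<open>Traces\<close>

text \<open>What traces need: on every element, a continuous extension up to the boundary. Both discrete spaces
consist of such functions, so jumps and means are treated once for both.\<close>

definition piecewise_continuous :: "element set \<Rightarrow> (pt \<Rightarrow> 'b::euclidean_space) set" where
  "piecewise_continuous \<T> =
     {v. \<forall>K\<in>\<T>. \<exists>q. continuous_on UNIV q \<and> (\<forall>x\<in>interior (region K). v x = q x)}"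

lemma V_space_piecewise_continuous: "V_space \<T> deg \<subseteq> piecewise_continuous \<T>"
proof
  fix v assume v: "v \<in> V_space \<T> deg"
  have "\<exists>q. continuous_on UNIV q \<and> (\<forall>x\<in>interior (region K). v x = q x)" if K: "K \<in> \<T>" for K
  proof -
    obtain q where "q \<in> local_space (deg K) K" "\<And>x. x \<in> interior (region K) \<Longrightarrow> v x = q x"
      using V_space_local[OF v K] by blast
    then show ?thesis using C1_continuous[OF C1_local_space] by blast
  qed
  then show "v \<in> piecewise_continuous \<T>" by (simp add: piecewise_continuous_def)
qed

lemma W_space_piecewise_continuous: "W_space \<T> deg \<subseteq> piecewise_continuous \<T>"
proof
  fix w assume w: "w \<in> W_space \<T> deg"
  have "\<exists>q. continuous_on UNIV q \<and> (\<forall>x\<in>interior (region K). w x = q x)" if K: "K \<in> \<T>" for K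
    by (rule W_space_local[OF w K]) blast
  then show "w \<in> piecewise_continuous \<T>" by (simp add: piecewise_continuous_def)
qed

text \<open>A point of an element is a limit point of the interior of the element, so the limit that defines the
trace exists, is unique and is the value of the continuous extension.\<close>

lemma trace_from_eq:
  fixes q :: "pt \<Rightarrow> 'b::euclidean_space"
  assumes "nondegenerate K" "x \<in> region K" "continuous_on UNIV q"
    and v: "\<And>y. y \<in> interior (region K) \<Longrightarrow> v y = q y"
  shows "trace_from K v x = q x"
  unfolding trace_from_def
proof (rule tendsto_Lim)
  have "x \<in> closure (interior (region K))" using assms closure_interior_region by simp
  then have "x islimpt interior (region K)"
    by (metis Un_iff closure_def interior_interior interior_limit_point mem_Collect_eq)
  then show "\<not> trivial_limit (at x within interior (region K))" by (simp add: trivial_limit_within)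
  have "(q \<longlongrightarrow> q x) (at x within UNIV)" using assms(3) by (simp add: continuous_on_def)
  then have "(q \<longlongrightarrow> q x) (at x within interior (region K))" by (rule tendsto_within_subset) simp
  then show "(v \<longlongrightarrow> q x) (at x within interior (region K))"
    by (rule Lim_transform_eventually) (simp add: eventually_at_filter v)
qed

lemma piecewise_continuous_trace:
  assumes "v \<in> piecewise_continuous \<T>" "K \<in> \<T>" "nondegenerate K"
  obtains q where "continuous_on UNIV q" "\<And>x. x \<in> interior (region K) \<Longrightarrow> v x = q x"
    "\<And>x. x \<in> region K \<Longrightarrow> trace_from K v x = q x"
  using assms trace_from_eq[OF assms(3)] unfolding piecewise_continuous_def by blast

lemma linear_functional_on_trace:
  fixes y :: "'b::euclidean_space"
  assumes K: "K \<in> \<T>" "nondegenerate K" "x \<in> region K"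
  shows "linear_functional_on (piecewise_continuous \<T>) (\<lambda>v. trace_from K v x \<bullet> y)"
proof (rule linear_functional_onI)
  fix u v :: "pt \<Rightarrow> 'b" assume uv: "u \<in> piecewise_continuous \<T>" "v \<in> piecewise_continuous \<T>"
  obtain p where p: "continuous_on UNIV p" "\<And>x. x \<in> interior (region K) \<Longrightarrow> u x = p x"
      "\<And>x. x \<in> region K \<Longrightarrow> trace_from K u x = p x"
    using piecewise_continuous_trace[OF uv(1) K(1,2)] by blast
  obtain q where q: "continuous_on UNIV q" "\<And>x. x \<in> interior (region K) \<Longrightarrow> v x = q x"
      "\<And>x. x \<in> region K \<Longrightarrow> trace_from K v x = q x"
    using piecewise_continuous_trace[OF uv(2) K(1,2)] by blast
  have "trace_from K (\<lambda>x. u x + v x) x = p x + q x"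
    by (rule trace_from_eq[OF K(2,3)]) (intro continuous_intros p(1) q(1), simp add: p(2) q(2))
  then show "trace_from K (\<lambda>x. u x + v x) x \<bullet> y = trace_from K u x \<bullet> y + trace_from K v x \<bullet> y"
    by (simp add: p(3) q(3) K(3) inner_add_left)
next
  fix c and u :: "pt \<Rightarrow> 'b" assume u: "u \<in> piecewise_continuous \<T>"
  obtain p where p: "continuous_on UNIV p" "\<And>x. x \<in> interior (region K) \<Longrightarrow> u x = p x"
      "\<And>x. x \<in> region K \<Longrightarrow> trace_from K u x = p x"
    using piecewise_continuous_trace[OF u K(1,2)] by blast
  have "trace_from K (\<lambda>x. c *\<^sub>R u x) x = c *\<^sub>R p x"
    by (rule trace_from_eq[OF K(2,3)]) (intro continuous_intros p(1), simp add: p(2))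
  then show "trace_from K (\<lambda>x. c *\<^sub>R u x) x \<bullet> y = c * (trace_from K u x \<bullet> y)"
    by (simp add: p(3) K(3))
qed

lemma continuous_on_trace:
  assumes "v \<in> piecewise_continuous \<T>" "K \<in> \<T>" "nondegenerate K" "e \<subseteq> region K"
  shows "continuous_on e (trace_from K v)"
proof -
  obtain q where q: "continuous_on UNIV q" "\<And>x. x \<in> interior (region K) \<Longrightarrow> v x = q x"
      "\<And>x. x \<in> region K \<Longrightarrow> trace_from K v x = q x"
    using piecewise_continuous_trace[OF assms(1-3)] by blast
  have "continuous_on e q" using continuous_on_subset[OF q(1)] by simp
  then show ?thesis by (rule continuous_on_eq) (use assms(4) q(3) in auto)
qed

lemma adjacentD:
  assumes "subdivision \<Omega> \<T>" "K \<in> adjacent \<T> e"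
  shows "K \<in> \<T>" "nondegenerate K" "e \<subseteq> region K"
  using assms frontier_region_subset[of K] by (auto simp: adjacent_def subdivision_def)

lemma linear_functional_on_jump:
  assumes "subdivision \<Omega> \<T>" "x \<in> e"
  shows "linear_functional_on (piecewise_continuous \<T>) (\<lambda>v. \<xi> \<bullet> jump \<T> e v x)"
proof -
  have "linear_functional_on (piecewise_continuous \<T>)
      (\<lambda>v. \<Sum>K\<in>adjacent \<T> e. (trace_from K v x \<bullet> (1::real)) * (\<xi> \<bullet> outward_normal K e))"
    using adjacentD[OF assms(1)] assms(2)
    by (intro linear_functional_on_sum linear_functional_on_multc linear_functional_on_trace) blast+
  then show ?thesis by (simp add: jump_def inner_sum_right inner_real_def)
qed

lemma linear_functional_on_normal_jump:
  assumes "subdivision \<Omega> \<T>" "x \<in> e"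
  shows "linear_functional_on (piecewise_continuous \<T>) (\<lambda>w. normal_jump \<T> e w x)"
  unfolding normal_jump_def using adjacentD[OF assms(1)] assms(2)
  by (intro linear_functional_on_sum linear_functional_on_trace) blast+

lemma linear_functional_on_average:
  assumes "subdivision \<Omega> \<T>" "x \<in> e"
  shows "linear_functional_on (piecewise_continuous \<T>) (\<lambda>w. average \<T> e w x \<bullet> \<xi>)"
proof -
  have "linear_functional_on (piecewise_continuous \<T>)
      (\<lambda>w. (1 / real (card (adjacent \<T> e))) * (\<Sum>K\<in>adjacent \<T> e. trace_from K w x \<bullet> \<xi>))"
    using adjacentD[OF assms(1)] assms(2)
    by (intro linear_functional_on_cmult linear_functional_on_sum linear_functional_on_trace) blast+
  then show ?thesis by (simp add: average_def inner_sum_left)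
qed

lemma continuous_on_jump:
  assumes "subdivision \<Omega> \<T>" "v \<in> piecewise_continuous \<T>"
  shows "continuous_on e (jump \<T> e v)"
  unfolding jump_def using adjacentD[OF assms(1)]
  by (intro continuous_intros continuous_on_trace[OF assms(2)]) auto

lemma continuous_on_normal_jump:
  assumes "subdivision \<Omega> \<T>" "w \<in> piecewise_continuous \<T>"
  shows "continuous_on e (normal_jump \<T> e w)"
  unfolding normal_jump_def using adjacentD[OF assms(1)]
  by (intro continuous_intros continuous_on_trace[OF assms(2)]) auto

lemma continuous_on_average:
  assumes "subdivision \<Omega> \<T>" "w \<in> piecewise_continuous \<T>"
  shows "continuous_on e (average \<T> e w)"
  unfolding average_def using adjacentD[OF assms(1)]
  by (intro continuous_intros continuous_on_trace[OF assms(2)]) auto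

section \<open>The broken gradient\<close>

lemma grad_eq:
  assumes "(v has_derivative (\<lambda>h. g \<bullet> h)) (at x)" shows "grad v x = g"
proof -
  have "frechet_derivative v (at x) = (\<lambda>h. g \<bullet> h)" using frechet_derivative_at[OF assms] by simp
  then show ?thesis by (simp add: grad_def vec_eq_iff inner_axis)
qed

lemma V_space_grad:
  assumes "v \<in> V_space \<T> deg" "K \<in> \<T>"
  obtains g where "continuous_on UNIV g"
    "\<And>x. x \<in> interior (region K) \<Longrightarrow> (v has_derivative (\<lambda>h. g x \<bullet> h)) (at x)"
proof -
  obtain q where q: "q \<in> local_space (deg K) K" "\<And>x. x \<in> interior (region K) \<Longrightarrow> v x = q x"
    using V_space_local[OF assms] by blast
  obtain g where g: "continuous_on UNIV g" "\<And>x. (q has_derivative (\<lambda>h. g x \<bullet> h)) (at x)"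
    using C1_local_space[OF q(1)] by (auto simp: C1_def)
  show thesis
  proof (rule that[OF g(1)])
    fix x assume "x \<in> interior (region K)"
    then show "(v has_derivative (\<lambda>h. g x \<bullet> h)) (at x)"
      using has_derivative_transform_within_open[OF g(2) open_interior, of x "region K" v] q(2) by auto
  qed
qed

lemma linear_functional_on_grad:
  assumes "K \<in> \<T>" "x \<in> interior (region K)"
  shows "linear_functional_on (V_space \<T> deg) (\<lambda>v. \<xi> \<bullet> grad v x)"
proof (rule linear_functional_onI)
  fix u v assume uv: "u \<in> V_space \<T> deg" "v \<in> V_space \<T> deg"
  obtain g where g: "(u has_derivative (\<lambda>k. g \<bullet> k)) (at x)"
    using V_space_grad[OF uv(1) assms(1)] assms(2) by blast
  obtain h where h: "(v has_derivative (\<lambda>k. h \<bullet> k)) (at x)"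
    using V_space_grad[OF uv(2) assms(1)] assms(2) by blast
  note gh = g h
  have "((\<lambda>x. u x + v x) has_derivative (\<lambda>k. (g + h) \<bullet> k)) (at x)"
    using has_derivative_add[OF gh] by (simp add: inner_add_left)
  then show "\<xi> \<bullet> grad (\<lambda>x. u x + v x) x = \<xi> \<bullet> grad u x + \<xi> \<bullet> grad v x"
    using gh by (simp add: grad_eq inner_add_right)
next
  fix c u assume u: "u \<in> V_space \<T> deg"
  obtain g where g: "(u has_derivative (\<lambda>k. g \<bullet> k)) (at x)"
    using V_space_grad[OF u assms(1)] assms(2) by blast
  have "((\<lambda>x. c *\<^sub>R u x) has_derivative (\<lambda>k. (c *\<^sub>R g) \<bullet> k)) (at x)"
    using has_derivative_scaleR_right[OF g, of c] by simp
  then show "\<xi> \<bullet> grad (\<lambda>x. c *\<^sub>R u x) x = c * (\<xi> \<bullet> grad u x)"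
    using g by (simp only: grad_eq inner_scaleR_right)
qed

text \<open>The frontier of a convex set is negligible; hence the arbitrary values of the gradient on it do not
influence integrals over the element.\<close>

lemma AE_interior_region: "AE x in lebesgue_on (region K). x \<in> interior (region K)"
proof -
  have "frontier (region K) \<in> null_sets lebesgue"
    using negligible_convex_frontier[OF convex_region] by (simp add: negligible_iff_null_sets)
  then have "AE x in lebesgue. x \<notin> frontier (region K)" by (rule AE_not_in)
  then have "AE x in lebesgue. x \<in> region K \<longrightarrow> x \<in> interior (region K)"
    by eventually_elim (auto simp: frontier_def closure_closed compact_imp_closed compact_region)
  then show ?thesis
    by (subst AE_restrict_space_iff) (auto simp: compact_region lmeasurable_compact fmeasurableD)
qed

lemma integrable_region:
  fixes h :: "pt \<Rightarrow> real"
  assumes "continuous_on UNIV h" "\<And>x. x \<in> interior (region K) \<Longrightarrow> f x = h x"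
  shows "integrable (lebesgue_on (region K)) f"
proof -
  have meas: "region K \<in> sets lebesgue" by (simp add: compact_region lmeasurable_compact fmeasurableD)
  have "continuous_on (region K) h" using assms(1) continuous_on_subset by blast
  then have "integrable lborel (\<lambda>x. indicator (region K) x *\<^sub>R h x)"
    by (rule borel_integrable_compact[OF compact_region])
  then have "h absolutely_integrable_on (region K)"
    unfolding set_integrable_def by (subst integrable_completion) (auto dest: borel_measurable_integrable)
  then have "f absolutely_integrable_on (region K)"
  proof (rule absolutely_integrable_spike)
    show "negligible (frontier (region K))" by (rule negligible_convex_frontier[OF convex_region])
    show "f x = h x" if "x \<in> region K - frontier (region K)" for x
      using that assms(2) by (auto simp: frontier_def closure_closed compact_imp_closed compact_region)
  qed
  then show ?thesis unfolding set_integrable_def by (subst integrable_restrict_space) (auto simp: meas)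
qed

lemma integrable_inner_grad:
  assumes "v \<in> V_space \<T> deg" "p \<in> piecewise_continuous \<T>" "K \<in> \<T>"
  shows "integrable (lebesgue_on (region K)) (\<lambda>x. p x \<bullet> grad v x)"
proof -
  obtain g where g: "continuous_on UNIV g"
    "\<And>x. x \<in> interior (region K) \<Longrightarrow> (v has_derivative (\<lambda>h. g x \<bullet> h)) (at x)"
    using V_space_grad[OF assms(1,3)] by blast
  obtain q where q: "continuous_on UNIV q" "\<And>x. x \<in> interior (region K) \<Longrightarrow> p x = q x"
    using assms(2,3) by (auto simp: piecewise_continuous_def)
  show ?thesis
    by (rule integrable_region[of "\<lambda>x. q x \<bullet> g x"])
      (auto intro!: continuous_intros g(1) q(1) simp: q(2) grad_eq[OF g(2)])
qed

section \<open>The forms are bilinear\<close>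

text \<open>Each of the three terms is an integral of an expression that is linear in each argument at
(almost) every point; what remains is integrability of all integrands.\<close>

lemma bilinear_on_form_A1:
  assumes sub: "subdivision \<Omega> \<T>" and \<Omega>: "open \<Omega>" "convex \<Omega>" and C12: "admissible_C12 c0 c1 \<T> C12"
  shows "bilinear_on (V_space \<T> deg) (W_space \<T> deg) (form_A1 \<Omega> \<T> C12)"
proof -
  let ?V = "V_space \<T> deg" and ?W = "W_space \<T> deg"
  note V = fun_subspace_V_space[of \<T> deg] and W = fun_subspace_W_space[of \<T> deg]
  have pcV: "v \<in> piecewise_continuous \<T>" if "v \<in> ?V" for v
    using that V_space_piecewise_continuous by blast
  have pcW: "w \<in> piecewise_continuous \<T>" if "w \<in> ?W" for w
    using that W_space_piecewise_continuous by blast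
  have seg: "\<exists>a b. e = closed_segment a b" if "e \<in> edges \<Omega> \<T>" for e
    using edge_segment[OF sub \<Omega> that] .
  have int_sub: "interior_edges \<T> \<subseteq> edges \<Omega> \<T>" by (auto simp: edges_def)
  have avg: "edge_integrable e (\<lambda>x. average \<T> e p x \<bullet> jump \<T> e v x)" if "v \<in> ?V" "p \<in> ?W" for v p e
    using that by (intro edge_integrable_continuous continuous_intros continuous_on_average[OF sub]
        continuous_on_jump[OF sub] pcV pcW)
  have jmp: "edge_integrable e (\<lambda>x. (C12 x \<bullet> jump \<T> e v x) * normal_jump \<T> e p x)"
    if "v \<in> ?V" "p \<in> ?W" "e \<in> interior_edges \<T>" for v p e
  proof (rule edge_integrable_bounded_mult)
    show "C12 \<in> borel_measurable (restrict_space borel (\<Union>(interior_edges \<T>)))"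
      "\<And>x. x \<in> \<Union>(interior_edges \<T>) \<Longrightarrow> norm (C12 x) \<le> c1"
      using C12 by (auto simp: admissible_C12_def)
  qed (use that in \<open>auto intro!: continuous_on_jump[OF sub] continuous_on_normal_jump[OF sub] pcV pcW\<close>)
  show ?thesis
  proof (rule bilinear_onI)
    fix p assume p: "p \<in> ?W"
    have lin: "linear_functional_on ?V (\<lambda>v. \<xi> \<bullet> jump \<T> e v x)" if "x \<in> e" for x e \<xi>
      using linear_functional_on_subset[OF linear_functional_on_jump[OF sub that] V_space_piecewise_continuous] .
    show "linear_functional_on ?V (\<lambda>v. form_A1 \<Omega> \<T> C12 v p)"
      unfolding form_A1_def
    proof (intro linear_functional_on_add linear_functional_on_diff linear_functional_on_sum)
      fix K assume K: "K \<in> \<T>"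
      show "linear_functional_on ?V (\<lambda>v. \<integral>x. p x \<bullet> grad v x \<partial>lebesgue_on (region K))"
      proof (rule linear_functional_on_integral[OF V])
        show "AE x in lebesgue_on (region K). linear_functional_on ?V (\<lambda>v. p x \<bullet> grad v x)"
          using AE_interior_region by eventually_elim (rule linear_functional_on_grad[OF K])
      qed (rule integrable_inner_grad[OF _ pcW[OF p] K])
    next
      fix e assume e: "e \<in> edges \<Omega> \<T>"
      show "linear_functional_on ?V (\<lambda>v. edge_integral e (\<lambda>x. average \<T> e p x \<bullet> jump \<T> e v x))"
        by (rule linear_functional_on_edge_integral[OF V seg[OF e]]) (auto intro: lin avg p)
    next
      fix e assume e: "e \<in> interior_edges \<T>"
      then have "e \<in> edges \<Omega> \<T>" using int_sub by blast
      then show "linear_functional_on ?V (\<lambda>v. edge_integral e (\<lambda>x. (C12 x \<bullet> jump \<T> e v x) * normal_jump \<T> e p x))"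
        by (intro linear_functional_on_edge_integral[OF V seg] linear_functional_on_multc lin jmp p e)
    qed
  next
    fix v assume v: "v \<in> ?V"
    have linN: "linear_functional_on ?W (\<lambda>w. normal_jump \<T> e w x)" if "x \<in> e" for x e
      using linear_functional_on_subset[OF linear_functional_on_normal_jump[OF sub that] W_space_piecewise_continuous] .
    have linA: "linear_functional_on ?W (\<lambda>w. average \<T> e w x \<bullet> \<xi>)" if "x \<in> e" for x e \<xi>
      using linear_functional_on_subset[OF linear_functional_on_average[OF sub that] W_space_piecewise_continuous] .
    show "linear_functional_on ?W (\<lambda>p. form_A1 \<Omega> \<T> C12 v p)"
      unfolding form_A1_def
    proof (intro linear_functional_on_add linear_functional_on_diff linear_functional_on_sum)
      fix K assume K: "K \<in> \<T>"
      show "linear_functional_on ?W (\<lambda>p. \<integral>x. p x \<bullet> grad v x \<partial>lebesgue_on (region K))"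
        by (intro linear_functional_on_integral[OF W] integrable_inner_grad[OF v _ K] AE_I2 pcW)
          (auto simp: linear_functional_on_def inner_add_left)
    next
      fix e assume e: "e \<in> edges \<Omega> \<T>"
      show "linear_functional_on ?W (\<lambda>p. edge_integral e (\<lambda>x. average \<T> e p x \<bullet> jump \<T> e v x))"
        by (rule linear_functional_on_edge_integral[OF W seg[OF e]]) (auto intro: linA avg v)
    next
      fix e assume e: "e \<in> interior_edges \<T>"
      then have "e \<in> edges \<Omega> \<T>" using int_sub by blast
      then show "linear_functional_on ?W (\<lambda>p. edge_integral e (\<lambda>x. (C12 x \<bullet> jump \<T> e v x) * normal_jump \<T> e p x))"
        by (intro linear_functional_on_edge_integral[OF W seg] linear_functional_on_cmult linN jmp v e)
    qed
  qed
qed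

lemma form_J_commute: "form_J \<zeta> \<alpha> \<Omega> \<T> deg u v = form_J \<zeta> \<alpha> \<Omega> \<T> deg v u"
  by (simp add: form_J_def inner_commute)

lemma form_J1_commute: "form_J1 \<kappa> \<beta> \<T> deg p w = form_J1 \<kappa> \<beta> \<T> deg w p"
  by (simp add: form_J1_def mult_ac)

lemma bilinear_on_form_J:
  assumes sub: "subdivision \<Omega> \<T>" and \<Omega>: "open \<Omega>" "convex \<Omega>"
  shows "bilinear_on (V_space \<T> deg) (V_space \<T> deg) (form_J \<zeta> \<alpha> \<Omega> \<T> deg)"
proof -
  let ?V = "V_space \<T> deg"
  have pcV: "v \<in> piecewise_continuous \<T>" if "v \<in> ?V" for v
    using that V_space_piecewise_continuous by blast
  have "linear_functional_on ?V (form_J \<zeta> \<alpha> \<Omega> \<T> deg u)" if u: "u \<in> ?V" for u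
    unfolding form_J_def
  proof (intro linear_functional_on_sum
      linear_functional_on_edge_integral[OF fun_subspace_V_space edge_segment[OF sub \<Omega>]]
      linear_functional_on_cmult)
    fix e :: "pt set" and x assume "x \<in> e"
    then show "linear_functional_on ?V (\<lambda>v. jump \<T> e u x \<bullet> jump \<T> e v x)"
      using linear_functional_on_subset[OF linear_functional_on_jump[OF sub] V_space_piecewise_continuous] by blast
  next
    fix e v assume "v \<in> ?V"
    then show "edge_integrable e (\<lambda>x. C11 \<zeta> \<alpha> \<T> deg e * (jump \<T> e u x \<bullet> jump \<T> e v x))"
      using u by (intro edge_integrable_continuous continuous_intros continuous_on_jump[OF sub] pcV)
  qed
  then show ?thesis by (intro bilinear_onI) (simp_all add: form_J_commute[of \<zeta> \<alpha> \<Omega> \<T> deg _ w for w])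
qed

lemma bilinear_on_form_J1:
  assumes sub: "subdivision \<Omega> \<T>" and \<Omega>: "open \<Omega>" "convex \<Omega>"
  shows "bilinear_on (W_space \<T> deg) (W_space \<T> deg) (form_J1 \<kappa> \<beta> \<T> deg)"
proof -
  let ?W = "W_space \<T> deg"
  have pcW: "w \<in> piecewise_continuous \<T>" if "w \<in> ?W" for w
    using that W_space_piecewise_continuous by blast
  have "linear_functional_on ?W (form_J1 \<kappa> \<beta> \<T> deg p)" if p: "p \<in> ?W" for p
    unfolding form_J1_def
  proof (intro linear_functional_on_sum
      linear_functional_on_edge_integral[OF fun_subspace_W_space interior_edge_segment[OF sub]]
      linear_functional_on_cmult)
    fix e :: "pt set" and x assume "x \<in> e"
    then show "linear_functional_on ?W (\<lambda>w. normal_jump \<T> e w x)"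
      using linear_functional_on_subset[OF linear_functional_on_normal_jump[OF sub] W_space_piecewise_continuous] by blast
  next
    fix e w assume "w \<in> ?W"
    then show "edge_integrable e (\<lambda>x. C22 \<kappa> \<beta> \<T> deg e * normal_jump \<T> e p x * normal_jump \<T> e w x)"
      using p by (intro edge_integrable_continuous continuous_intros continuous_on_normal_jump[OF sub] pcW)
  qed
  then show ?thesis by (intro bilinear_onI) (simp_all add: form_J1_commute[of \<kappa> \<beta> \<T> deg _ w for w])
qed

lemma Min_image_nonneg:
  assumes "finite S" "S \<noteq> {}" "\<And>x. x \<in> S \<Longrightarrow> f x \<ge> (0::real)"
  shows "(MIN x\<in>S. f x) \<ge> 0"
  using assms by simp

text \<open>If no element borders on \<open>e\<close> then the minimum in the stabilization parameter is over the empty set and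
its sign is unknown, but then the jump is an empty sum.\<close>

lemma form_J_nonneg:
  assumes "subdivision \<Omega> \<T>" "\<zeta> \<ge> 0" shows "form_J \<zeta> \<alpha> \<Omega> \<T> deg v v \<ge> 0"
  unfolding form_J_def
proof (intro sum_nonneg edge_integral_nonneg)
  fix e x
  show "0 \<le> C11 \<zeta> \<alpha> \<T> deg e * (jump \<T> e v x \<bullet> jump \<T> e v x)"
  proof (cases "adjacent \<T> e = {}")
    case True
    then show ?thesis by (simp add: jump_def)
  next
    case False
    moreover have "finite (adjacent \<T> e)" using assms(1) by (simp add: subdivision_def adjacent_def)
    ultimately have "C11 \<zeta> \<alpha> \<T> deg e \<ge> 0"
      unfolding C11_def using assms(2) by (intro mult_nonneg_nonneg Min_image_nonneg) auto
    then show ?thesis by simp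
  qed
qed

lemma form_J1_nonneg:
  assumes "subdivision \<Omega> \<T>" "\<kappa> \<ge> 0" shows "form_J1 \<kappa> \<beta> \<T> deg w w \<ge> 0"
  unfolding form_J1_def
proof (intro sum_nonneg edge_integral_nonneg)
  fix e x
  show "0 \<le> C22 \<kappa> \<beta> \<T> deg e * normal_jump \<T> e w x * normal_jump \<T> e w x"
  proof (cases "adjacent \<T> e = {}")
    case True
    then show ?thesis by (simp add: normal_jump_def)
  next
    case False
    moreover have "finite (adjacent \<T> e)" using assms(1) by (simp add: subdivision_def adjacent_def)
    ultimately have "C22 \<kappa> \<beta> \<T> deg e \<ge> 0"
      unfolding C22_def using assms(2) by (intro mult_nonneg_nonneg Min_image_nonneg) auto
    then show ?thesis by (simp add: mult.assoc)
  qed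
qed

section \<open>Square roots of positive definite matrices\<close>

lemma matrix_vector_mult_2: "((S :: mat2) *v \<xi>) $ i = S $ i $ 1 * \<xi> $ 1 + S $ i $ 2 * \<xi> $ 2"
  by (simp add: matrix_vector_mult_def sum_2)

lemma inner_2: "(x :: pt) \<bullet> y = x $ 1 * y $ 1 + x $ 2 * y $ 2"
  by (simp add: inner_vec_def sum_2)

text \<open>Sylvester's criterion in dimension 2.\<close>

lemma pos_def_matrix_iff:
  "pos_def_matrix S \<longleftrightarrow> S $ 1 $ 2 = S $ 2 $ 1 \<and> S $ 1 $ 1 > 0 \<and> S $ 1 $ 1 * S $ 2 $ 2 - (S $ 1 $ 2)\<^sup>2 > 0"
proof
  assume S: "pos_def_matrix S"
  have "transpose S $ 2 $ 1 = S $ 2 $ 1" using S by (simp only: pos_def_matrix_def)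
  then have sym: "S $ 1 $ 2 = S $ 2 $ 1" by (simp add: transpose_def)
  have pos: "(S *v \<xi>) \<bullet> \<xi> > 0" if "\<xi> \<noteq> 0" for \<xi> using S that by (simp add: pos_def_matrix_def)
  have "axis 1 (1::real) \<noteq> (0 :: pt)" by (simp add: axis_eq_0_iff)
  from pos[OF this] have s: "S $ 1 $ 1 > 0"
    by (simp add: inner_2 matrix_vector_mult_2 axis_def)
  \<comment> \<open>the quadratic form takes the value \<open>S\<^sub>1\<^sub>1 det S\<close>
    at this vector\<close>
  let ?\<xi> = "vector [- (S $ 1 $ 2), S $ 1 $ 1] :: pt"
  have "?\<xi> $ 2 \<noteq> 0" using s by simp
  then have "?\<xi> \<noteq> 0" by (metis zero_index)
  from pos[OF this] have "S $ 1 $ 1 * (S $ 1 $ 1 * S $ 2 $ 2 - (S $ 1 $ 2)\<^sup>2) > 0"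
    by (simp add: inner_2 matrix_vector_mult_2 sym power2_eq_square algebra_simps)
  then show "S $ 1 $ 2 = S $ 2 $ 1 \<and> S $ 1 $ 1 > 0 \<and> S $ 1 $ 1 * S $ 2 $ 2 - (S $ 1 $ 2)\<^sup>2 > 0"
    using sym s by (simp add: zero_less_mult_iff)
next
  assume S: "S $ 1 $ 2 = S $ 2 $ 1 \<and> S $ 1 $ 1 > 0 \<and> S $ 1 $ 1 * S $ 2 $ 2 - (S $ 1 $ 2)\<^sup>2 > 0"
  have "(S *v \<xi>) \<bullet> \<xi> > 0" if "\<xi> \<noteq> 0" for \<xi>
  proof -
    have "S $ 1 $ 1 * ((S *v \<xi>) \<bullet> \<xi>) = (S $ 1 $ 1 * \<xi> $ 1 + S $ 1 $ 2 * \<xi> $ 2)\<^sup>2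
        + (S $ 1 $ 1 * S $ 2 $ 2 - (S $ 1 $ 2)\<^sup>2) * (\<xi> $ 2)\<^sup>2"
      using S by (simp add: inner_2 matrix_vector_mult_2 power2_eq_square algebra_simps)
    also have "\<dots> > 0"
    proof (cases "\<xi> $ 2 = 0")
      case True
      then have "\<xi> $ 1 \<noteq> 0" using that by (auto simp: vec_eq_iff forall_2)
      then show ?thesis using S True by simp
    next
      case False
      then have "(S $ 1 $ 1 * S $ 2 $ 2 - (S $ 1 $ 2)\<^sup>2) * (\<xi> $ 2)\<^sup>2 > 0"
        using S by (intro mult_pos_pos) auto
      then show ?thesis by (simp add: add_nonneg_pos)
    qed
    finally show ?thesis using S by (simp add: zero_less_mult_iff)
  qed
  moreover have "transpose S = S" using S by (simp add: transpose_def vec_eq_iff forall_2)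
  ultimately show "pos_def_matrix S" by (simp add: pos_def_matrix_def)
qed

lemma matrix_square_eq_iff:
  "(S :: mat2) ** S = A \<longleftrightarrow> (\<forall>i j. S $ i $ 1 * S $ 1 $ j + S $ i $ 2 * S $ 2 $ j = A $ i $ j)"
  by (simp add: matrix_matrix_mult_def vec_eq_iff sum_2)

lemma pos_def_sqrt_unique:
  assumes S: "pos_def_matrix S" "S ** S = A" and R: "pos_def_matrix R" "R ** R = A"
  shows "S = R"
proof -
  \<comment> \<open>by Cayley-Hamilton \<open>tr X X = A + (det X) I\<close>, and \<open>det
    X\<close> and \<open>tr X\<close> are the positive square roots of \<open>det A\<close> and
    of \<open>tr A + 2 det X\<close>; so \<open>A\<close> determines \<open>X\<close>\<close>
  define tr where "tr X = X $ 1 $ 1 + X $ 2 $ 2" for X :: mat2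
  define dt where "dt X = X $ 1 $ 1 * X $ 2 $ 2 - (X $ 1 $ 2)\<^sup>2" for X :: mat2
  have *: "X $ 1 $ 2 = X $ 2 $ 1" "dt X > 0" "tr X > 0" "(dt X)\<^sup>2 = dt A" "(tr X)\<^sup>2 = tr A + 2 * dt X"
    "X $ 1 $ 1 * tr X = A $ 1 $ 1 + dt X" "X $ 1 $ 2 * tr X = A $ 1 $ 2"
    if X: "pos_def_matrix X" "X ** X = A" for X
  proof -
    have p: "X $ 1 $ 2 = X $ 2 $ 1" "X $ 1 $ 1 > 0" "dt X > 0"
      using X(1) by (auto simp: pos_def_matrix_iff dt_def)
    have "X $ 1 $ 1 * X $ 2 $ 2 > 0"
      using p(3) zero_le_power2[of "X $ 1 $ 2"] unfolding dt_def by linarith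
    then have "X $ 2 $ 2 > 0" using p(2) by (simp add: zero_less_mult_iff)
    then show "X $ 1 $ 2 = X $ 2 $ 1" "dt X > 0" "tr X > 0" using p by (auto simp: tr_def)
    have q: "X $ i $ 1 * X $ 1 $ j + X $ i $ 2 * X $ 2 $ j = A $ i $ j" for i j
      using X(2) by (simp add: matrix_square_eq_iff)
    show "(dt X)\<^sup>2 = dt A" "(tr X)\<^sup>2 = tr A + 2 * dt X"
      "X $ 1 $ 1 * tr X = A $ 1 $ 1 + dt X" "X $ 1 $ 2 * tr X = A $ 1 $ 2"
      unfolding dt_def tr_def q[symmetric] using p(1) by (simp_all add: power2_eq_square algebra_simps)
  qed
  have dt: "dt S = dt R"
    using *(2,4)[OF S] *(2,4)[OF R] power2_eq_iff_nonneg[of "dt S" "dt R"] by simp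
  have tr: "tr S = tr R"
    using *(3,5)[OF S] *(3,5)[OF R] dt power2_eq_iff_nonneg[of "tr S" "tr R"] by simp
  have a: "S $ 1 $ 1 = R $ 1 $ 1" using *(3,6)[OF S] *(3,6)[OF R] dt tr
    by (metis less_irrefl mult_right_cancel)
  have b: "S $ 1 $ 2 = R $ 1 $ 2" using *(3,7)[OF S] *(3,7)[OF R] tr
    by (metis less_irrefl mult_right_cancel)
  have c: "S $ 2 $ 2 = R $ 2 $ 2" using a tr by (simp add: tr_def)
  show ?thesis using a b c *(1)[OF S] *(1)[OF R] by (simp add: vec_eq_iff forall_2)
qed

lemma pos_def_sqrt_exists:
  assumes "pos_def_matrix A" shows "\<exists>S. pos_def_matrix S \<and> S ** S = A"
proof -
  define a b c where "a = A $ 1 $ 1" and "b = A $ 1 $ 2" and "c = A $ 2 $ 2"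
  have A: "A $ 2 $ 1 = b" "a > 0" "a * c - b\<^sup>2 > 0"
    using assms by (auto simp: pos_def_matrix_iff a_def b_def c_def)
  have "a * c > 0" using A(3) zero_le_power2[of b] by linarith
  then have c: "c > 0" using A(2) by (simp add: zero_less_mult_iff)
  define d where "d = sqrt (a * c - b\<^sup>2)"
  have d: "d > 0" "d * d = a * c - b * b" using A(3) by (simp_all add: d_def power2_eq_square)
  define t where "t = sqrt (a + c + 2 * d)"
  have t: "t > 0" "t * t = a + c + 2 * d" using A(2) c d by (simp_all add: t_def)
  \<comment> \<open>this is \<open>(A + d I) / t\<close>, the square root that Cayley-Hamilton
    predicts, with \<open>d\<close> its determinant and \<open>t\<close> its trace\<close>
  let ?S = "vector [vector [(a + d) / t, b / t], vector [b / t, (c + d) / t]] :: mat2"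
  have "(a + d) * (c + d) - b * b = d * (t * t)"
    unfolding t(2) using d(2) by (simp add: algebra_simps)
  then have "((a + d) / t) * ((c + d) / t) - (b / t)\<^sup>2 = d"
    using t(1) by (simp add: field_simps power2_eq_square)
  then have "pos_def_matrix ?S" using A(2) c d t by (simp add: pos_def_matrix_iff)
  moreover have "?S ** ?S = A"
  proof -
    have *: "(a + d) * (a + d) + b * b = a * (t * t)" "b * b + (c + d) * (c + d) = c * (t * t)"
      "(a + d) * b + b * (c + d) = b * (t * t)" "b * (a + d) + (c + d) * b = b * (t * t)"
      unfolding t(2) using d(2) by (simp_all add: algebra_simps)
    have "x / t * (y / t) + z / t * (w / t) = r" if "x * y + z * w = r * (t * t)" for x y z w r
    proof -
      have "x / t * (y / t) + z / t * (w / t) = (x * y + z * w) / (t * t)"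
        by (simp add: add_divide_distrib)
      then show ?thesis using that t(1) by simp
    qed
    note * = this[OF *(1)] this[OF *(2)] this[OF *(3)] this[OF *(4)]
    then show ?thesis unfolding matrix_square_eq_iff
      using A(1) by (simp add: forall_2 * a_def[symmetric] b_def[symmetric] c_def[symmetric])
  qed
  ultimately show ?thesis by blast
qed

lemma matrix_sqrt:
  assumes "pos_def_matrix A"
  shows "pos_def_matrix (matrix_sqrt A)" "matrix_sqrt A ** matrix_sqrt A = A"
proof -
  have "\<exists>!S. pos_def_matrix S \<and> S ** S = A"
    using pos_def_sqrt_exists[OF assms] pos_def_sqrt_unique by blast
  from theI'[OF this] show "pos_def_matrix (matrix_sqrt A)" "matrix_sqrt A ** matrix_sqrt A = A"
    by (auto simp: matrix_sqrt_def)
qed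

lemma pos_def_matrix_inner_commute:
  assumes "pos_def_matrix A" shows "(A *v x) \<bullet> y = (A *v y) \<bullet> x"
  using assms by (simp add: pos_def_matrix_iff inner_2 matrix_vector_mult_2 algebra_simps)

text \<open>The only property of the square root that enters the triple norm: \<open>|A\<^bsup>1/2\<^esup>x|\<^sup>2 = Ax \<bullet> x\<close>.\<close>

lemma norm_matrix_sqrt:
  assumes "pos_def_matrix A"
  shows "(matrix_sqrt A *v x) \<bullet> (matrix_sqrt A *v x) = (A *v x) \<bullet> x"
  using pos_def_matrix_inner_commute[OF matrix_sqrt(1)[OF assms], of x "matrix_sqrt A *v x"]
    matrix_sqrt(2)[OF assms] by (simp add: matrix_vector_mul_assoc)

section \<open>Bounded coefficients\<close>

text \<open>What the forms with matrix coefficients need at a fixed time: the Lipschitz bound in time is a bound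
of this kind for a difference of two coefficients.\<close>

definition bounded_coeff :: "pt set \<Rightarrow> real \<Rightarrow> (pt \<Rightarrow> mat2) \<Rightarrow> bool" where
  "bounded_coeff \<Omega> M D \<longleftrightarrow>
     (\<forall>i j. (\<lambda>x. D x $ i $ j) \<in> borel_measurable (lebesgue_on \<Omega>) \<and> (\<forall>x\<in>\<Omega>. \<bar>D x $ i $ j\<bar> \<le> M))"

text \<open>The factor 4 counts the matrix entries.\<close>

lemma norm_matrix_vector_mult_le:
  assumes "\<And>i j. \<bar>(D :: mat2) $ i $ j\<bar> \<le> M"
  shows "norm (D *v \<xi>) \<le> 4 * M * norm \<xi>"
proof -
  have M: "M \<ge> 0" using assms[of 1 1] by linarith
  have "\<bar>(D *v \<xi>) $ i\<bar> \<le> 2 * M * norm \<xi>" for i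
  proof -
    have "\<bar>D $ i $ j * \<xi> $ j\<bar> \<le> M * norm \<xi>" for j
      unfolding abs_mult using assms M component_le_norm_cart by (intro mult_mono) auto
    from this[of 1] this[of 2] show ?thesis unfolding matrix_vector_mult_2 by linarith
  qed
  from this[of 1] this[of 2] show ?thesis using norm_le_l1_cart[of "D *v \<xi>"] by (simp add: sum_2)
qed

lemma measurable_component:
  "p \<in> borel_measurable M \<Longrightarrow> (\<lambda>x. (p x :: pt) $ j) \<in> borel_measurable M"
  using borel_measurable_inner[of p M "\<lambda>x. axis j 1"] by (simp add: inner_axis)

lemma L2_coeff:
  assumes D: "bounded_coeff \<Omega> M D" and p: "L2 \<Omega> p" and \<Omega>: "\<Omega> \<in> sets lebesgue"
  shows "L2 \<Omega> (\<lambda>x. D x *v p x)"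
    and "M \<ge> 0 \<Longrightarrow> L2_norm \<Omega> (\<lambda>x. D x *v p x) \<le> 4 * M * L2_norm \<Omega> p"
proof -
  have mp: "p \<in> borel_measurable (lebesgue_on \<Omega>)" using p by (simp add: L2_def)
  have meas: "(\<lambda>x. D x *v p x) \<in> borel_measurable (lebesgue_on \<Omega>)"
  proof (subst borel_measurable_euclidean_space, intro ballI)
    fix b :: pt assume "b \<in> Basis"
    then obtain i where b: "b = axis i 1" by (auto simp: Basis_vec_def)
    have "(\<lambda>x. D x $ i $ 1 * p x $ 1 + D x $ i $ 2 * p x $ 2) \<in> borel_measurable (lebesgue_on \<Omega>)"
      using D unfolding bounded_coeff_def
      by (intro borel_measurable_add borel_measurable_times measurable_component[OF mp]) blast+
    then show "(\<lambda>x. (D x *v p x) \<bullet> b) \<in> borel_measurable (lebesgue_on \<Omega>)"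
      by (simp add: b inner_axis matrix_vector_mult_2)
  qed
  have bound: "(norm (D x *v p x))\<^sup>2 \<le> (4 * M)\<^sup>2 * (norm (p x))\<^sup>2" if "x \<in> \<Omega>" for x
  proof -
    have "norm (D x *v p x) \<le> 4 * M * norm (p x)"
      using norm_matrix_vector_mult_le[of "D x" M "p x"] D that by (simp add: bounded_coeff_def)
    then show ?thesis by (simp only: power_mult_distrib[symmetric] power_mono norm_ge_zero)
  qed
  have int: "integrable (lebesgue_on \<Omega>) (\<lambda>x. (4 * M)\<^sup>2 * (norm (p x))\<^sup>2)"
    using p by (simp add: L2_def)
  have "integrable (lebesgue_on \<Omega>) (\<lambda>x. (norm (D x *v p x))\<^sup>2)"
  proof (rule Bochner_Integration.integrable_bound[OF int])
    show "(\<lambda>x. (norm (D x *v p x))\<^sup>2) \<in> borel_measurable (lebesgue_on \<Omega>)" using meas by simp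
    show "AE x in lebesgue_on \<Omega>. norm ((norm (D x *v p x))\<^sup>2) \<le> norm ((4 * M)\<^sup>2 * (norm (p x))\<^sup>2)"
      using bound by (intro AE_I2) simp
  qed
  then show L2: "L2 \<Omega> (\<lambda>x. D x *v p x)" using meas by (simp add: L2_def)
  show "L2_norm \<Omega> (\<lambda>x. D x *v p x) \<le> 4 * M * L2_norm \<Omega> p" if "M \<ge> 0"
  proof (rule power2_le_imp_le)
    have "L2_inner \<Omega> (\<lambda>x. D x *v p x) (\<lambda>x. D x *v p x) \<le> (\<integral>x. (4 * M)\<^sup>2 * (norm (p x))\<^sup>2 \<partial>lebesgue_on \<Omega>)"
      unfolding L2_inner_def
      by (rule integral_mono[OF L2_inner_integrable[OF L2 L2] int])
        (use bound in \<open>simp add: power2_norm_eq_inner\<close>)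
    then show "(L2_norm \<Omega> (\<lambda>x. D x *v p x))\<^sup>2 \<le> (4 * M * L2_norm \<Omega> p)\<^sup>2"
      unfolding power_mult_distrib L2_norm_power2
      by (simp add: L2_inner_def power2_norm_eq_inner power_mult_distrib)
  qed (use that in simp)
qed

lemma bilinear_on_coeff:
  assumes D: "bounded_coeff \<Omega> M D" and \<Omega>: "\<Omega> \<in> sets lebesgue"
  shows "bilinear_on {p. L2 \<Omega> p} {w. L2 \<Omega> w} (\<lambda>p w. \<integral>x. (D x *v p x) \<bullet> w x \<partial>lebesgue_on \<Omega>)"
proof (rule bilinear_onI)
  fix w :: "pt \<Rightarrow> pt" assume w: "w \<in> {w. L2 \<Omega> w}"
  have "linear_functional_on {p. L2 \<Omega> p} (\<lambda>p. (D x *v p x) \<bullet> w x)" for x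
    by (simp add: linear_functional_on_def matrix_vector_right_distrib matrix_vector_mult_scaleR inner_add_left)
  then show "linear_functional_on {p. L2 \<Omega> p} (\<lambda>p. \<integral>x. (D x *v p x) \<bullet> w x \<partial>lebesgue_on \<Omega>)"
    using w by (intro linear_functional_on_integral[OF fun_subspace_L2] AE_I2 L2_inner_integrable
        L2_coeff(1)[OF D _ \<Omega>]) auto
next
  fix p :: "pt \<Rightarrow> pt" assume "p \<in> {p. L2 \<Omega> p}"
  then have "L2 \<Omega> (\<lambda>x. D x *v p x)" using L2_coeff(1)[OF D _ \<Omega>] by simp
  then show "linear_functional_on {w. L2 \<Omega> w} (\<lambda>w. \<integral>x. (D x *v p x) \<bullet> w x \<partial>lebesgue_on \<Omega>)"
    using bilinear_onD(2)[OF bilinear_on_L2_inner, of "\<lambda>x. D x *v p x" \<Omega>]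
    by (simp add: L2_inner_def[abs_def])
qed

lemma coeff_bound:
  assumes D: "bounded_coeff \<Omega> M D" and \<Omega>: "\<Omega> \<in> sets lebesgue" and "M \<ge> 0" and pw: "L2 \<Omega> p" "L2 \<Omega> w"
  shows "\<bar>\<integral>x. (D x *v p x) \<bullet> w x \<partial>lebesgue_on \<Omega>\<bar> \<le> 4 * M * L2_norm \<Omega> p * L2_norm \<Omega> w"
proof -
  have "\<bar>L2_inner \<Omega> (\<lambda>x. D x *v p x) w\<bar> \<le> L2_norm \<Omega> (\<lambda>x. D x *v p x) * L2_norm \<Omega> w"
    by (rule L2_Cauchy_Schwarz[OF L2_coeff(1)[OF D pw(1) \<Omega>] pw(2)])
  also have "\<dots> \<le> 4 * M * L2_norm \<Omega> p * L2_norm \<Omega> w"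
    using L2_coeff(2)[OF D pw(1) \<Omega> \<open>M \<ge> 0\<close>] by (intro mult_right_mono) auto
  finally show ?thesis by (simp add: L2_inner_def)
qed

lemma smooth_on_differentiable: "smooth_on S g \<Longrightarrow> x \<in> S \<Longrightarrow> g differentiable (at x within S)"
  by (erule smooth_on.cases) auto

lemma smooth_on_continuous: "smooth_on S g \<Longrightarrow> continuous_on S g"
  by (meson continuous_on_eq_continuous_within differentiable_imp_continuous_within smooth_on_differentiable)

lemma elliptic_bounded_coeff:
  assumes "elliptic_coeff \<Omega> \<alpha>\<^sub>0 M A" "\<Omega> \<in> sets lebesgue" shows "bounded_coeff \<Omega> M A"
  using assms smooth_on_continuous continuous_imp_measurable_on_sets_lebesgue
  unfolding bounded_coeff_def elliptic_coeff_def smooth_bounded_on_def by blast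

lemma form_A2_commute:
  assumes "elliptic_coeff \<Omega> \<alpha>\<^sub>0 M A" shows "form_A2 \<Omega> A p w = form_A2 \<Omega> A w p"
  unfolding form_A2_def
  by (rule Bochner_Integration.integral_cong)
    (use assms pos_def_matrix_inner_commute in \<open>auto simp: elliptic_coeff_def\<close>)

lemma L2_norm_matrix_sqrt:
  assumes "elliptic_coeff \<Omega> \<alpha>\<^sub>0 M A"
  shows "(L2_norm \<Omega> (\<lambda>x. matrix_sqrt (A x) *v p x))\<^sup>2 = form_A2 \<Omega> A p p"
  unfolding L2_norm_power2 L2_inner_def form_A2_def
  by (rule Bochner_Integration.integral_cong)
    (use assms norm_matrix_sqrt in \<open>auto simp: elliptic_coeff_def\<close>)

lemma form_A2_coercive:
  assumes A: "elliptic_coeff \<Omega> \<alpha>\<^sub>0 M A" and \<Omega>: "\<Omega> \<in> sets lebesgue" and p: "L2 \<Omega> p"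
  shows "\<alpha>\<^sub>0 * (L2_norm \<Omega> p)\<^sup>2 \<le> form_A2 \<Omega> A p p"
proof -
  have "\<alpha>\<^sub>0 * (L2_norm \<Omega> p)\<^sup>2 = (\<integral>x. \<alpha>\<^sub>0 * (p x \<bullet> p x) \<partial>lebesgue_on \<Omega>)"
    by (simp add: L2_norm_power2 L2_inner_def)
  also have "\<dots> \<le> form_A2 \<Omega> A p p"
    unfolding form_A2_def
  proof (rule integral_mono)
    show "integrable (lebesgue_on \<Omega>) (\<lambda>x. \<alpha>\<^sub>0 * (p x \<bullet> p x))"
      using L2_inner_integrable[OF p p] by simp
    show "integrable (lebesgue_on \<Omega>) (\<lambda>x. (A x *v p x) \<bullet> p x)"
      by (rule L2_inner_integrable[OF L2_coeff(1)[OF elliptic_bounded_coeff[OF A \<Omega>] p \<Omega>] p])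
    fix x assume "x \<in> space (lebesgue_on \<Omega>)"
    then have "p x \<noteq> 0 \<Longrightarrow> \<alpha>\<^sub>0 * (norm (p x))\<^sup>2 \<le> (A x *v p x) \<bullet> p x"
      using A by (auto simp: elliptic_coeff_def)
    then show "\<alpha>\<^sub>0 * (p x \<bullet> p x) \<le> (A x *v p x) \<bullet> p x"
      by (cases "p x = 0") (auto simp: power2_norm_eq_inner)
  qed
  finally show ?thesis .
qed

section \<open>The memory kernel\<close>

lemma memory_bounded_coeff:
  assumes B: "memory_coeff \<Omega> T M B" and \<Omega>: "\<Omega> \<in> sets lebesgue" and st: "0 \<le> s" "s \<le> t" "t \<le> T"
  shows "bounded_coeff \<Omega> M (\<lambda>x. B x t s)"
  unfolding bounded_coeff_def
proof (intro allI conjI ballI)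
  fix i j
  let ?S = "{(x,t,s). x \<in> \<Omega> \<and> 0 \<le> s \<and> s \<le> t \<and> t \<le> T}"
  let ?g = "\<lambda>(x,t,s). B x t s $ i $ j"
  have g: "smooth_bounded_on ?S M ?g" using B by (auto simp: memory_coeff_def)
  then have "continuous_on ?S ?g" by (auto simp: smooth_bounded_on_def intro: smooth_on_continuous)
  then have "continuous_on \<Omega> (\<lambda>x. ?g (x, t, s))"
    by (rule continuous_on_compose2) (use st in \<open>auto intro!: continuous_intros\<close>)
  then show "(\<lambda>x. B x t s $ i $ j) \<in> borel_measurable (lebesgue_on \<Omega>)"
    by (intro continuous_imp_measurable_on_sets_lebesgue[OF _ \<Omega>]) simp
  fix x assume "x \<in> \<Omega>"
  then have "(x, t, s) \<in> ?S" using st by simp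
  then have "\<bar>?g (x, t, s)\<bar> \<le> M" using g unfolding smooth_bounded_on_def by blast
  then show "\<bar>B x t s $ i $ j\<bar> \<le> M" by simp
qed

text \<open>The mean value theorem in the first time argument. For fixed \<open>s\<close> the segment \<open>[s, T]\<close> stays in the
domain of the kernel, so the derivative within that domain restricts to it and its value in the
direction of \<open>t\<close> is one of the bounded partial derivatives.\<close>

lemma memory_Lipschitz:
  assumes B: "memory_coeff \<Omega> T M B" and x: "x \<in> \<Omega>" and st: "0 \<le> s" "s \<le> t" "t \<le> t'" "t' \<le> T"
  shows "\<bar>B x t' s $ i $ j - B x t s $ i $ j\<bar> \<le> M * (t' - t)"
proof -
  let ?S = "{(x,t,s). x \<in> \<Omega> \<and> 0 \<le> s \<and> s \<le> t \<and> t \<le> T}"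
  let ?g = "\<lambda>(x,t,s). B x t s $ i $ j"
  have g: "smooth_bounded_on ?S M ?g" using B by (auto simp: memory_coeff_def)
  define D where "D r = frechet_derivative ?g (at (x, r, s) within ?S)" for r
  have "norm (B x t' s $ i $ j - B x t s $ i $ j) \<le> M * norm (t' - t)"
  proof (rule field_differentiable_bound[where S = "{s..T}" and f' = "\<lambda>r. D r (0, 1, 0)"])
    fix r assume r: "r \<in> {s..T}"
    then have mem: "(x, r, s) \<in> ?S" using x st by simp
    have "?g differentiable (at (x, r, s) within ?S)"
      using g mem unfolding smooth_bounded_on_def by (blast intro: smooth_on_differentiable)
    then have der: "(?g has_derivative D r) (at (x, r, s) within ?S)"
      unfolding D_def using frechet_derivative_works by blast
    have lin: "linear (D r)" using der has_derivative_linear by blast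
    have "((\<lambda>r. (x, r, s)) has_derivative (\<lambda>h. (0, h, 0))) (at r within {s..T})"
      by (auto intro!: derivative_eq_intros)
    moreover have "(?g has_derivative D r) (at (x, r, s) within (\<lambda>r. (x, r, s)) ` {s..T})"
      by (rule has_derivative_subset[OF der]) (use x st in auto)
    ultimately have "((\<lambda>r. ?g (x, r, s)) has_derivative (\<lambda>h. D r (0, h, 0))) (at r within {s..T})"
      by (rule has_derivative_in_compose)
    moreover have "D r (0, h, 0) = D r (0, 1, 0) * h" for h
      using linear_scale[OF lin, of h "(0, 1, 0)"] by (simp add: mult.commute)
    then have "(\<lambda>h. D r (0, h, 0)) = (*) (D r (0, 1, 0))" by (rule ext)
    ultimately show "((\<lambda>r. B x r s $ i $ j) has_field_derivative D r (0, 1, 0)) (at r within {s..T})"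
      by (simp only: has_field_derivative_def prod.case)
    have "(0, 1, 0) \<in> (Basis :: (pt \<times> real \<times> real) set)" by (simp add: Basis_prod_def image_iff)
    then have "\<bar>frechet_derivative ?g (at (x, r, s) within ?S) (0, 1, 0)\<bar> \<le> M"
      using g mem unfolding smooth_bounded_on_def by blast
    then show "norm (D r (0, 1, 0)) \<le> M" by (simp add: D_def)
  qed (use st in auto)
  then show ?thesis using st by simp
qed

lemma memory_diff_bounded_coeff:
  assumes B: "memory_coeff \<Omega> T M B" and \<Omega>: "\<Omega> \<in> sets lebesgue"
    and st: "0 \<le> s" "s \<le> t" "t \<le> t'" "t' \<le> T"
  shows "bounded_coeff \<Omega> (M * (t' - t)) (\<lambda>x. B x t' s - B x t s)"
  using memory_bounded_coeff[OF B \<Omega>, of s t] memory_bounded_coeff[OF B \<Omega>, of s t']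
    memory_Lipschitz[OF B _ st] st
  unfolding bounded_coeff_def by (simp add: borel_measurable_diff)

lemma linear_functional_on_quadrature:
  assumes B: "memory_coeff \<Omega> T M B" and \<Omega>: "\<Omega> \<in> sets lebesgue" and k: "0 < k" "real n * k \<le> T"
    and q: "\<And>j. j < n \<Longrightarrow> L2 \<Omega> (half Q j)"
  shows "linear_functional_on {w. L2 \<Omega> w} (quadrature \<Omega> B k Q n)"
  unfolding quadrature_def form_B_def
proof (intro linear_functional_on_cmult linear_functional_on_sum)
  fix j assume "j \<in> {..<n}"
  then have j: "j < n" and "real j + 1 / 2 \<le> real n" by auto
  then have "(real j + 1 / 2) * k \<le> real n * k" using k(1) by (intro mult_right_mono) auto
  then have "bounded_coeff \<Omega> M (\<lambda>x. B x (real n * k) ((real j + 1 / 2) * k))"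
    using k by (intro memory_bounded_coeff[OF B \<Omega>]) auto
  from bilinear_onD(2)[OF bilinear_on_coeff[OF this \<Omega>], of "half Q j"] q[OF j]
  show "linear_functional_on {w. L2 \<Omega> w}
     (\<lambda>w. \<integral>x. (B x (real n * k) ((real j + 1 / 2) * k) *v half Q j x) \<bullet> w x \<partial>lebesgue_on \<Omega>)" by simp
qed

text \<open>From one time level to the next the memory sum receives one new term of weight \<open>k\<close>, and each of
its old terms moves by at most \<open>k\<close> times the Lipschitz constant. So the memory term has a difference
quotient bounded by the fluxes, without any difference of fluxes.\<close>

lemma quadrature_step:
  assumes B: "memory_coeff \<Omega> T M B" and "M \<ge> 0" and \<Omega>: "\<Omega> \<in> sets lebesgue"
    and k: "0 < k" "real (n + 1) * k \<le> T"
    and q: "\<And>j. j \<le> n \<Longrightarrow> L2 \<Omega> (half Q j)" and w: "L2 \<Omega> w"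
  shows "\<bar>quadrature \<Omega> B k Q (n + 1) w - quadrature \<Omega> B k Q n w\<bar>
    \<le> k * (4 * M * (L2_norm \<Omega> (half Q n) + k * (\<Sum>j<n. L2_norm \<Omega> (half Q j)))) * L2_norm \<Omega> w"
proof -
  let ?b = "\<lambda>n j. form_B \<Omega> B (real n * k) ((real j + 1/2) * k) (half Q j) w"
  have nk: "real n * k \<le> T" using k by (simp add: algebra_simps)
  have s: "0 \<le> (real j + 1 / 2) * k" for j using k by simp
  have last: "\<bar>?b (n + 1) n\<bar> \<le> 4 * M * L2_norm \<Omega> (half Q n) * L2_norm \<Omega> w"
    unfolding form_B_def
    by (intro coeff_bound[OF memory_bounded_coeff[OF B \<Omega>] \<Omega> \<open>M \<ge> 0\<close> q w] s) (use k in auto)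
  \<comment> \<open>the old terms change through the first time argument of \<open>B\<close>
    only, and by the Lipschitz bound each change has the size of \<open>k\<close>\<close>
  have old: "\<bar>?b (n + 1) j - ?b n j\<bar> \<le> 4 * (M * k) * L2_norm \<Omega> (half Q j) * L2_norm \<Omega> w"
    if j: "j < n" for j
  proof -
    let ?s = "(real j + 1 / 2) * k"
    have "real j + 1 / 2 \<le> real n" using j by linarith
    then have le: "?s \<le> real n * k" "real n * k \<le> real (n + 1) * k"
      using k(1) by (auto intro: mult_right_mono)
    have qj: "L2 \<Omega> (half Q j)" using q j by simp
    have c1: "bounded_coeff \<Omega> M (\<lambda>x. B x (real (n + 1) * k) ?s)"
      by (rule memory_bounded_coeff[OF B \<Omega> s _ k(2)]) (use le in linarith)
    have c0: "bounded_coeff \<Omega> M (\<lambda>x. B x (real n * k) ?s)"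
      by (rule memory_bounded_coeff[OF B \<Omega> s le(1) nk])
    have "?b (n + 1) j - ?b n j
        = (\<integral>x. ((B x (real (n + 1) * k) ?s - B x (real n * k) ?s) *v half Q j x) \<bullet> w x \<partial>lebesgue_on \<Omega>)"
      unfolding form_B_def
      by (subst Bochner_Integration.integral_diff[symmetric])
        (rule L2_inner_integrable[OF L2_coeff(1)[OF c1 qj \<Omega>] w]
          L2_inner_integrable[OF L2_coeff(1)[OF c0 qj \<Omega>] w]
          | simp add: matrix_vector_mult_diff_rdistrib inner_diff_left)+
    also have "\<bar>\<dots>\<bar> \<le> 4 * (M * (real (n + 1) * k - real n * k)) * L2_norm \<Omega> (half Q j) * L2_norm \<Omega> w"
      by (rule coeff_bound[OF memory_diff_bounded_coeff[OF B \<Omega> s le k(2)] \<Omega> _ qj w])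
        (use le \<open>M \<ge> 0\<close> in simp)
    also have "real (n + 1) * k - real n * k = k" by (simp add: algebra_simps)
    finally show ?thesis .
  qed
  have diff: "quadrature \<Omega> B k Q (n + 1) w - quadrature \<Omega> B k Q n w
      = k * (?b (n + 1) n + (\<Sum>j<n. ?b (n + 1) j - ?b n j))"
    by (simp add: quadrature_def sum_subtractf algebra_simps)
  have "\<bar>quadrature \<Omega> B k Q (n + 1) w - quadrature \<Omega> B k Q n w\<bar>
      = k * \<bar>?b (n + 1) n + (\<Sum>j<n. ?b (n + 1) j - ?b n j)\<bar>"
    unfolding diff using k(1) by (simp add: abs_mult)
  also have "\<dots> \<le> k * (4 * M * L2_norm \<Omega> (half Q n) * L2_norm \<Omega> w
      + (\<Sum>j<n. 4 * (M * k) * L2_norm \<Omega> (half Q j) * L2_norm \<Omega> w))"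
  proof (intro mult_left_mono)
    have "\<bar>\<Sum>j<n. ?b (n + 1) j - ?b n j\<bar> \<le> (\<Sum>j<n. 4 * (M * k) * L2_norm \<Omega> (half Q j) * L2_norm \<Omega> w)"
      by (rule order_trans[OF sum_abs sum_mono]) (use old in auto)
    then show "\<bar>?b (n + 1) n + (\<Sum>j<n. ?b (n + 1) j - ?b n j)\<bar> \<le> 4 * M * L2_norm \<Omega> (half Q n) * L2_norm \<Omega> w
      + (\<Sum>j<n. 4 * (M * k) * L2_norm \<Omega> (half Q j) * L2_norm \<Omega> w)"
      using last by linarith
  qed (use k in simp)
  also have "\<dots> = k * (4 * M * (L2_norm \<Omega> (half Q n) + k * (\<Sum>j<n. L2_norm \<Omega> (half Q j)))) * L2_norm \<Omega> w"
    by (simp add: sum_distrib_left sum_distrib_right algebra_simps)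
  finally show ?thesis .
qed

section \<open>Discrete Gronwall inequality and summation by parts\<close>

lemma discrete_Gronwall:
  fixes y :: "nat \<Rightarrow> real"
  assumes "c \<ge> 0" "2 * c \<le> 1" "\<And>n. y n \<ge> 0"
    and y: "\<And>n. n \<le> m \<Longrightarrow> y n \<le> a + c * (\<Sum>j\<le>n. y j)"
  shows "y m \<le> 2 * a * (1 + 2 * c) ^ m"
proof -
  have explicit: "y n \<le> 2 * a + 2 * c * (\<Sum>j<n. y j)" if "n \<le> m" for n
  proof -
    have "{..n} = insert n {..<n}" by auto
    \<comment> \<open>absorb the implicit term \<open>c y\<^sub>n\<close>; this is where
      \<open>c \<le> 1/2\<close> enters\<close>
    then have "(1 - c) * y n \<le> a + c * (\<Sum>j<n. y j)" using y[OF that] by (simp add: algebra_simps)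
    moreover have "1 / 2 * y n \<le> (1 - c) * y n" using assms by (intro mult_right_mono) auto
    ultimately show ?thesis by linarith
  qed
  have "2 * a + 2 * c * (\<Sum>j<n. y j) \<le> 2 * a * (1 + 2 * c) ^ n" if "n \<le> m" for n
    using that
  proof (induction n)
    case (Suc n)
    have "2 * a + 2 * c * (\<Sum>j<Suc n. y j) = 2 * a + 2 * c * (\<Sum>j<n. y j) + 2 * c * y n"
      by (simp add: algebra_simps)
    also have "2 * c * y n \<le> 2 * c * (2 * a + 2 * c * (\<Sum>j<n. y j))"
      using explicit[of n] Suc.prems assms(1) by (intro mult_left_mono) auto
    also have "2 * a + 2 * c * (\<Sum>j<n. y j) + 2 * c * (2 * a + 2 * c * (\<Sum>j<n. y j))
        = (1 + 2 * c) * (2 * a + 2 * c * (\<Sum>j<n. y j))"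
      by (simp add: algebra_simps)
    also have "\<dots> \<le> (1 + 2 * c) * (2 * a * (1 + 2 * c) ^ n)"
      using Suc assms(1) by (intro mult_left_mono) auto
    finally show ?case by (simp add: algebra_simps)
  qed simp
  from this[of m] explicit[of m] show ?thesis by simp
qed

text \<open>The hypothesis bounds a square by a product with an upper bound \<open>P\<close> of the earlier values. With \<open>P\<close> the
maximum and \<open>n\<close> the place where it is attained, one factor cancels and the linear Gronwall lemma
applies.\<close>

lemma quadratic_Gronwall:
  fixes y R :: "nat \<Rightarrow> real"
  assumes c: "c \<ge> 0" "2 * c \<le> 1" and y0: "\<And>n. y n \<ge> 0"
    and R: "R m \<ge> 0" "\<And>n. n \<le> m \<Longrightarrow> R n \<le> R m"
    and y: "\<And>n P. n \<le> m \<Longrightarrow> (\<And>j. j \<le> n \<Longrightarrow> y j \<le> P) \<Longrightarrow>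
      (y n)\<^sup>2 \<le> (y 0)\<^sup>2 + P * (R n + c * (\<Sum>j\<le>n. y j))"
  shows "y m \<le> 2 * (y 0 + R m) * (1 + 2 * c) ^ m"
proof (rule discrete_Gronwall[OF c y0])
  fix n assume n: "n \<le> m"
  have "Max (y ` {..n}) \<in> y ` {..n}" by (intro Max_in) auto
  \<comment> \<open>evaluate the hypothesis at an index \<open>i\<close> where \<open>y\<close>
    is largest and divide by \<open>y i\<close>\<close>
  then obtain i where i: "i \<le> n" "y i = Max (y ` {..n})" by force
  have max: "y j \<le> y i" if "j \<le> n" for j using that i(2) by simp
  have "y i \<le> y 0 + R m + c * (\<Sum>j\<le>n. y j)"
  proof (cases "y i = 0")
    case True
    then have 0: "y j = 0" if "j \<le> n" for j using max[OF that] y0[of j] by simp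
    show ?thesis using 0 True R(1) by simp
  next
    case False
    then have pos: "y i > 0" using y0[of i] by simp
    have "(y i)\<^sup>2 \<le> (y 0)\<^sup>2 + y i * (R i + c * (\<Sum>j\<le>i. y j))"
      using y[of i "y i"] max i(1) n by simp
    also have "(y 0)\<^sup>2 \<le> y i * y 0" using max[of 0] y0 by (simp add: power2_eq_square mult_right_mono)
    also have "y i * y 0 + y i * (R i + c * (\<Sum>j\<le>i. y j)) = y i * (y 0 + R i + c * (\<Sum>j\<le>i. y j))"
      by (simp add: algebra_simps)
    finally have "y i \<le> y 0 + R i + c * (\<Sum>j\<le>i. y j)"
      using pos by (simp add: power2_eq_square)
    also have "\<dots> \<le> y 0 + R m + c * (\<Sum>j\<le>n. y j)"
      using R(2)[of i] i(1) n c(1) y0 by (intro add_mono mult_left_mono sum_mono2) auto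
    finally show ?thesis .
  qed
  then show "y n \<le> y 0 + R m + c * (\<Sum>j\<le>n. y j)" using max[of n] by simp
qed

lemma sum_by_parts:
  fixes h :: "nat \<Rightarrow> nat \<Rightarrow> real"
  shows "(\<Sum>n=1..m. h n n - h n (n - 1)) = h m m - h 0 0 - (\<Sum>n<m. h (n + 1) n - h n n)"
  by (induction m) auto

lemma abs_average_le: "\<bar>a\<bar> \<le> x \<Longrightarrow> \<bar>b\<bar> \<le> x \<Longrightarrow> \<bar>(a + b) / 2\<bar> \<le> (x :: real)"
  by (simp add: abs_le_iff)

lemma abs_weighted_average_le:
  fixes a b c x y w :: real
  assumes "\<bar>a\<bar> \<le> x" "\<bar>b\<bar> \<le> y" "\<bar>c\<bar> \<le> w"
  shows "\<bar>(a + 2 * b + c) / 4\<bar> \<le> (x + 2 * y + w) / 4"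
  using assms by (simp add: abs_le_iff)

text \<open>Summation by parts moves the difference in the second index of \<open>h\<close> to the first index, where the
hypothesis provides smallness. The last term, the first term and the differences contribute at most
\<open>1\<close>, \<open>1/4\<close> and \<open>5/4\<close> times the sum of \<open>\<eta>\<close>, together less than \<open>3\<close>.\<close>

lemma averaged_sum_by_parts_bound:
  fixes H h :: "nat \<Rightarrow> nat \<Rightarrow> real"
  assumes H0: "\<And>i. i \<le> m \<Longrightarrow> H 0 i = 0"
    and step: "\<And>n i. n \<le> m \<Longrightarrow> i \<le> m \<Longrightarrow> \<bar>H (n + 1) i - H n i\<bar> \<le> \<eta> n"
    and h: "\<And>n i. h n i = (H (n + 1) i + 2 * H n i + H (n - 1) i) / 4"
  shows "\<bar>\<Sum>n=1..m. h n n - h n (n - 1)\<bar> \<le> 3 * (\<Sum>n\<le>m. \<eta> n)"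
proof -
  define E where "E = (\<Sum>n\<le>m. \<eta> n)"
  have \<eta>: "\<eta> n \<ge> 0" if "n \<le> m" for n using step[of n 0] that by (meson abs_ge_zero le0 order_trans)
  have part: "(\<Sum>n\<in>S. \<eta> n) \<le> E" if "S \<subseteq> {..m}" for S
    unfolding E_def using that \<eta> by (intro sum_mono2) auto
  have H: "\<bar>H n i\<bar> \<le> E" if "n \<le> m + 1" "i \<le> m" for n i
  proof -
    have "\<bar>H n i\<bar> \<le> (\<Sum>j<n. \<eta> j)" using that(1)
    proof (induction n)
      case (Suc n)
      then show ?case using step[of n i] that(2) by auto
    qed (simp add: H0 that(2))
    also have "\<dots> \<le> E" using that(1) by (intro part) auto
    finally show ?thesis .
  qed
  have last: "\<bar>h m m\<bar> \<le> E" 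
  proof -
    have "m - 1 \<le> m + 1" by simp
    then show ?thesis using H[of "m + 1" m] H[of m m] H[of "m - 1" m] by (simp add: h abs_le_iff)
  qed
  \<comment> \<open>here \<open>n - 1\<close> is \<open>0\<close> again, so \<open>h 0
    0\<close> reduces to \<open>H 1 0 / 4\<close>\<close>
  have first: "\<bar>h 0 0\<bar> \<le> E / 4"
    using H[of 1 0] H0[of 0] by (simp add: h)
  have diff: "\<bar>h (n + 1) n - h n n\<bar> \<le> (\<eta> (n + 1) + 2 * \<eta> n + \<eta> (n - 1)) / 4" if n: "n < m" for n
  proof (cases n)
    case 0
    have "h (n + 1) n - h n n = ((H (1 + 1) 0 - H 1 0) + 2 * (H (0 + 1) 0 - H 0 0) + 0) / 4"
      by (simp add: h 0 field_simps)
    then show ?thesis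
      using abs_weighted_average_le[OF step[of 1 0] step[of 0 0], of 0 "\<eta> 0"] \<eta>[of 0] n
      by (simp only: 0) simp
  next
    case (Suc l)
    have "h (n + 1) n - h n n
        = ((H (n + 1 + 1) n - H (n + 1) n) + 2 * (H (n + 1) n - H n n) + (H (l + 1) n - H l n)) / 4"
      by (simp add: h Suc field_simps)
    then show ?thesis
      using abs_weighted_average_le[OF step[of "n + 1" n] step[of n n] step[of l n]] n
      by (simp only:) (simp add: Suc)
  qed
  have "(\<Sum>n<m. \<eta> (n + 1)) = (\<Sum>n\<in>Suc ` {..<m}. \<eta> n)" by (subst sum.reindex) auto
  also have "\<dots> \<le> E" by (rule part) auto
  finally have s1: "(\<Sum>n<m. \<eta> (n + 1)) \<le> E" .
  have s2: "(\<Sum>n<m. \<eta> n) \<le> E" by (rule part) auto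
  have s3: "(\<Sum>n<m. \<eta> (n - 1)) \<le> 2 * E"
  proof (cases m)
    case 0
    then show ?thesis using part[of "{}"] by simp
  next
    case (Suc l)
    have "(\<Sum>n<m. \<eta> (n - 1)) = (\<Sum>n\<in>{0}. \<eta> n) + (\<Sum>n<l. \<eta> n)"
      unfolding Suc by (subst sum.lessThan_Suc_shift) simp
    moreover have "(\<Sum>n\<in>{0}. \<eta> n) \<le> E" "(\<Sum>n<l. \<eta> n) \<le> E" by (rule part; auto simp: Suc)+
    ultimately show ?thesis by linarith
  qed
  have "\<bar>\<Sum>n<m. h (n + 1) n - h n n\<bar> \<le> (\<Sum>n<m. (\<eta> (n + 1) + 2 * \<eta> n + \<eta> (n - 1)) / 4)"
    by (rule order_trans[OF sum_abs sum_mono]) (use diff in auto)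
  also have "\<dots> = ((\<Sum>n<m. \<eta> (n + 1)) + 2 * (\<Sum>n<m. \<eta> n) + (\<Sum>n<m. \<eta> (n - 1))) / 4"
    by (simp add: sum_divide_distrib[symmetric] sum.distrib sum_distrib_left)
  also have "\<dots> \<le> 5 / 4 * E" using s1 s2 s3 by simp
  finally show ?thesis unfolding sum_by_parts E_def[symmetric] using last first by linarith
qed

text \<open>The three shifted copies of the sum overlap with total weight 1.\<close>

lemma averaged_sum_le:
  fixes g :: "nat \<Rightarrow> real"
  assumes "\<And>n. g n \<ge> 0"
  shows "(\<Sum>n=1..l. (g (n + 1) + 2 * g n + g (n - 1)) / 4) \<le> (\<Sum>n=0..l+1. g n)"
proof -
  have part: "(\<Sum>n\<in>S. g n) \<le> (\<Sum>n=0..l+1. g n)" if "S \<subseteq> {0..l+1}" for S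
    using that assms by (intro sum_mono2) auto
  have "(\<Sum>n=1..l. g (n + 1)) = (\<Sum>n\<in>Suc ` {1..l}. g n)" by (subst sum.reindex) auto
  also have "\<dots> \<le> (\<Sum>n=0..l+1. g n)" by (rule part) auto
  finally have 1: "(\<Sum>n=1..l. g (n + 1)) \<le> (\<Sum>n=0..l+1. g n)" .
  have "(\<Sum>n=1..l. g (n - 1)) = (\<Sum>n\<in>(\<lambda>n. n - 1) ` {1..l}. g n)"
    by (subst sum.reindex) (auto simp: inj_on_def)
  also have "\<dots> \<le> (\<Sum>n=0..l+1. g n)" by (rule part) auto
  finally have 2: "(\<Sum>n=1..l. g (n - 1)) \<le> (\<Sum>n=0..l+1. g n)" .
  have 3: "(\<Sum>n=1..l. g n) \<le> (\<Sum>n=0..l+1. g n)" by (rule part) auto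
  have "(\<Sum>n=1..l. (g (n + 1) + 2 * g n + g (n - 1)) / 4)
      = ((\<Sum>n=1..l. g (n + 1)) + 2 * (\<Sum>n=1..l. g n) + (\<Sum>n=1..l. g (n - 1))) / 4"
    by (simp add: sum_divide_distrib[symmetric] sum.distrib sum_distrib_left)
  moreover have "(a + 2 * b + c) / 4 \<le> G" if "a \<le> G" "b \<le> G" "c \<le> G" for a b c G :: real
    using that by simp
  ultimately show ?thesis using 1 2 3 by simp
qed

section \<open>The energy argument\<close>

text \<open>One solution on one mesh with one time step. Uniformity of the constants is visible in the final
estimate, whose constants mention no parameter of the mesh and not the time step.\<close>

locale MFD_scheme =
  fixes \<Omega> :: "pt set" and T \<alpha>\<^sub>0 M \<zeta> \<kappa> \<alpha> \<beta> c\<^sub>0 c\<^sub>1 k :: real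
    and A :: "pt \<Rightarrow> mat2" and B :: "pt \<Rightarrow> real \<Rightarrow> real \<Rightarrow> mat2"
    and \<T> :: "element set" and deg :: "element \<Rightarrow> nat" and C12 :: "pt \<Rightarrow> pt" and N :: nat
    and f :: "pt \<Rightarrow> real \<Rightarrow> real" and F :: "nat \<Rightarrow> (pt \<Rightarrow> real) \<Rightarrow> real"
    and G :: "nat \<Rightarrow> (pt \<Rightarrow> pt) \<Rightarrow> real"
    and U :: "nat \<Rightarrow> pt \<Rightarrow> real" and Q Z :: "nat \<Rightarrow> pt \<Rightarrow> pt"
  assumes open_\<Omega>: "open \<Omega>" and convex_\<Omega>: "convex \<Omega>" and lmeas: "\<Omega> \<in> lmeasurable"
    and \<alpha>\<^sub>0: "\<alpha>\<^sub>0 > 0" and M: "M \<ge> 0" and \<zeta>: "\<zeta> \<ge> 0" and \<kappa>: "\<kappa> \<ge> 0"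
    and A: "elliptic_coeff \<Omega> \<alpha>\<^sub>0 M A" and B: "memory_coeff \<Omega> T M B"
    and mesh: "subdivision \<Omega> \<T>" and C12: "admissible_C12 c\<^sub>0 c\<^sub>1 \<T> C12"
    and k: "k > 0" and Nk: "real N * k \<le> T"
    and f: "\<And>n. n \<le> N \<Longrightarrow> L2 \<Omega> (at_steps k f n)"
    and F: "\<And>n. 1 \<le> n \<Longrightarrow> n < N \<Longrightarrow> linear_functional_on (V_space \<T> deg) (F n)"
    and G: "\<And>n. n \<le> N \<Longrightarrow> linear_functional_on (W_space \<T> deg) (G n)"
    and G0: "\<And>\<tau>. \<tau> \<in> W_space \<T> deg \<Longrightarrow> G 0 \<tau> = 0"
    and sol: "MFD_solution \<Omega> A B \<T> deg \<zeta> \<alpha> \<kappa> \<beta> C12 k N f F G U Q Z"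
begin

abbreviation "Vh \<equiv> V_space \<T> deg"
abbreviation "Wh \<equiv> W_space \<T> deg"
abbreviation "A1 \<equiv> form_A1 \<Omega> \<T> C12"
abbreviation "A2 \<equiv> form_A2 \<Omega> A"
abbreviation "J \<equiv> form_J \<zeta> \<alpha> \<Omega> \<T> deg"
abbreviation "J1 \<equiv> form_J1 \<kappa> \<beta> \<T> deg"
abbreviation "u \<equiv> half U"
abbreviation "q \<equiv> half Q"
abbreviation "z \<equiv> half Z"
abbreviation "d \<equiv> dt k U"
abbreviation "energy \<equiv> energy_norm \<Omega> A \<T> deg \<zeta> \<alpha> \<kappa> \<beta> k U Q Z"

lemmas subspace_Vh = fun_subspace_V_space[of \<T> deg]
lemmas subspace_Wh = fun_subspace_W_space[of \<T> deg]

lemma \<Omega>_sets: "\<Omega> \<in> sets lebesgue" using lmeas by (rule fmeasurableD)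

lemma Vh_L2: "v \<in> Vh \<Longrightarrow> L2 \<Omega> v" and Wh_L2: "w \<in> Wh \<Longrightarrow> L2 \<Omega> w"
  using L2_V_space[OF mesh lmeas] by blast+

lemma bil_L2: "bilinear_on Vh Vh (L2_inner \<Omega>)"
  using bilinear_on_subset[OF bilinear_on_L2_inner] Vh_L2 by blast

lemma bil_A: "bilinear_on Wh Wh (form_A \<Omega>)"
proof -
  have "form_A \<Omega> = L2_inner \<Omega>" by (intro ext) (simp add: form_A_def L2_inner_def)
  then show ?thesis using bilinear_on_subset[OF bilinear_on_L2_inner] Wh_L2 by auto
qed

lemma bil_A2: "bilinear_on Wh Wh A2"
proof -
  have "A2 = (\<lambda>p w. \<integral>x. (A x *v p x) \<bullet> w x \<partial>lebesgue_on \<Omega>)" by (intro ext) (simp add: form_A2_def)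
  then show ?thesis
    using bilinear_on_subset[OF bilinear_on_coeff[OF elliptic_bounded_coeff[OF A \<Omega>_sets] \<Omega>_sets]] Wh_L2 by auto
qed

lemmas bil_A1 = bilinear_on_form_A1[OF mesh open_\<Omega> convex_\<Omega> C12, of deg]
lemmas bil_J = bilinear_on_form_J[OF mesh open_\<Omega> convex_\<Omega>, of deg \<zeta> \<alpha>]
lemmas bil_J1 = bilinear_on_form_J1[OF mesh open_\<Omega> convex_\<Omega>, of deg \<kappa> \<beta>]

lemma U_mem: "n \<le> N \<Longrightarrow> U n \<in> Vh" and Q_mem: "n \<le> N \<Longrightarrow> Q n \<in> Wh" and Z_mem: "n \<le> N \<Longrightarrow> Z n \<in> Wh"
  using sol by (auto simp: MFD_solution_def)

lemma half_mem_Vh_Wh: assumes "n < N" shows "u n \<in> Vh" "q n \<in> Wh" "z n \<in> Wh" "d n \<in> Vh"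
proof -
  have n: "n + 1 \<le> N" "n \<le> N" using assms by auto
  show "u n \<in> Vh" using half_mem[OF subspace_Vh, OF U_mem[OF n(1)] U_mem[OF n(2)]] .
  show "q n \<in> Wh" using half_mem[OF subspace_Wh, OF Q_mem[OF n(1)] Q_mem[OF n(2)]] .
  show "z n \<in> Wh" using half_mem[OF subspace_Wh, OF Z_mem[OF n(1)] Z_mem[OF n(2)]] .
  show "d n \<in> Vh" unfolding dt_def
    using fun_subspaceD(3)[OF subspace_Vh fun_subspace_diff[OF subspace_Vh U_mem[OF n(1)] U_mem[OF n(2)]]] .
qed

text \<open>Data and memory in the second equation play the same role and are treated as one functional. It
vanishes at \<open>n = 0\<close>, where the memory sum is empty.\<close>

definition load :: "nat \<Rightarrow> (pt \<Rightarrow> pt) \<Rightarrow> real" where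
  "load n \<tau> = G n \<tau> - quadrature \<Omega> B k Q n \<tau>"

text \<open>At \<open>n = 0\<close> truncated subtraction gives \<open>load 0\<close> the weight of the missing predecessor as well; this
value appears only as the initial boundary term of the summation by parts.\<close>

definition mean_load :: "nat \<Rightarrow> (pt \<Rightarrow> pt) \<Rightarrow> real" where
  "mean_load n \<tau> = (load (n + 1) \<tau> + 2 * load n \<tau> + load (n - 1) \<tau>) / 4"

definition energy_sum :: "nat \<Rightarrow> real" where
  "energy_sum n = L2_inner \<Omega> (d n) (d n) + A2 (q n) (q n) + J1 (z n) (z n) + J (u n) (u n)"

text \<open>The test function of the energy method, the mean of the velocities at the two neighbouring half levels.\<close>

definition test_fun :: "nat \<Rightarrow> pt \<Rightarrow> real" where
  "test_fun n = (\<lambda>x. (1/2) *\<^sub>R (d n x + d (n - 1) x))"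

lemma nk: "n \<le> N \<Longrightarrow> real n * k \<le> T"
  by (rule order_trans[OF mult_right_mono Nk]) (use k in auto)

lemma linear_load: "n \<le> N \<Longrightarrow> linear_functional_on Wh (load n)"
proof -
  assume n: "n \<le> N"
  have "linear_functional_on Wh (quadrature \<Omega> B k Q n)"
    by (rule linear_functional_on_subset[OF linear_functional_on_quadrature[OF B \<Omega>_sets k nk[OF n]]])
      (use n half_mem_Vh_Wh Wh_L2 in auto)
  then show ?thesis unfolding load_def[abs_def] by (intro linear_functional_on_diff G[OF n])
qed

lemma linear_mean_load: "n < N \<Longrightarrow> linear_functional_on Wh (mean_load n)"
proof -
  assume "n < N"
  then have "linear_functional_on Wh (\<lambda>\<tau>. (load (n + 1) \<tau> + 2 * load n \<tau> + load (n - 1) \<tau>) * (1 / 4))"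
    by (intro linear_functional_on_multc linear_functional_on_add linear_functional_on_cmult linear_load) auto
  then show ?thesis by (simp add: mean_load_def[abs_def])
qed

text \<open>The discrete energy identity. All four squares in the energy arise as products of a difference and a
sum of values at consecutive half levels.\<close>

lemma energy_step:
  assumes n: "1 \<le> n" "n < N"
  shows "energy_sum n - energy_sum (n - 1) = 2 * k * L2_inner \<Omega> (quarter (at_steps k f) n) (test_fun n) + 2 * k * F n (test_fun n)
    + 2 * (mean_load n (q n) - mean_load n (q (n - 1)))"
proof -
  have n': "n - 1 < N" "n - 1 + 1 = n" using n by auto
  note mem1 = half_mem_Vh_Wh[OF n(2)] and mem0 = half_mem_Vh_Wh[OF n'(1)]
  let ?zz = "\<lambda>x. (1/2) *\<^sub>R (z n x + z (n - 1) x)"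
  let ?dq = "\<lambda>x. q n x - q (n - 1) x"
  have zz: "?zz \<in> Wh" using fun_subspaceD(3)[OF subspace_Wh fun_subspaceD(2)[OF subspace_Wh mem1(3) mem0(3)]] .
  have dq: "?dq \<in> Wh" using fun_subspace_diff[OF subspace_Wh mem1(2) mem0(2)] .
  have v: "test_fun n \<in> Vh" unfolding test_fun_def
    using fun_subspaceD(3)[OF subspace_Vh fun_subspaceD(2)[OF subspace_Vh mem1(4) mem0(4)]] .
  \<comment> \<open>the same function written with \<open>d\<close> turns the inertia term into
    a difference of squares and written with \<open>u\<close> does so for the stabilization
    term\<close>
  have v_eq: "test_fun n = (\<lambda>x. (1/k) *\<^sub>R (u n x - u (n - 1) x))"
    using k n'(2) by (auto simp: test_fun_def dt_def half_def algebra_simps)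
  have dtt_eq: "dtt k U n = (\<lambda>x. (1/k) *\<^sub>R (d n x - d (n - 1) x))"
    using k n'(2) by (auto simp: dtt_def dt_def power2_eq_square field_simps)
  have qU: "quarter U n = (\<lambda>x. (1/2) *\<^sub>R (u n x + u (n - 1) x))"
    using n'(2) by (auto simp: quarter_def half_def algebra_simps)
  have qZ: "quarter Z n = ?zz"
    using n'(2) by (intro ext) (simp add: quarter_def half_def vec_eq_iff algebra_simps)
  have eq3: "L2_inner \<Omega> (dtt k U n) (test_fun n) + A1 (test_fun n) (quarter Z n) + J (quarter U n) (test_fun n)
      = L2_inner \<Omega> (quarter (at_steps k f) n) (test_fun n) + F n (test_fun n)"
    using sol n v unfolding MFD_solution_def by blast
  have eq1: "A1 (u i) ?zz = form_A \<Omega> (q i) ?zz + J1 (z i) ?zz" if "i < N" for i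
  proof -
    have "form_A \<Omega> (q i) ?zz - A1 (u i) ?zz + J1 (z i) ?zz = 0"
      using sol that zz unfolding MFD_solution_def by blast
    then show ?thesis by simp
  qed
  have eq2: "form_A \<Omega> (z i) ?dq = A2 (q i) ?dq - (load (i + 1) ?dq + load i ?dq) / 2" if "i < N" for i
  proof -
    have "A2 (q i) ?dq - form_A \<Omega> (z i) ?dq + half (quadrature \<Omega> B k Q) i ?dq = half G i ?dq"
      using sol that dq unfolding MFD_solution_def by blast
    then show ?thesis by (simp add: half_def load_def field_simps)
  qed
  have t1: "L2_inner \<Omega> (dtt k U n) (test_fun n) = 1 / k * (1 / 2) * (L2_inner \<Omega> (d n) (d n) - L2_inner \<Omega> (d (n - 1)) (d (n - 1)))"
    unfolding dtt_eq test_fun_def by (rule bilinear_on_diff_sum[OF subspace_Vh bil_L2 L2_inner_commute mem1(4) mem0(4)])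
  have t2: "J (quarter U n) (test_fun n) = 1 / k * (1 / 2) * (J (u n) (u n) - J (u (n - 1)) (u (n - 1)))"
    unfolding qU v_eq form_J_commute[of \<zeta> \<alpha> \<Omega> \<T> deg "\<lambda>x. (1/2) *\<^sub>R (u n x + u (n - 1) x)"]
    by (rule bilinear_on_diff_sum[OF subspace_Vh bil_J form_J_commute mem1(1) mem0(1)])
  have t3: "A1 (test_fun n) ?zz = 1 / k * (A1 (u n) ?zz - A1 (u (n - 1)) ?zz)"
    unfolding v_eq using linear_functional_onD(2)[OF bilinear_onD(1)[OF bil_A1 zz] fun_subspace_diff[OF subspace_Vh mem1(1) mem0(1)], of "1/k"]
      linear_functional_on_diff_arg[OF subspace_Vh bilinear_onD(1)[OF bil_A1 zz] mem1(1) mem0(1)] by simp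
  have t4: "J1 (z n) ?zz - J1 (z (n - 1)) ?zz = 1 / 2 * (J1 (z n) (z n) - J1 (z (n - 1)) (z (n - 1)))"
    using bilinear_on_diff_sum[OF subspace_Wh bil_J1 form_J1_commute mem1(3) mem0(3), of 1 "1/2"]
      linear_functional_on_diff_arg[OF subspace_Wh bilinear_onD(1)[OF bil_J1 zz] mem1(3) mem0(3)] by simp
  have comm: "form_A \<Omega> p w = form_A \<Omega> w p" for p w by (simp add: form_A_def inner_commute)
  have t5: "form_A \<Omega> (q n) ?zz - form_A \<Omega> (q (n - 1)) ?zz
      = 1 / 2 * (form_A \<Omega> (z n) ?dq + form_A \<Omega> (z (n - 1)) ?dq)"
  proof -
    have "form_A \<Omega> (q n) ?zz - form_A \<Omega> (q (n - 1)) ?zz = form_A \<Omega> ?zz ?dq"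
      using linear_functional_on_diff_arg[OF subspace_Wh bilinear_onD(2)[OF bil_A zz] mem1(2) mem0(2)]
      by (simp only: comm[of "q n"] comm[of "q (n - 1)"])
    also have "\<dots> = 1 / 2 * form_A \<Omega> (\<lambda>x. z n x + z (n - 1) x) ?dq"
      by (rule linear_functional_onD(2)[OF bilinear_onD(1)[OF bil_A dq] fun_subspaceD(2)[OF subspace_Wh mem1(3) mem0(3)]])
    also have "form_A \<Omega> (\<lambda>x. z n x + z (n - 1) x) ?dq = form_A \<Omega> (z n) ?dq + form_A \<Omega> (z (n - 1)) ?dq"
      by (rule linear_functional_onD(1)[OF bilinear_onD(1)[OF bil_A dq] mem1(3) mem0(3)])
    finally show ?thesis .
  qed
  \<comment> \<open>the cross terms cancel because \<open>A\<close> is symmetric\<close>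
  have t6: "A2 (q n) ?dq + A2 (q (n - 1)) ?dq = A2 (q n) (q n) - A2 (q (n - 1)) (q (n - 1))"
    using linear_functional_on_diff_arg[OF subspace_Wh bilinear_onD(2)[OF bil_A2 mem1(2)] mem1(2) mem0(2)]
      linear_functional_on_diff_arg[OF subspace_Wh bilinear_onD(2)[OF bil_A2 mem0(2)] mem1(2) mem0(2)]
      form_A2_commute[OF A, of "q n" "q (n - 1)"] by simp
  have t7: "mean_load n ?dq = mean_load n (q n) - mean_load n (q (n - 1))"
    by (rule linear_functional_on_diff_arg[OF subspace_Wh linear_mean_load[OF n(2)] mem1(2) mem0(2)])
  have FA: "form_A \<Omega> (q n) ?zz - form_A \<Omega> (q (n - 1)) ?zz
      = 1 / 2 * (A2 (q n) (q n) - A2 (q (n - 1)) (q (n - 1))) - mean_load n ?dq"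
    using t5 eq2[OF n(2)] eq2[OF n'(1)] t6 n'(2) by (simp add: mean_load_def field_simps)
  have "A1 (u n) ?zz - A1 (u (n - 1)) ?zz = 1 / 2 * (A2 (q n) (q n) - A2 (q (n - 1)) (q (n - 1)))
      - mean_load n ?dq + 1 / 2 * (J1 (z n) (z n) - J1 (z (n - 1)) (z (n - 1)))"
  proof -
    have "A1 (u n) ?zz - A1 (u (n - 1)) ?zz = (form_A \<Omega> (q n) ?zz - form_A \<Omega> (q (n - 1)) ?zz)
        + (J1 (z n) ?zz - J1 (z (n - 1)) ?zz)"
      unfolding eq1[OF n(2)] eq1[OF n'(1)] by simp
    then show ?thesis unfolding FA t4 .
  qed
  then have t8: "A1 (test_fun n) (quarter Z n) = 1 / k * (1 / 2 * (A2 (q n) (q n) - A2 (q (n - 1)) (q (n - 1)))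
      - mean_load n ?dq + 1 / 2 * (J1 (z n) (z n) - J1 (z (n - 1)) (z (n - 1))))"
    unfolding qZ t3 by simp
  have "2 * k * (L2_inner \<Omega> (dtt k U n) (test_fun n) + A1 (test_fun n) (quarter Z n) + J (quarter U n) (test_fun n))
      = energy_sum n - energy_sum (n - 1) - 2 * mean_load n ?dq"
    unfolding t1 t2 t8 using k by (simp add: energy_sum_def field_simps)
  then show ?thesis unfolding eq3 using t7 by (simp add: algebra_simps)
qed

text \<open>The triple norm is the square root of a sum of nonnegative terms, so its square is that sum and it
dominates every term; ellipticity turns the weighted norm of the flux into the plain one.\<close>

lemma energy_power2: "n < N \<Longrightarrow> (energy n)\<^sup>2 = energy_sum n"
  and d_le_energy: "n < N \<Longrightarrow> L2_norm \<Omega> (d n) \<le> energy n"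
  and q_le_energy: "n < N \<Longrightarrow> L2_norm \<Omega> (q n) \<le> energy n / sqrt \<alpha>\<^sub>0"
  and energy_nonneg: "energy n \<ge> 0"
proof -
  have p: "J (u n) (u n) \<ge> 0" "J1 (z n) (z n) \<ge> 0" for n
    using form_J_nonneg[OF mesh \<zeta>] form_J1_nonneg[OF mesh \<kappa>] by auto
  have e: "energy n = sqrt ((L2_norm \<Omega> (d n))\<^sup>2 + A2 (q n) (q n) + J1 (z n) (z n) + J (u n) (u n))" for n
    by (simp add: energy_norm_def L2_norm_matrix_sqrt[OF A])
  have A2: "A2 (q n) (q n) \<ge> 0" for n
    using L2_norm_matrix_sqrt[OF A, of "q n"] zero_le_power2 by metis
  show "energy n \<ge> 0" by (simp add: e p A2)
  show "(energy n)\<^sup>2 = energy_sum n" by (simp add: e p A2 energy_sum_def L2_norm_power2 L2_inner_self_nonneg)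
  show "L2_norm \<Omega> (d n) \<le> energy n"
    unfolding e using p[of n] A2[of n] by (intro real_le_rsqrt) auto
  assume n: "n < N"
  have "\<alpha>\<^sub>0 * (L2_norm \<Omega> (q n))\<^sup>2 \<le> A2 (q n) (q n)"
    by (rule form_A2_coercive[OF A \<Omega>_sets Wh_L2[OF half_mem_Vh_Wh(2)[OF n]]])
  then have "(sqrt \<alpha>\<^sub>0 * L2_norm \<Omega> (q n))\<^sup>2 \<le> (L2_norm \<Omega> (d n))\<^sup>2 + A2 (q n) (q n) + J1 (z n) (z n) + J (u n) (u n)"
  proof -
    have "(sqrt \<alpha>\<^sub>0 * L2_norm \<Omega> (q n))\<^sup>2 = \<alpha>\<^sub>0 * (L2_norm \<Omega> (q n))\<^sup>2"
      using \<alpha>\<^sub>0 by (simp add: power_mult_distrib)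
    moreover note \<open>\<alpha>\<^sub>0 * (L2_norm \<Omega> (q n))\<^sup>2 \<le> A2 (q n) (q n)\<close>
    ultimately show ?thesis
      using p[of n] zero_le_power2[of "L2_norm \<Omega> (d n)"] by linarith
  qed
  then have "sqrt \<alpha>\<^sub>0 * L2_norm \<Omega> (q n) \<le> energy n" unfolding e by (rule real_le_rsqrt)
  then show "L2_norm \<Omega> (q n) \<le> energy n / sqrt \<alpha>\<^sub>0" using \<alpha>\<^sub>0 by (simp add: field_simps)
qed

abbreviation "f_norm n \<equiv> L2_norm \<Omega> (at_steps k f n)"
abbreviation "F_norm n \<equiv> dual_norm \<Omega> Vh (F n)"
abbreviation "G_norm n \<equiv> dual_norm \<Omega> Wh (dt k G n)"

lemma linear_dt_G: "n < N \<Longrightarrow> linear_functional_on Wh (dt k G n)"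
  unfolding dt_def real_scaleR_def
  by (intro linear_functional_on_cmult linear_functional_on_diff G) auto

text \<open>The bound that the summation by parts uses for the difference quotient of the load: the norm of
\<open>\<partial>\<^sub>tG\<close> and the bound of \<open>quadrature_step\<close>.\<close>

definition load_rate :: "nat \<Rightarrow> real" where
  "load_rate n = G_norm n + 4 * M * (L2_norm \<Omega> (q n) + k * (\<Sum>j<n. L2_norm \<Omega> (q j)))"

lemma load_step:
  assumes n: "n < N" and \<tau>: "\<tau> \<in> Wh"
  shows "\<bar>load (n + 1) \<tau> - load n \<tau>\<bar> \<le> k * load_rate n * L2_norm \<Omega> \<tau>"
proof -
  have "G (n + 1) \<tau> - G n \<tau> = k * dt k G n \<tau>" using k by (simp add: dt_def)
  moreover have "\<bar>k * dt k G n \<tau>\<bar> \<le> k * (G_norm n * L2_norm \<Omega> \<tau>)"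
    unfolding abs_mult using k dual_norm_W_space(2)[OF mesh open_\<Omega> convex_\<Omega> lmeas linear_dt_G[OF n] \<tau>]
    by (simp add: mult_left_mono)
  moreover have "\<bar>quadrature \<Omega> B k Q (n + 1) \<tau> - quadrature \<Omega> B k Q n \<tau>\<bar>
    \<le> k * (4 * M * (L2_norm \<Omega> (q n) + k * (\<Sum>j<n. L2_norm \<Omega> (q j)))) * L2_norm \<Omega> \<tau>"
    using n nk[of "n + 1"] Wh_L2[OF half_mem_Vh_Wh(2)] Wh_L2[OF \<tau>]
    by (intro quadrature_step[OF B M \<Omega>_sets k]) auto
  ultimately show ?thesis unfolding load_def load_rate_def by (simp add: algebra_simps)
qed

text \<open>The double sum over the history of the flux costs only a factor \<open>T\<close>, since each flux is counted at most
\<open>T/k\<close> times with weight \<open>k\<close>.\<close>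

lemma sum_load_rate:
  assumes "l < N"
  shows "(\<Sum>n\<le>l. load_rate n) \<le> (\<Sum>n=0..l. G_norm n) + 4 * M * (1 + T) / sqrt \<alpha>\<^sub>0 * (\<Sum>n\<le>l. energy n)"
proof -
  let ?q = "\<lambda>n. L2_norm \<Omega> (q n)"
  have "(\<Sum>n\<le>l. \<Sum>j<n. ?q j) \<le> (\<Sum>n\<le>l. \<Sum>j\<le>l. ?q j)"
    by (intro sum_mono sum_mono2) auto
  then have "k * (\<Sum>n\<le>l. \<Sum>j<n. ?q j) \<le> k * (\<Sum>n\<le>l. \<Sum>j\<le>l. ?q j)"
    using k by (intro mult_left_mono) auto
  also have "\<dots> = (real (l + 1) * k) * (\<Sum>j\<le>l. ?q j)" by simp
  also have "\<dots> \<le> T * (\<Sum>j\<le>l. ?q j)"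
    using nk[of "l + 1"] assms by (intro mult_right_mono sum_nonneg) auto
  finally have 1: "k * (\<Sum>n\<le>l. \<Sum>j<n. ?q j) \<le> T * (\<Sum>j\<le>l. ?q j)" .
  have T: "T \<ge> 0" using nk[of 0] by simp
  have 2: "(\<Sum>j\<le>l. ?q j) \<le> (\<Sum>n\<le>l. energy n) / sqrt \<alpha>\<^sub>0"
    unfolding sum_divide_distrib using assms by (intro sum_mono q_le_energy) auto
  have "(\<Sum>n\<le>l. load_rate n) = (\<Sum>n=0..l. G_norm n) + 4 * M * ((\<Sum>n\<le>l. ?q n) + k * (\<Sum>n\<le>l. \<Sum>j<n. ?q j))"
    by (simp add: load_rate_def sum.distrib sum_distrib_left algebra_simps atMost_atLeast0)
  also have "\<dots> \<le> (\<Sum>n=0..l. G_norm n) + 4 * M * ((1 + T) * ((\<Sum>n\<le>l. energy n) / sqrt \<alpha>\<^sub>0))"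
  proof (intro add_left_mono mult_left_mono)
    have "(\<Sum>n\<le>l. ?q n) + k * (\<Sum>n\<le>l. \<Sum>j<n. ?q j) \<le> (1 + T) * (\<Sum>n\<le>l. ?q n)"
      using 1 by (simp add: algebra_simps)
    also have "\<dots> \<le> (1 + T) * ((\<Sum>n\<le>l. energy n) / sqrt \<alpha>\<^sub>0)" using 2 T by (intro mult_left_mono) auto
    finally show "(\<Sum>n\<le>l. ?q n) + k * (\<Sum>n\<le>l. \<Sum>j<n. ?q j) \<le> (1 + T) * ((\<Sum>n\<le>l. energy n) / sqrt \<alpha>\<^sub>0)" .
  qed (use M in simp)
  finally show ?thesis by simp
qed

lemma forcing_bound:
  assumes n: "1 \<le> n" "n < N" and P: "L2_norm \<Omega> (d n) \<le> P" "L2_norm \<Omega> (d (n - 1)) \<le> P"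
  shows "\<bar>L2_inner \<Omega> (quarter (at_steps k f) n) (test_fun n)\<bar> \<le> (f_norm (n + 1) + 2 * f_norm n + f_norm (n - 1)) / 4 * P"
    and "\<bar>F n (test_fun n)\<bar> \<le> F_norm n * P"
proof -
  have n': "n - 1 < N" using n by simp
  note d1 = half_mem_Vh_Wh(4)[OF n(2)] and d0 = half_mem_Vh_Wh(4)[OF n']
  have sumd: "(\<lambda>x. d n x + d (n - 1) x) \<in> Vh" by (rule fun_subspaceD(2)[OF subspace_Vh d1 d0])
  have v: "test_fun n \<in> Vh" unfolding test_fun_def by (rule fun_subspaceD(3)[OF subspace_Vh sumd])
  have test: "\<bar>L2_inner \<Omega> g (test_fun n)\<bar> \<le> L2_norm \<Omega> g * P" if g: "L2 \<Omega> g" for g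
  proof -
    have "linear_functional_on {v. L2 \<Omega> v} (L2_inner \<Omega> g)" using bilinear_onD(2)[OF bilinear_on_L2_inner] g by blast
    then have lin: "linear_functional_on Vh (L2_inner \<Omega> g)"
      by (rule linear_functional_on_subset) (use Vh_L2 in blast)
    have "\<bar>L2_inner \<Omega> g (d n)\<bar> \<le> L2_norm \<Omega> g * P"
      by (rule order_trans[OF L2_Cauchy_Schwarz[OF g Vh_L2[OF d1]] mult_left_mono[OF P(1)]]) simp
    moreover have "\<bar>L2_inner \<Omega> g (d (n - 1))\<bar> \<le> L2_norm \<Omega> g * P"
      by (rule order_trans[OF L2_Cauchy_Schwarz[OF g Vh_L2[OF d0]] mult_left_mono[OF P(2)]]) simp
    moreover have "L2_inner \<Omega> g (test_fun n) = (L2_inner \<Omega> g (d n) + L2_inner \<Omega> g (d (n - 1))) / 2"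
      unfolding test_fun_def using linear_functional_onD(2)[OF lin sumd, of "1/2"] linear_functional_onD(1)[OF lin d1 d0]
      by simp
    ultimately show ?thesis using abs_average_le by metis
  qed
  have fL2: "L2 \<Omega> (at_steps k f (n + 1))" "L2 \<Omega> (at_steps k f n)" "L2 \<Omega> (at_steps k f (n - 1))"
    using f n by auto
  have lin: "linear_functional_on {g. L2 \<Omega> g} (\<lambda>g. L2_inner \<Omega> g (test_fun n))"
    using bilinear_onD(1)[OF bilinear_on_L2_inner] Vh_L2[OF v] by blast
  have "L2_inner \<Omega> (quarter (at_steps k f) n) (test_fun n) = (L2_inner \<Omega> (at_steps k f (n + 1)) (test_fun n)
      + 2 * L2_inner \<Omega> (at_steps k f n) (test_fun n) + L2_inner \<Omega> (at_steps k f (n - 1)) (test_fun n)) / 4"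
  proof -
    let ?L = "{g. L2 \<Omega> (g :: pt \<Rightarrow> real)}"
    have m2: "(\<lambda>x. 2 *\<^sub>R at_steps k f n x) \<in> ?L" using fun_subspaceD(3)[OF fun_subspace_L2] fL2(2) by blast
    have m3: "(\<lambda>x. at_steps k f (n + 1) x + 2 *\<^sub>R at_steps k f n x) \<in> ?L"
      using fun_subspaceD(2)[OF fun_subspace_L2 _ m2] fL2(1) by blast
    have m4: "(\<lambda>x. at_steps k f (n + 1) x + 2 *\<^sub>R at_steps k f n x + at_steps k f (n - 1) x) \<in> ?L"
      using fun_subspaceD(2)[OF fun_subspace_L2 m3] fL2(3) by blast
    show ?thesis unfolding quarter_def
      using linear_functional_onD(2)[OF lin m4, of "1/4"] linear_functional_onD(1)[OF lin m3, of "at_steps k f (n - 1)"]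
        linear_functional_onD(1)[OF lin _ m2, of "at_steps k f (n + 1)"]
        linear_functional_onD(2)[OF lin, of "at_steps k f n" 2] fL2
      by simp
  qed
  then show "\<bar>L2_inner \<Omega> (quarter (at_steps k f) n) (test_fun n)\<bar> \<le> (f_norm (n + 1) + 2 * f_norm n + f_norm (n - 1)) / 4 * P"
    using abs_weighted_average_le[OF test[OF fL2(1)] test[OF fL2(2)] test[OF fL2(3)]]
    by (simp add: algebra_simps)
  have "F n (test_fun n) = (F n (d n) + F n (d (n - 1))) / 2"
    unfolding test_fun_def using linear_functional_onD(2)[OF F[OF n] sumd, of "1/2"]
      linear_functional_onD(1)[OF F[OF n] d1 d0] by simp
  moreover note dual = dual_norm_V_space[OF mesh open_\<Omega> convex_\<Omega> lmeas F[OF n]]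
  have "\<bar>F n (d n)\<bar> \<le> F_norm n * P"
    by (rule order_trans[OF dual(2)[OF d1] mult_left_mono[OF P(1) dual(1)]])
  moreover have "\<bar>F n (d (n - 1))\<bar> \<le> F_norm n * P"
    by (rule order_trans[OF dual(2)[OF d0] mult_left_mono[OF P(2) dual(1)]])
  ultimately show "\<bar>F n (test_fun n)\<bar> \<le> F_norm n * P" using abs_average_le by metis
qed

text \<open>The data as they enter the energy inequality. The factor \<open>6\<close> comes from the \<open>3\<close> of the summation by
parts and the \<open>2\<close> of the energy identity, and \<open>1 / sqrt \<alpha>\<^sub>0\<close> from bounding the flux by the energy.\<close>

definition data_sum :: "nat \<Rightarrow> real" where
  "data_sum l = 2 * k * (\<Sum>n=0..l+1. f_norm n) + 2 * k * (\<Sum>n=1..l. F_norm n) + 6 / sqrt \<alpha>\<^sub>0 * (k * (\<Sum>n=0..l. G_norm n))"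

text \<open>Sum the energy identity. Velocities and fluxes are bounded by \<open>P\<close>, the first directly and the second up to
\<open>1 / sqrt \<alpha>\<^sub>0\<close>; the memory term brings a further factor \<open>1 / sqrt \<alpha>\<^sub>0\<close> for the flux in the history.\<close>

lemma energy_inequality:
  assumes l: "l < N" and P: "\<And>j. j \<le> l \<Longrightarrow> energy j \<le> P"
  shows "(energy l)\<^sup>2 \<le> (energy 0)\<^sup>2 + P * (data_sum l + 24 * M * (1 + T) / \<alpha>\<^sub>0 * k * (\<Sum>j\<le>l. energy j))"
proof -
  have P0: "P \<ge> 0" using P[of 0] energy_nonneg[of 0] by simp
  define S where "S = (\<Sum>n=1..l. mean_load n (q n) - mean_load n (q (n - 1)))"
  have "energy_sum l = energy_sum 0 + (\<Sum>n=1..l. energy_sum n - energy_sum (n - 1))"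
    by (induction l) auto
  also have "(\<Sum>n=1..l. energy_sum n - energy_sum (n - 1)) = (\<Sum>n=1..l. 2 * k * L2_inner \<Omega> (quarter (at_steps k f) n) (test_fun n)
      + 2 * k * F n (test_fun n) + 2 * (mean_load n (q n) - mean_load n (q (n - 1))))"
    by (rule sum.cong[OF refl], rule energy_step) (use l in auto)
  also have "\<dots> = 2 * k * (\<Sum>n=1..l. L2_inner \<Omega> (quarter (at_steps k f) n) (test_fun n))
      + 2 * k * (\<Sum>n=1..l. F n (test_fun n)) + 2 * S"
    by (simp add: S_def sum.distrib sum_distrib_left)
  finally have expand: "energy_sum l = energy_sum 0 + (2 * k * (\<Sum>n=1..l. L2_inner \<Omega> (quarter (at_steps k f) n) (test_fun n))
      + 2 * k * (\<Sum>n=1..l. F n (test_fun n)) + 2 * S)" .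
  have dP: "L2_norm \<Omega> (d n) \<le> P" if "n \<le> l" for n
    using order_trans[OF d_le_energy P[OF that]] that l by simp
  have b1: "(\<Sum>n=1..l. L2_inner \<Omega> (quarter (at_steps k f) n) (test_fun n)) \<le> (\<Sum>n=0..l+1. f_norm n) * P"
  proof -
    have "(\<Sum>n=1..l. L2_inner \<Omega> (quarter (at_steps k f) n) (test_fun n))
        \<le> (\<Sum>n=1..l. (f_norm (n + 1) + 2 * f_norm n + f_norm (n - 1)) / 4 * P)"
      by (intro sum_mono order_trans[OF abs_ge_self forcing_bound(1)] dP) (use l in auto)
    also have "\<dots> = (\<Sum>n=1..l. (f_norm (n + 1) + 2 * f_norm n + f_norm (n - 1)) / 4) * P" by (rule sum_distrib_right[symmetric])
    also have "\<dots> \<le> (\<Sum>n=0..l+1. f_norm n) * P" by (intro mult_right_mono averaged_sum_le P0) simp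
    finally show ?thesis .
  qed
  have b2: "(\<Sum>n=1..l. F n (test_fun n)) \<le> (\<Sum>n=1..l. F_norm n) * P"
    unfolding sum_distrib_right
    by (intro sum_mono order_trans[OF abs_ge_self forcing_bound(2)] dP) (use l in auto)
  have b3: "\<bar>S\<bar> \<le> 3 * (\<Sum>n\<le>l. k * load_rate n * (P / sqrt \<alpha>\<^sub>0))"
    unfolding S_def
  proof (rule averaged_sum_by_parts_bound[where H = "\<lambda>n i. load n (q i)"])
    show "load 0 (q i) = 0" if "i \<le> l" for i
      using G0[OF half_mem_Vh_Wh(2)] that l by (simp add: load_def quadrature_def)
    show "\<bar>load (n + 1) (q i) - load n (q i)\<bar> \<le> k * load_rate n * (P / sqrt \<alpha>\<^sub>0)" if ni: "n \<le> l" "i \<le> l" for n i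
    proof -
      have i: "i < N" and n: "n < N" using ni l by auto
      have "L2_norm \<Omega> (q i) \<le> P / sqrt \<alpha>\<^sub>0"
        using order_trans[OF q_le_energy[OF i] divide_right_mono[OF P[OF ni(2)]]] \<alpha>\<^sub>0 by simp
      moreover have "k * load_rate n \<ge> 0"
        using k M dual_norm_W_space(1)[OF mesh open_\<Omega> convex_\<Omega> lmeas linear_dt_G[OF n]]
        by (auto simp: load_rate_def intro!: mult_nonneg_nonneg add_nonneg_nonneg sum_nonneg)
      ultimately show ?thesis
        by (intro order_trans[OF load_step[OF n half_mem_Vh_Wh(2)[OF i]]] mult_left_mono)
    qed
  qed (simp add: mean_load_def)
  also have "\<dots> = 3 * (k * (P / sqrt \<alpha>\<^sub>0)) * (\<Sum>n\<le>l. load_rate n)" by (simp add: sum_distrib_left mult_ac)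
  also have "\<dots> \<le> 3 * (k * (P / sqrt \<alpha>\<^sub>0)) * ((\<Sum>n=0..l. G_norm n) + 4 * M * (1 + T) / sqrt \<alpha>\<^sub>0 * (\<Sum>n\<le>l. energy n))"
    using k P0 \<alpha>\<^sub>0 by (intro mult_left_mono sum_load_rate[OF l]) auto
  also have "\<dots> = P * (3 / sqrt \<alpha>\<^sub>0 * (k * (\<Sum>n=0..l. G_norm n)) + 12 * M * (1 + T) / \<alpha>\<^sub>0 * k * (\<Sum>n\<le>l. energy n))"
  proof -
    have "3 * (k * (P * r)) * (g + 4 * M * (1 + T) * r * e)
        = P * (3 * r * (k * g) + 12 * M * (1 + T) * (r * r) * k * e)" for g e r
      by (simp add: algebra_simps)
    from this[of "1 / sqrt \<alpha>\<^sub>0"] show ?thesis using \<alpha>\<^sub>0 by simp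
  qed
  finally have b3: "S \<le> P * (3 / sqrt \<alpha>\<^sub>0 * (k * (\<Sum>n=0..l. G_norm n)) + 12 * M * (1 + T) / \<alpha>\<^sub>0 * k * (\<Sum>n\<le>l. energy n))"
    by simp
  have "2 * k * (\<Sum>n=1..l. L2_inner \<Omega> (quarter (at_steps k f) n) (test_fun n)) \<le> 2 * k * ((\<Sum>n=0..l+1. f_norm n) * P)"
    using b1 k by (intro mult_left_mono) auto
  moreover have "2 * k * (\<Sum>n=1..l. F n (test_fun n)) \<le> 2 * k * ((\<Sum>n=1..l. F_norm n) * P)"
    using b2 k by (intro mult_left_mono) auto
  ultimately have "energy_sum l \<le> energy_sum 0 + (2 * k * ((\<Sum>n=0..l+1. f_norm n) * P) + 2 * k * ((\<Sum>n=1..l. F_norm n) * P)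
      + 2 * (P * (3 / sqrt \<alpha>\<^sub>0 * (k * (\<Sum>n=0..l. G_norm n)) + 12 * M * (1 + T) / \<alpha>\<^sub>0 * k * (\<Sum>n\<le>l. energy n))))"
    unfolding expand using b3 by linarith
  also have "\<dots> = energy_sum 0 + P * (data_sum l + 24 * M * (1 + T) / \<alpha>\<^sub>0 * k * (\<Sum>j\<le>l. energy j))"
    by (simp add: data_sum_def algebra_simps)
  finally show ?thesis using l by (simp add: energy_power2)
qed

text \<open>The Gronwall factor \<open>(1 + 2ck)\<^sup>m\<close> stays below \<open>exp (2cT)\<close> because \<open>mk \<le> T\<close>.\<close>

lemma stability:
  assumes m: "m < N" and ck: "24 * M * (1 + T) / \<alpha>\<^sub>0 * k \<le> 1 / 2"
  shows "energy m \<le> 2 * exp (2 * (24 * M * (1 + T) / \<alpha>\<^sub>0) * T) * (2 + 6 / sqrt \<alpha>\<^sub>0)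
    * (energy 0 + k * (\<Sum>n=0..m+1. f_norm n) + k * (\<Sum>n=1..m. F_norm n) + k * (\<Sum>n=0..m. G_norm n))"
proof -
  define c where "c = 24 * M * (1 + T) / \<alpha>\<^sub>0"
  have T: "T \<ge> 0" using nk[of 0] by simp
  have c: "c \<ge> 0" using M T \<alpha>\<^sub>0 by (simp add: c_def)
  have F_norm: "F_norm n \<ge> 0" if "1 \<le> n" "n \<le> m" for n
    using that m by (intro dual_norm_V_space(1)[OF mesh open_\<Omega> convex_\<Omega> lmeas F]) auto
  have G_norm: "G_norm n \<ge> 0" if "n \<le> m" for n
    using that m by (intro dual_norm_W_space(1)[OF mesh open_\<Omega> convex_\<Omega> lmeas linear_dt_G]) auto
  have sums: "(\<Sum>n=0..m+1. f_norm n) \<ge> 0" "(\<Sum>n=1..m. F_norm n) \<ge> 0" "(\<Sum>n=0..m. G_norm n) \<ge> 0"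
    using F_norm G_norm by (intro sum_nonneg; simp)+
  have data_sum_nonneg: "data_sum m \<ge> 0"
    unfolding data_sum_def using k \<alpha>\<^sub>0 sums by (intro add_nonneg_nonneg mult_nonneg_nonneg) auto
  have data_sum_mono: "data_sum n \<le> data_sum m" if "n \<le> m" for n
    unfolding data_sum_def using that k \<alpha>\<^sub>0 F_norm G_norm by (intro add_mono mult_left_mono sum_mono2) auto
  have "energy m \<le> 2 * (energy 0 + data_sum m) * (1 + 2 * (c * k)) ^ m"
  proof (rule quadratic_Gronwall)
    show "0 \<le> c * k" using c k by simp
    show "2 * (c * k) \<le> 1" using ck by (simp add: c_def)
    show "(energy n)\<^sup>2 \<le> (energy 0)\<^sup>2 + P * (data_sum n + c * k * (\<Sum>j\<le>n. energy j))"
      if "n \<le> m" "\<And>j. j \<le> n \<Longrightarrow> energy j \<le> P" for n P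
      using energy_inequality[of n P] that m by (simp add: c_def)
  qed (use energy_nonneg data_sum_nonneg data_sum_mono in auto)
  also have "\<dots> \<le> 2 * ((2 + 6 / sqrt \<alpha>\<^sub>0)
      * (energy 0 + k * (\<Sum>n=0..m+1. f_norm n) + k * (\<Sum>n=1..m. F_norm n) + k * (\<Sum>n=0..m. G_norm n))) * exp (2 * c * T)"
  proof (intro mult_mono)
    let ?f = "k * (\<Sum>n=0..m+1. f_norm n)" and ?F = "k * (\<Sum>n=1..m. F_norm n)" and ?G = "k * (\<Sum>n=0..m. G_norm n)"
    have nn: "?f \<ge> 0" "?F \<ge> 0" "?G \<ge> 0" 
      using k sums by (auto intro: mult_nonneg_nonneg simp del: sum.atLeast0_atMost_Suc)
    have s: "6 / sqrt \<alpha>\<^sub>0 \<ge> 0" using \<alpha>\<^sub>0 by simp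
    have "data_sum m = 2 * ?f + 2 * ?F + 6 / sqrt \<alpha>\<^sub>0 * ?G" by (simp add: data_sum_def)
    moreover have "0 \<le> 6 / sqrt \<alpha>\<^sub>0 * ?f" "0 \<le> 6 / sqrt \<alpha>\<^sub>0 * ?F" "0 \<le> 6 / sqrt \<alpha>\<^sub>0 * energy 0"
      using s nn energy_nonneg[of 0] by (auto intro: mult_nonneg_nonneg)
    moreover have "(2 + 6 / sqrt \<alpha>\<^sub>0) * (energy 0 + ?f + ?F + ?G) = 2 * energy 0 + 2 * ?f + 2 * ?F + 2 * ?G
        + (6 / sqrt \<alpha>\<^sub>0 * energy 0 + 6 / sqrt \<alpha>\<^sub>0 * ?f + 6 / sqrt \<alpha>\<^sub>0 * ?F + 6 / sqrt \<alpha>\<^sub>0 * ?G)"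
      by (simp only: distrib_left distrib_right)
    ultimately show le: "energy 0 + data_sum m \<le> (2 + 6 / sqrt \<alpha>\<^sub>0) * (energy 0 + ?f + ?F + ?G)"
      using nn energy_nonneg[of 0] by linarith
    have "(1 + 2 * (c * k)) ^ m \<le> exp (2 * (c * k)) ^ m"
      using c k by (intro power_mono exp_ge_add_one_self) auto
    also have "\<dots> = exp (2 * c * (real m * k))" by (simp add: exp_of_nat_mult[symmetric] mult_ac)
    also have "\<dots> \<le> exp (2 * c * T)" using nk[of m] m c by (simp add: mult_left_mono)
    finally show "(1 + 2 * (c * k)) ^ m \<le> exp (2 * c * T)" .
    show "0 \<le> (1 + 2 * (c * k)) ^ m" using c k by simp
    show "0 \<le> 2 * ((2 + 6 / sqrt \<alpha>\<^sub>0) * (energy 0 + ?f + ?F + ?G))"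
      using nn s energy_nonneg[of 0] by simp
  qed (use data_sum_nonneg energy_nonneg[of 0] in auto)
  finally show ?thesis by (simp add: c_def mult_ac)
qed

end

theorem theorem6p1:
  fixes \<Omega> :: "pt set"
    and T \<alpha>\<^sub>0 M \<sigma> \<delta> \<zeta> \<kappa> \<alpha> \<beta> c\<^sub>0 c\<^sub>1 :: real
    and A :: "pt \<Rightarrow> mat2" and B :: "pt \<Rightarrow> real \<Rightarrow> real \<Rightarrow> mat2"
  assumes "open \<Omega>" "\<Omega> \<noteq> {}" "bounded \<Omega>" "convex \<Omega>"
    and "T > 0" "\<alpha>\<^sub>0 > 0" "M > 0"
    and "elliptic_coeff \<Omega> \<alpha>\<^sub>0 M A" and "memory_coeff \<Omega> T M B"
    and "\<sigma> > 0" "\<delta> > 0" "c\<^sub>0 > 0" "c\<^sub>1 > 0"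
    and "\<zeta> > 0" "\<kappa> \<ge> 0" "-1 \<le> \<alpha>" "\<alpha> \<le> 0" "0 \<le> \<beta>" "\<beta> \<le> 1"
  shows "\<exists>C > 0. \<exists>k\<^sub>0 > 0.
    \<forall>(\<T> :: element set) (deg :: element \<Rightarrow> nat) (C12 :: pt \<Rightarrow> pt)
      (N :: nat) (k :: real) (f :: pt \<Rightarrow> real \<Rightarrow> real)
      (F :: nat \<Rightarrow> (pt \<Rightarrow> real) \<Rightarrow> real) (G :: nat \<Rightarrow> (pt \<Rightarrow> pt) \<Rightarrow> real)
      (U :: nat \<Rightarrow> pt \<Rightarrow> real) (Q :: nat \<Rightarrow> pt \<Rightarrow> pt) (Z :: nat \<Rightarrow> pt \<Rightarrow> pt) (m :: nat).
      admissible_mesh \<Omega> \<sigma> \<delta> \<T> deg \<longrightarrow>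
      admissible_C12 c\<^sub>0 c\<^sub>1 \<T> C12 \<longrightarrow>
      N \<ge> 1 \<longrightarrow> k = T / real N \<longrightarrow> 0 < k \<longrightarrow> k < 1 \<longrightarrow> k \<le> k\<^sub>0 \<longrightarrow>
      (\<forall>t\<in>{0..T}. L2 \<Omega> (\<lambda>x. f x t)) \<longrightarrow>
      (\<forall>n. 1 \<le> n \<and> n < N \<longrightarrow> linear_functional_on (V_space \<T> deg) (F n)) \<longrightarrow>
      (\<forall>n\<le>N. linear_functional_on (W_space \<T> deg) (G n)) \<longrightarrow>
      (\<forall>\<tau>\<in>W_space \<T> deg. G 0 \<tau> = 0) \<longrightarrow>
      MFD_solution \<Omega> A B \<T> deg \<zeta> \<alpha> \<kappa> \<beta> C12 k N f F G U Q Z \<longrightarrow>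
      m \<ge> 1 \<longrightarrow> real (m + 1) * k \<le> T \<longrightarrow>
      energy_norm \<Omega> A \<T> deg \<zeta> \<alpha> \<kappa> \<beta> k U Q Z m
        \<le> C * (energy_norm \<Omega> A \<T> deg \<zeta> \<alpha> \<kappa> \<beta> k U Q Z 0
               + k * (\<Sum>n=0..m+1. L2_norm \<Omega> (at_steps k f n))
               + k * (\<Sum>n=1..m. dual_norm \<Omega> (V_space \<T> deg) (F n))
               + k * (\<Sum>n=0..m. dual_norm \<Omega> (W_space \<T> deg) (dt k G n)))"
proof -
  define c where "c = 24 * M * (1 + T) / \<alpha>\<^sub>0"
  define C where "C = 2 * exp (2 * c * T) * (2 + 6 / sqrt \<alpha>\<^sub>0)"
  \<comment> \<open>\<open>k\<^sub>0\<close> is the largest step for which the implicit term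
    can be absorbed, \<open>c k \<le> 1/2\<close>\<close>
  define k\<^sub>0 where "k\<^sub>0 = 1 / (2 * c)"
  have c: "c > 0" using assms by (simp add: c_def)
  have lmeas: "\<Omega> \<in> lmeasurable" using assms by (simp add: lmeasurable_open)
  show ?thesis
  proof (rule exI[of _ C], intro conjI, goal_cases)
    case 1
    have "6 / sqrt \<alpha>\<^sub>0 > 0" using assms by simp
    then show ?case by (simp add: C_def add_pos_pos)
  next
    case 2
    show ?case
    proof (rule exI[of _ k\<^sub>0], intro conjI allI impI, goal_cases)
      case 1
      show ?case using c by (simp add: k\<^sub>0_def)
    next
      case (2 \<T> deg C12 N k f F G U Q Z m)
      have Nk: "real N * k = T" using 2 by simp
      have "real (m + 1) * k \<le> real N * k" using 2 Nk by simp
      then have "real (m + 1) \<le> real N" using 2(5) by (simp only: mult_le_cancel_right_pos)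
      then have m: "m < N" by simp
      interpret MFD_scheme \<Omega> T \<alpha>\<^sub>0 M \<zeta> \<kappa> \<alpha> \<beta> c\<^sub>0 c\<^sub>1 k A B \<T> deg C12 N f F G U Q Z
      proof
        show "L2 \<Omega> (at_steps k f n)" if "n \<le> N" for n
        proof -
          have "real n * k \<le> real N * k" using that 2(5) by (intro mult_right_mono) auto
          then have "real n * k \<in> {0..T}" using Nk 2(5) by simp
          then show ?thesis using 2(8) by (auto simp: at_steps_def)
        qed
      qed (use assms 2 lmeas Nk in \<open>auto simp: admissible_mesh_def\<close>)
      have "c * k \<le> 1 / 2" using 2(7) c by (simp add: k\<^sub>0_def field_simps)
      then show ?case using stability[OF m] unfolding C_def c_def by simp
    qed
  qed
qed

end
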